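(* Let $\{(\mathcal{A}_i,\varphi_i):i\in I\}$ be a family of noncommutative probability spaces, let $\mathcal{A}=*_{i\in I}\mathcal{A}_i$ be the free product without identification of units, and let $\psi(w):\mathcal{A}\to\mathbb{C}$, $w\in\mathcal{M}^*$, be the linear Motzkin functionals. Then: (1) for the free product of the functionals $\varphi_i$, $$(\star_{i\in I}\varphi_i)\circ\tau=\sum_{w\in\mathcal{M}^*}\psi(w),$$ where $\tau:\mathcal{A}\to\star_{i\in I}\mathcal{A}_i$ is the canonical unital homomorphism that maps each internal unit $1_i$ onto $1$; (2) for the boolean product $\varphi_{\rm bool}$ of the functionals $\varphi_i$, $$\varphi_{\rm bool}=\sum_{w\in\mathcal{B}^*}\psi(w),$$ where $\mathcal{B}^*=\{1^n:n\in\mathbb{N}\cup\{0\}\}$, with $1^0=\varnothing$ the empty word.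
   Context: **Probability spaces and notation.** $\mathbb{N}=\{1,2,\dots\}$. A noncommutative probability space $(\mathcal{A},\varphi)$ is a unital complex algebra with a linear functional $\varphi$ such that $\varphi(1)=1$. The unit of $\mathcal{A}_i$ is $1_i$. The notation $i_1\neq\cdots\neq i_n$ means that $i_k\neq i_{k+1}$ for all $k$. **Orthogonal replicas.** For each $i\in I$ let $p_i$ be an abstract idempotent ($p_i^2=p_i$) and let $\widetilde{\mathcal{A}}_i=\mathcal{A}_i\star\mathbb{C}[p_i]$ (free product with identified units, where $\mathbb{C}[p_i]$ is the unital algebra generated by $p_i$), with the linear functional $\widetilde\varphi_i$ determined by $\widetilde\varphi_i(p_i)=1$ and $\widetilde\varphi_i(p_i^{\gamma}a_1p_ia_2p_i\cdots p_ia_mp_i^{\delta})=\varphi_i(a_1)\cdots\varphi_i(a_m)$ for $\gamma,\delta\in\{0,1\}$, $a_1,\dots,a_m\in\mathcal{A}_i$. Let $\mathcal{A}_\otimes=\bigotimes_{i\in I}\widetilde{\mathcal{A}}_i^{\otimes\infty}$ be the infinite tensor product spanned by simple tensors $\bigotimes_{i\in I}\bigotimes_{k=1}^\infty x_{i,k}$ with $x_{i,k}\in\widetilde{\mathcal{A}}_i$ and $x_{i,k}\notin\{1_i,p_i\}$ for only finitely many sites $(i,k)$ (multilinear in the entries, multiplied sitewise), and let $\Phi_\otimes$ be the linear functional with $\Phi_\otimes(\bigotimes x_{i,k})=\prod_{i,k}\widetilde\varphi_i(x_{i,k})$. For $i\in I$ and $j\in\mathbb{N}$ let $P_i(j)$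 be the simple tensor with $1_i$ at all sites $(i,m)$ and, for each $k\neq i$, with $1_k$ at sites $(k,m)$, $m\le j-1$, and $p_k$ at sites $(k,m)$, $m\geq j$; put $P_i(0)=0$ and $p_i(j)=P_i(j)-P_i(j-1)$. For $a\in\mathcal{A}_i$ let $\iota_j(a)$ be the simple tensor with $a$ at site $(i,j)$ and units elsewhere. The orthogonal replica of $a\in\mathcal{A}_i$ of label $i$ and color $j$ is $a(j)=\iota_j(a)\,p_i(j)$. Let $\mathcal{A}_{\rm rep}$ be the unital subalgebra of $\mathcal{A}_\otimes$ generated by all replicas, and let $\Phi$ be the restriction of $\Phi_\otimes$ to $\mathcal{A}_{\rm rep}$. **Motzkin words.** A reduced Motzkin word of length $n\geq1$ is a word $w=j_1\cdots j_n$ in letters from $\mathbb{N}$ with $j_1=j_n=1$ and $|j_k-j_{k-1}|\in\{0,1\}$ for $1<k\le n$. $\mathcal{M}_n$ is the set of these, $\mathcal{M}=\bigcup_{n\ge1}\mathcal{M}_n$, $\mathcal{M}^*=\mathcal{M}\cup\{\varnothing\}$. **Linear Motzkin functionals.** $\mathcal{A}=*_{i\in I}\mathcal{A}_i$ is the free product of the algebras $\mathcal{A}_i$ in which units are not identified, with a separate unit $1_{\mathcal{A}}$. As a vector space $\mathcal{A}=\bigoplus_{n\ge0}F_n$, where $F_0=\mathbb{C}1_{\mathcal{A}}$ and $F_n$ is spanned by the products $a_1\cdots a_n$ with $a_k\in\mathcal{A}_{i_k}$, $i_1\neq\cdots\neq i_n$. For $w=j_1\cdots j_n\in\mathcal{M}_n$,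 $\psi(w):\mathcal{A}\to\mathbb{C}$ is the linear functional given on $F_n$ by $\psi(w)(a_1\cdots a_n)=\Phi(a_1(j_1)\cdots a_n(j_n))$ ($a_k\in\mathcal{A}_{i_k}$, $i_1\neq\cdots\neq i_n$) and equal to zero on $F_m$ for $m\neq n$. $\psi(\varnothing)$ is given by $\psi(\varnothing)(1_{\mathcal{A}})=1$ and is zero on $F_m$ for $m\ge1$. (Only finitely many terms in the sums over $w$ are nonzero on any given element of $\mathcal{A}$.) **Products of functionals.** $\star_{i\in I}\mathcal{A}_i$ is the free product of unital algebras with identified units and $\star_{i\in I}\varphi_i$ is Voiculescu's free product of the functionals $\varphi_i$ on it. The boolean product $\varphi_{\rm bool}$ is the linear functional on $\mathcal{A}$ with $\varphi_{\rm bool}(1_{\mathcal{A}})=1$ and $\varphi_{\rm bool}(a_1\cdots a_n)=\varphi_{i_1}(a_1)\cdots\varphi_{i_n}(a_n)$ whenever $a_k\in\mathcal{A}_{i_k}$, $i_1\neq\cdots\neq i_n$. *)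

theory Defs
  imports
    Complex_Main
    "HOL-Library.FuncSet"
    "HOL-Library.Poly_Mapping"
    "HOL-Algebra.QuotRing"
    "HOL-Algebra.Module"
    "HOL-Algebra.Algebraic_Closure_Type"
begin

section \<open>Noncommutative probability spaces\<close>

text \<open>The locale \<^locale>\<open>algebra\<close> of the library is restricted to commutative algebras, so unital
  complex algebras are introduced here on the same records. Scalars are the field of complex
  numbers, viewed as a ring record.\<close>

type_synonym 'a calg = "(complex, 'a) module"

abbreviation complex_field :: "complex ring" where
  "complex_field \<equiv> ring_of_type_algebra"

definition complex_algebra :: "'a calg \<Rightarrow> bool" where
  "complex_algebra A \<longleftrightarrow> ring A \<and> module complex_field A \<and>
     (\<forall>c. \<forall>x\<in>carrier A. \<forall>y\<in>carrier A.
        (c \<odot>\<^bsub>A\<^esub> x) \<otimes>\<^bsub>A\<^esub> y = c \<odot>\<^bsub>A\<^esub> (x \<otimes>\<^bsub>A\<^esub> y) \<and>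
        x \<otimes>\<^bsub>A\<^esub> (c \<odot>\<^bsub>A\<^esub> y) = c \<odot>\<^bsub>A\<^esub> (x \<otimes>\<^bsub>A\<^esub> y))"

definition linear_functional :: "'a calg \<Rightarrow> ('a \<Rightarrow> complex) \<Rightarrow> bool" where
  "linear_functional A f \<longleftrightarrow>
     (\<forall>x\<in>carrier A. \<forall>y\<in>carrier A. f (x \<oplus>\<^bsub>A\<^esub> y) = f x + f y) \<and>
     (\<forall>c. \<forall>x\<in>carrier A. f (c \<odot>\<^bsub>A\<^esub> x) = c * f x)"

definition nc_prob_space :: "'a calg \<Rightarrow> ('a \<Rightarrow> complex) \<Rightarrow> bool" where
  "nc_prob_space A \<phi> \<longleftrightarrow> complex_algebra A \<and> linear_functional A \<phi> \<and> \<phi> \<one>\<^bsub>A\<^esub> = 1"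

definition algebra_hom :: "'a calg \<Rightarrow> 'b calg \<Rightarrow> ('a \<Rightarrow> 'b) \<Rightarrow> bool" where
  "algebra_hom A B h \<longleftrightarrow> h \<in> ring_hom A B \<and>
     (\<forall>c. \<forall>x\<in>carrier A. h (c \<odot>\<^bsub>A\<^esub> x) = c \<odot>\<^bsub>B\<^esub> h x)"

text \<open>The map on \<open>C\<close> determined by the property \<open>P\<close>; values outside \<open>C\<close> are irrelevant and are
  fixed to be \<^const>\<open>undefined\<close> so that the description is unique.\<close>

definition the_on :: "'a set \<Rightarrow> (('a \<Rightarrow> 'b) \<Rightarrow> bool) \<Rightarrow> 'a \<Rightarrow> 'b" where
  "the_on C P = (THE f. f \<in> extensional C \<and> P f)"

definition list_prod :: "('a, 'm) monoid_scheme \<Rightarrow> 'a list \<Rightarrow> 'a" where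
  "list_prod G xs = foldr (\<otimes>\<^bsub>G\<^esub>) xs \<one>\<^bsub>G\<^esub>"

definition unital_subalgebra :: "'a set \<Rightarrow> 'a calg \<Rightarrow> bool" where
  "unital_subalgebra B A \<longleftrightarrow> B \<subseteq> carrier A \<and> \<one>\<^bsub>A\<^esub> \<in> B \<and>
     (\<forall>x\<in>B. \<forall>y\<in>B. x \<oplus>\<^bsub>A\<^esub> y \<in> B \<and> x \<otimes>\<^bsub>A\<^esub> y \<in> B) \<and>
     (\<forall>c. \<forall>x\<in>B. c \<odot>\<^bsub>A\<^esub> x \<in> B)"

definition generated_subalgebra :: "'a calg \<Rightarrow> 'a set \<Rightarrow> 'a set" where
  "generated_subalgebra A S = \<Inter>{B. unital_subalgebra B A \<and> S \<subseteq> B}"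


section \<open>Monoid algebras, quotients and presentations\<close>

text \<open>The complex algebra of formal linear combinations of elements of a monoid \<open>G\<close>, with the
  multiplication of \<open>G\<close> extended bilinearly.\<close>

definition monoid_algebra :: "'g monoid \<Rightarrow> ('g \<Rightarrow>\<^sub>0 complex) calg" where
  "monoid_algebra G =
     \<lparr> carrier = {f. Poly_Mapping.keys f \<subseteq> carrier G},
       monoid.mult = (\<lambda>f g. \<Sum>x\<in>Poly_Mapping.keys f. \<Sum>y\<in>Poly_Mapping.keys g.
          Poly_Mapping.single (x \<otimes>\<^bsub>G\<^esub> y)
            (Poly_Mapping.lookup f x * Poly_Mapping.lookup g y)),
       one = Poly_Mapping.single \<one>\<^bsub>G\<^esub> 1,
       zero = 0,
       add = (+),
       module.smult = (\<lambda>c. Poly_Mapping.map ((*) c)) \<rparr>"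

text \<open>The ring \<open>R Quot J\<close> of cosets of a two-sided ideal, with the induced scalar multiplication.\<close>

definition quotient_algebra :: "'a calg \<Rightarrow> 'a set \<Rightarrow> 'a set calg" where
  "quotient_algebra R J =
     \<lparr> carrier = carrier (R Quot J),
       monoid.mult = monoid.mult (R Quot J),
       one = one (R Quot J),
       zero = zero (R Quot J),
       add = add (R Quot J),
       module.smult = (\<lambda>c Y. \<Union>x\<in>Y. J +>\<^bsub>R\<^esub> (c \<odot>\<^bsub>R\<^esub> x)) \<rparr>"

text \<open>The unital algebra with generators \<open>S\<close> and relations \<open>r = 0\<close> for \<open>r \<in> R\<close>: noncommutative
  polynomials are formal combinations of words over \<open>S\<close>, the empty word being the unit.\<close>

definition word_monoid :: "'x set \<Rightarrow> 'x list monoid" where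
  "word_monoid S = \<lparr> carrier = lists S, monoid.mult = (@), one = [] \<rparr>"

definition relation_ideal :: "'x set \<Rightarrow> ('x list \<Rightarrow>\<^sub>0 complex) set \<Rightarrow> ('x list \<Rightarrow>\<^sub>0 complex) set" where
  "relation_ideal S R = Idl\<^bsub>monoid_algebra (word_monoid S)\<^esub> R"

definition presented_algebra ::
  "'x set \<Rightarrow> ('x list \<Rightarrow>\<^sub>0 complex) set \<Rightarrow> ('x list \<Rightarrow>\<^sub>0 complex) set calg" where
  "presented_algebra S R =
     quotient_algebra (monoid_algebra (word_monoid S)) (relation_ideal S R)"

definition generator ::
  "'x set \<Rightarrow> ('x list \<Rightarrow>\<^sub>0 complex) set \<Rightarrow> 'x \<Rightarrow> ('x list \<Rightarrow>\<^sub>0 complex) set" where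
  "generator S R x =
     relation_ideal S R +>\<^bsub>monoid_algebra (word_monoid S)\<^esub> Poly_Mapping.single [x] 1"

text \<open>Relations saying that the letters \<open>e a\<close>, \<open>a \<in> A\<close>, add, scale and multiply as in \<open>A\<close>
  (nothing is said about the unit of \<open>A\<close>).\<close>

definition algebra_relations :: "'a calg \<Rightarrow> ('a \<Rightarrow> 'x) \<Rightarrow> ('x list \<Rightarrow>\<^sub>0 complex) set" where
  "algebra_relations A e =
     {Poly_Mapping.single [e (\<alpha> \<odot>\<^bsub>A\<^esub> a \<oplus>\<^bsub>A\<^esub> \<beta> \<odot>\<^bsub>A\<^esub> b)] 1
        - Poly_Mapping.single [e a] \<alpha> - Poly_Mapping.single [e b] \<beta> | \<alpha> \<beta> a b.
        a \<in> carrier A \<and> b \<in> carrier A} \<union>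
     {Poly_Mapping.single [e a, e b] 1 - Poly_Mapping.single [e (a \<otimes>\<^bsub>A\<^esub> b)] 1 | a b.
        a \<in> carrier A \<and> b \<in> carrier A}"

definition unit_relation :: "'a calg \<Rightarrow> ('a \<Rightarrow> 'x) \<Rightarrow> 'x list \<Rightarrow>\<^sub>0 complex" where
  "unit_relation A e = Poly_Mapping.single [e \<one>\<^bsub>A\<^esub>] 1 - Poly_Mapping.single [] 1"


section \<open>Free products\<close>

type_synonym ('i, 'a) fp = "(('i \<times> 'a) list \<Rightarrow>\<^sub>0 complex) set"

definition letters :: "'i set \<Rightarrow> ('i \<Rightarrow> 'a calg) \<Rightarrow> ('i \<times> 'a) set" where
  "letters I A = (SIGMA i:I. carrier (A i))"

definition nonunital_relations ::
  "'i set \<Rightarrow> ('i \<Rightarrow> 'a calg) \<Rightarrow> (('i \<times> 'a) list \<Rightarrow>\<^sub>0 complex) set" where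
  "nonunital_relations I A = (\<Union>i\<in>I. algebra_relations (A i) (Pair i))"

definition unital_relations ::
  "'i set \<Rightarrow> ('i \<Rightarrow> 'a calg) \<Rightarrow> (('i \<times> 'a) list \<Rightarrow>\<^sub>0 complex) set" where
  "unital_relations I A = nonunital_relations I A \<union> (\<lambda>i. unit_relation (A i) (Pair i)) ` I"

text \<open>The free product without identification of units, and the one with identified units,
  with the canonical maps from the \<open>A i\<close>.\<close>

definition free_product_sep :: "'i set \<Rightarrow> ('i \<Rightarrow> 'a calg) \<Rightarrow> ('i, 'a) fp calg" where
  "free_product_sep I A = presented_algebra (letters I A) (nonunital_relations I A)"

definition emb_sep :: "'i set \<Rightarrow> ('i \<Rightarrow> 'a calg) \<Rightarrow> 'i \<Rightarrow> 'a \<Rightarrow> ('i, 'a) fp" where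
  "emb_sep I A i a = generator (letters I A) (nonunital_relations I A) (i, a)"

definition free_product :: "'i set \<Rightarrow> ('i \<Rightarrow> 'a calg) \<Rightarrow> ('i, 'a) fp calg" where
  "free_product I A = presented_algebra (letters I A) (unital_relations I A)"

definition emb :: "'i set \<Rightarrow> ('i \<Rightarrow> 'a calg) \<Rightarrow> 'i \<Rightarrow> 'a \<Rightarrow> ('i, 'a) fp" where
  "emb I A i a = generator (letters I A) (unital_relations I A) (i, a)"

text \<open>Words \<open>(i\<^sub>1, a\<^sub>1) \<dots> (i\<^sub>n, a\<^sub>n)\<close> with \<open>i\<^sub>1 \<noteq> \<dots> \<noteq> i\<^sub>n\<close>, including the empty one, and the
  corresponding products in the two free products.\<close>

definition alternating_words :: "'i set \<Rightarrow> ('i \<Rightarrow> 'a calg) \<Rightarrow> ('i \<times> 'a) list set" where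
  "alternating_words I A = {u \<in> lists (letters I A). distinct_adj (map fst u)}"

definition word_sep :: "'i set \<Rightarrow> ('i \<Rightarrow> 'a calg) \<Rightarrow> ('i \<times> 'a) list \<Rightarrow> ('i, 'a) fp" where
  "word_sep I A u = list_prod (free_product_sep I A) (map (\<lambda>(i, a). emb_sep I A i a) u)"

definition word :: "'i set \<Rightarrow> ('i \<Rightarrow> 'a calg) \<Rightarrow> ('i \<times> 'a) list \<Rightarrow> ('i, 'a) fp" where
  "word I A u = list_prod (free_product I A) (map (\<lambda>(i, a). emb I A i a) u)"

text \<open>The canonical unital homomorphism \<open>\<tau>\<close>. As a homomorphism over each \<open>A i\<close> it sends the
  internal unit of \<open>A i\<close> to \<^term>\<open>emb I A i \<one>\<^bsub>A i\<^esub>\<close>, which is the unit of the target.\<close>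

definition canonical_hom :: "'i set \<Rightarrow> ('i \<Rightarrow> 'a calg) \<Rightarrow> ('i, 'a) fp \<Rightarrow> ('i, 'a) fp" where
  "canonical_hom I A = the_on (carrier (free_product_sep I A)) (\<lambda>h.
     algebra_hom (free_product_sep I A) (free_product I A) h \<and>
     (\<forall>i\<in>I. \<forall>a\<in>carrier (A i). h (emb_sep I A i a) = emb I A i a))"

text \<open>Voiculescu's free product of functionals: it extends every \<open>\<phi> i\<close>, and alternating
  products of centred elements have value 0.\<close>

definition free_product_functional ::
  "'i set \<Rightarrow> ('i \<Rightarrow> 'a calg) \<Rightarrow> ('i \<Rightarrow> 'a \<Rightarrow> complex) \<Rightarrow> ('i, 'a) fp \<Rightarrow> complex" where
  "free_product_functional I A \<phi> = the_on (carrier (free_product I A)) (\<lambda>f.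
     linear_functional (free_product I A) f \<and>
     f \<one>\<^bsub>free_product I A\<^esub> = 1 \<and>
     (\<forall>i\<in>I. \<forall>a\<in>carrier (A i). f (emb I A i a) = \<phi> i a) \<and>
     (\<forall>u\<in>alternating_words I A. u \<noteq> [] \<and> (\<forall>(i, a)\<in>set u. \<phi> i a = 0) \<longrightarrow>
        f (word I A u) = 0))"

definition boolean_product_functional ::
  "'i set \<Rightarrow> ('i \<Rightarrow> 'a calg) \<Rightarrow> ('i \<Rightarrow> 'a \<Rightarrow> complex) \<Rightarrow> ('i, 'a) fp \<Rightarrow> complex" where
  "boolean_product_functional I A \<phi> = the_on (carrier (free_product_sep I A)) (\<lambda>f.
     linear_functional (free_product_sep I A) f \<and>
     f \<one>\<^bsub>free_product_sep I A\<^esub> = 1 \<and>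
     (\<forall>u\<in>alternating_words I A. u \<noteq> [] \<longrightarrow>
        f (word_sep I A u) = (\<Prod>(i, a)\<leftarrow>u. \<phi> i a)))"


section \<open>Adjoining an idempotent\<close>

text \<open>The free product with identified units of \<open>A\<close> and the unital algebra generated by an
  idempotent \<open>p\<close>: the letter \<^term>\<open>Some a\<close> stands for \<open>a \<in> A\<close> and \<^const>\<open>None\<close> for \<open>p\<close>.\<close>

type_synonym 'a ext = "('a option list \<Rightarrow>\<^sub>0 complex) set"

definition ext_letters :: "'a calg \<Rightarrow> 'a option set" where
  "ext_letters A = insert None (Some ` carrier A)"

definition ext_relations :: "'a calg \<Rightarrow> ('a option list \<Rightarrow>\<^sub>0 complex) set" where
  "ext_relations A = algebra_relations A Some \<union> {unit_relation A Some} \<union>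
     {Poly_Mapping.single [None, None] 1 - Poly_Mapping.single [None] 1}"

definition ext_algebra :: "'a calg \<Rightarrow> 'a ext calg" where
  "ext_algebra A = presented_algebra (ext_letters A) (ext_relations A)"

definition ext_emb :: "'a calg \<Rightarrow> 'a \<Rightarrow> 'a ext" where
  "ext_emb A a = generator (ext_letters A) (ext_relations A) (Some a)"

definition ext_idem :: "'a calg \<Rightarrow> 'a ext" where
  "ext_idem A = generator (ext_letters A) (ext_relations A) None"

text \<open>The values are prescribed on \<open>p\<^sup>\<gamma> a p a\<^sub>2 p \<dots> p a\<^sub>m p\<^sup>\<delta>\<close>, where \<open>as = [a\<^sub>2, \<dots>, a\<^sub>m]\<close>.\<close>

definition ext_functional :: "'a calg \<Rightarrow> ('a \<Rightarrow> complex) \<Rightarrow> 'a ext \<Rightarrow> complex" where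
  "ext_functional A \<phi> = the_on (carrier (ext_algebra A)) (\<lambda>f.
     linear_functional (ext_algebra A) f \<and>
     f (ext_idem A) = 1 \<and>
     (\<forall>\<gamma>\<in>{0, 1}. \<forall>\<delta>\<in>{0, 1}. \<forall>a\<in>carrier A. \<forall>as\<in>lists (carrier A).
        f (list_prod (ext_algebra A)
             (replicate \<gamma> (ext_idem A) @
              ext_emb A a # concat (map (\<lambda>b. [ext_idem A, ext_emb A b]) as) @
              replicate \<delta> (ext_idem A)))
          = \<phi> a * (\<Prod>b\<leftarrow>as. \<phi> b)))"


section \<open>The infinite tensor product\<close>

type_synonym ('i, 'a) tfam = "'i \<times> nat \<Rightarrow> 'a ext"
type_synonym ('i, 'a) tensor = "(('i, 'a) tfam \<Rightarrow>\<^sub>0 complex) set"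

definition sites :: "'i set \<Rightarrow> ('i \<times> nat) set" where
  "sites I = I \<times> {1..}"

text \<open>The families of entries of simple tensors, multiplied sitewise.\<close>

definition tensor_monoid :: "'i set \<Rightarrow> ('i \<Rightarrow> 'a calg) \<Rightarrow> ('i, 'a) tfam monoid" where
  "tensor_monoid I A =
     \<lparr> carrier = {x \<in> (\<Pi>\<^sub>E s\<in>sites I. carrier (ext_algebra (A (fst s)))).
          finite {s \<in> sites I. x s \<notin> {\<one>\<^bsub>ext_algebra (A (fst s))\<^esub>, ext_idem (A (fst s))}}},
       monoid.mult = (\<lambda>x y. \<lambda>s\<in>sites I. x s \<otimes>\<^bsub>ext_algebra (A (fst s))\<^esub> y s),
       one = (\<lambda>s\<in>sites I. \<one>\<^bsub>ext_algebra (A (fst s))\<^esub>) \<rparr>"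

definition multilinearity_relations ::
  "'i set \<Rightarrow> ('i \<Rightarrow> 'a calg) \<Rightarrow> (('i, 'a) tfam \<Rightarrow>\<^sub>0 complex) set" where
  "multilinearity_relations I A =
     {Poly_Mapping.single (x(s := \<alpha> \<odot>\<^bsub>ext_algebra (A (fst s))\<^esub> u
                                   \<oplus>\<^bsub>ext_algebra (A (fst s))\<^esub>
                                   \<beta> \<odot>\<^bsub>ext_algebra (A (fst s))\<^esub> v)) 1
        - Poly_Mapping.single (x(s := u)) \<alpha> - Poly_Mapping.single (x(s := v)) \<beta> | x s \<alpha> \<beta> u v.
        x \<in> carrier (tensor_monoid I A) \<and> s \<in> sites I \<and>
        u \<in> carrier (ext_algebra (A (fst s))) \<and> v \<in> carrier (ext_algebra (A (fst s)))}"

text \<open>The linear span of the multilinearity relations is already a two-sided ideal, because the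
  sitewise product is bilinear at each site; so generating an ideal imposes nothing beyond
  multilinearity.\<close>

definition multilinearity_ideal ::
  "'i set \<Rightarrow> ('i \<Rightarrow> 'a calg) \<Rightarrow> (('i, 'a) tfam \<Rightarrow>\<^sub>0 complex) set" where
  "multilinearity_ideal I A =
     Idl\<^bsub>monoid_algebra (tensor_monoid I A)\<^esub> (multilinearity_relations I A)"

definition tensor_algebra :: "'i set \<Rightarrow> ('i \<Rightarrow> 'a calg) \<Rightarrow> ('i, 'a) tensor calg" where
  "tensor_algebra I A =
     quotient_algebra (monoid_algebra (tensor_monoid I A)) (multilinearity_ideal I A)"

definition simple_tensor ::
  "'i set \<Rightarrow> ('i \<Rightarrow> 'a calg) \<Rightarrow> ('i, 'a) tfam \<Rightarrow> ('i, 'a) tensor" where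
  "simple_tensor I A x =
     multilinearity_ideal I A +>\<^bsub>monoid_algebra (tensor_monoid I A)\<^esub> Poly_Mapping.single x 1"

text \<open>In the product over all sites, all but finitely many factors are 1; it is taken over the
  remaining ones.\<close>

definition tensor_functional ::
  "'i set \<Rightarrow> ('i \<Rightarrow> 'a calg) \<Rightarrow> ('i \<Rightarrow> 'a \<Rightarrow> complex) \<Rightarrow> ('i, 'a) tensor \<Rightarrow> complex" where
  "tensor_functional I A \<phi> = the_on (carrier (tensor_algebra I A)) (\<lambda>f.
     linear_functional (tensor_algebra I A) f \<and>
     (\<forall>x\<in>carrier (tensor_monoid I A).
        f (simple_tensor I A x) =
          (\<Prod>s | s \<in> sites I \<and> ext_functional (A (fst s)) (\<phi> (fst s)) (x s) \<noteq> 1.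
             ext_functional (A (fst s)) (\<phi> (fst s)) (x s))))"


section \<open>Orthogonal replicas\<close>

definition P_tensor :: "'i set \<Rightarrow> ('i \<Rightarrow> 'a calg) \<Rightarrow> 'i \<Rightarrow> nat \<Rightarrow> ('i, 'a) tensor" where
  "P_tensor I A i j =
     (if j = 0 then \<zero>\<^bsub>tensor_algebra I A\<^esub>
      else simple_tensor I A (\<lambda>(k, m)\<in>sites I.
        if k = i \<or> m < j then \<one>\<^bsub>ext_algebra (A k)\<^esub> else ext_idem (A k)))"

definition p_tensor :: "'i set \<Rightarrow> ('i \<Rightarrow> 'a calg) \<Rightarrow> 'i \<Rightarrow> nat \<Rightarrow> ('i, 'a) tensor" where
  "p_tensor I A i j = P_tensor I A i j \<ominus>\<^bsub>tensor_algebra I A\<^esub> P_tensor I A i (j - 1)"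

definition iota :: "'i set \<Rightarrow> ('i \<Rightarrow> 'a calg) \<Rightarrow> 'i \<Rightarrow> nat \<Rightarrow> 'a \<Rightarrow> ('i, 'a) tensor" where
  "iota I A i j a = simple_tensor I A (\<lambda>(k, m)\<in>sites I.
     if k = i \<and> m = j then ext_emb (A k) a else \<one>\<^bsub>ext_algebra (A k)\<^esub>)"

definition replica :: "'i set \<Rightarrow> ('i \<Rightarrow> 'a calg) \<Rightarrow> 'i \<Rightarrow> 'a \<Rightarrow> nat \<Rightarrow> ('i, 'a) tensor" where
  "replica I A i a j = iota I A i j a \<otimes>\<^bsub>tensor_algebra I A\<^esub> p_tensor I A i j"

definition replica_algebra :: "'i set \<Rightarrow> ('i \<Rightarrow> 'a calg) \<Rightarrow> ('i, 'a) tensor set" where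
  "replica_algebra I A = generated_subalgebra (tensor_algebra I A)
     {replica I A i a j | i a j. i \<in> I \<and> a \<in> carrier (A i) \<and> 1 \<le> j}"

definition replica_functional ::
  "'i set \<Rightarrow> ('i \<Rightarrow> 'a calg) \<Rightarrow> ('i \<Rightarrow> 'a \<Rightarrow> complex) \<Rightarrow> ('i, 'a) tensor \<Rightarrow> complex" where
  "replica_functional I A \<phi> = restrict (tensor_functional I A \<phi>) (replica_algebra I A)"


section \<open>Motzkin words and linear Motzkin functionals\<close>

definition motzkin_words :: "nat list set" where
  "motzkin_words = {w. w \<noteq> [] \<and> (\<forall>j\<in>set w. 1 \<le> j) \<and> hd w = 1 \<and> last w = 1 \<and>
     (\<forall>k. Suc k < length w \<longrightarrow> \<bar>int (w ! Suc k) - int (w ! k)\<bar> \<in> {0, 1})}"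

definition motzkin_words_star :: "nat list set" where
  "motzkin_words_star = insert [] motzkin_words"

definition boolean_words_star :: "nat list set" where
  "boolean_words_star = {replicate n 1 | n. True}"

text \<open>The summand \<open>F\<^sub>m\<close> of the free product is spanned by the alternating words of length \<open>m\<close>,
  so the functional is prescribed by its values on these.\<close>

definition motzkin_functional ::
  "'i set \<Rightarrow> ('i \<Rightarrow> 'a calg) \<Rightarrow> ('i \<Rightarrow> 'a \<Rightarrow> complex) \<Rightarrow> nat list \<Rightarrow> ('i, 'a) fp \<Rightarrow> complex" where
  "motzkin_functional I A \<phi> w = the_on (carrier (free_product_sep I A)) (\<lambda>f.
     linear_functional (free_product_sep I A) f \<and>
     (\<forall>u\<in>alternating_words I A.
        f (word_sep I A u) =
          (if length u \<noteq> length w then 0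
           else if w = [] then 1
           else replica_functional I A \<phi>
                  (list_prod (tensor_algebra I A)
                     (map2 (\<lambda>(i, a) j. replica I A i a j) u w)))))"

end

theory Submission
  imports Defs
begin

text \<open>An alternating word \<open>(i\<^sub>1, a\<^sub>1) \<dots> (i\<^sub>m, a\<^sub>m)\<close> whose letters after the first are centred is
  called a stack. Left multiplication of \<open>a\<^sub>1 \<dots> a\<^sub>m\<close> by \<open>b\<close> of label \<open>k \<noteq> i\<^sub>1\<close> in the unital free
  product gives the sum of the stack with top \<open>b\<close> above \<open>a\<^sub>1 - \<phi>(a\<^sub>1)\<close> and of \<open>\<phi>(a\<^sub>1) b a\<^sub>2 \<dots> a\<^sub>m\<close>, where
  \<open>b\<close> and \<open>a\<^sub>2\<close> merge if their labels agree; this recursion computes the free product functional.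
  In the tensor product the same stack is the simple tensor with \<open>a\<^sub>r\<close> at the site
  \<open>(i\<^sub>r, m + 1 - r)\<close>. There the replica of \<open>b\<close> of colour \<open>m + 1\<close> produces the first summand,
  colour \<open>m\<close> the second one without merging, colour \<open>m - 1\<close> the second one with merging, and all
  other colours give 0 under \<open>\<Phi>\<close>. Hence the colour always equals the new height of the stack, so
  only Motzkin words contribute, and summing over the colours gives the multiplication of the free
  product. The constant word 1 keeps the height 1 throughout and yields the boolean product.\<close>

section \<open>Complex algebras and their linear functionals\<close>

text \<open>The functionals of the statement are definite descriptions on quotient algebras, so each
  needs an existence and a uniqueness proof before it can be evaluated. Existence comes from a
  function on words, or on families of entries, that annihilates all two-sided translates of the
  relations. For the free product functional the stack recursion is itself the construction, and its
  compatibility with the relations has to be checked on arbitrary stacks. Tensors follow the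
  recursion only under \<Phi>, and behind an arbitrary left factor \<open>Y\<close>. Every scalar
  that splits off has one source, the identity \<open>f(y p z) = f(y) f(z)\<close> in an extended
  algebra: \<open>P_k(j)\<close> has \<open>p\<close> at all sites of label other than
  \<open>k\<close> and height at least \<open>j\<close>, so a letter sitting there leaves as its
  expectation. On a stack whose top has a label other than \<open>k\<close>, the value of
  \<open>P_k(n)\<close> is therefore a step function of \<open>n\<close> with at most two jumps, and
  \<open>P_k(j) - P_k(j - 1)\<close> picks out the jump at \<open>j\<close>. This is why at most two
  colours survive at each step.\<close>

locale complex_alg = ring R for R :: "'a calg" (structure) +
  assumes complex_algebra: "complex_algebra R"
begin

lemma module: "module complex_field R"
  using complex_algebra by (simp add: complex_algebra_def)

lemma smult_closed [simp, intro]: "x \<in> carrier R \<Longrightarrow> c \<odot> x \<in> carrier R"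
  using module.smult_closed[OF module] by (simp add: ring_of_type_algebra_def)

lemma smult_l_distr: "x \<in> carrier R \<Longrightarrow> (c + d) \<odot> x = c \<odot> x \<oplus> d \<odot> x"
  using module.smult_l_distr[OF module, of c d] by (simp add: ring_of_type_algebra_def)

lemma smult_r_distr:
  "x \<in> carrier R \<Longrightarrow> y \<in> carrier R \<Longrightarrow> c \<odot> (x \<oplus> y) = c \<odot> x \<oplus> c \<odot> y"
  using module.smult_r_distr[OF module, of c] by (simp add: ring_of_type_algebra_def)

lemma smult_assoc: "x \<in> carrier R \<Longrightarrow> (c * d) \<odot> x = c \<odot> (d \<odot> x)"
  using module.smult_assoc1[OF module, of c d] by (simp add: ring_of_type_algebra_def)

lemma smult_one [simp]: "x \<in> carrier R \<Longrightarrow> 1 \<odot> x = x"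
  using module.smult_one[OF module] by (simp add: ring_of_type_algebra_def)

lemma smult_mult_left:
  "x \<in> carrier R \<Longrightarrow> y \<in> carrier R \<Longrightarrow> (c \<odot> x) \<otimes> y = c \<odot> (x \<otimes> y)"
  using complex_algebra by (simp add: complex_algebra_def)

lemma smult_mult_right:
  "x \<in> carrier R \<Longrightarrow> y \<in> carrier R \<Longrightarrow> x \<otimes> (c \<odot> y) = c \<odot> (x \<otimes> y)"
  using complex_algebra by (simp add: complex_algebra_def)

lemma smult_zero_left [simp]: "x \<in> carrier R \<Longrightarrow> 0 \<odot> x = \<zero>"
  using smult_l_distr[of x 0 0] by simp

lemma a_inv_eq_smult: "x \<in> carrier R \<Longrightarrow> \<ominus> x = (- 1) \<odot> x"
  using smult_l_distr[of x "- 1" 1] by (simp add: minus_equality)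

lemma minus_eq_lincomb:
  "x \<in> carrier R \<Longrightarrow> y \<in> carrier R \<Longrightarrow> x \<ominus> y = 1 \<odot> x \<oplus> (- 1) \<odot> y"
  by (simp add: a_minus_def a_inv_eq_smult)

lemma mult_lincomb:
  assumes "x \<in> carrier R" "y \<in> carrier R" "u \<in> carrier R" "v \<in> carrier R"
  shows "u \<otimes> (\<alpha> \<odot> x \<oplus> \<beta> \<odot> y) \<otimes> v = \<alpha> \<odot> (u \<otimes> x \<otimes> v) \<oplus> \<beta> \<odot> (u \<otimes> y \<otimes> v)"
  using assms by (simp add: r_distr l_distr smult_mult_left smult_mult_right)

lemma linear_functional_zero: "linear_functional R f \<Longrightarrow> f \<zero> = 0"
  unfolding linear_functional_def by (metis mult_zero_left smult_zero_left zero_closed)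

lemma linear_functional_minus:
  "linear_functional R f \<Longrightarrow> x \<in> carrier R \<Longrightarrow> y \<in> carrier R \<Longrightarrow> f (x \<ominus> y) = f x - f y"
  by (simp add: linear_functional_def minus_eq_lincomb)

lemma linear_functional_restrict:
  "linear_functional R f \<Longrightarrow> linear_functional R (restrict f (carrier R))"
  by (simp add: linear_functional_def)

lemma linear_functional_mult:
  "linear_functional R f \<Longrightarrow> u \<in> carrier R \<Longrightarrow> v \<in> carrier R \<Longrightarrow>
     linear_functional R (\<lambda>x. f (u \<otimes> x \<otimes> v))"
  by (simp add: linear_functional_def r_distr l_distr smult_mult_left smult_mult_right)

end

lemma complex_algI: "complex_algebra R \<Longrightarrow> complex_alg R"
  by (simp add: complex_alg_def complex_alg_axioms_def complex_algebra_def)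

lemma complex_algebraI:
  fixes R :: "'a calg" (structure)
  assumes "ring R"
    and "\<And>c x. x \<in> carrier R \<Longrightarrow> c \<odot> x \<in> carrier R"
    and "\<And>c d x. x \<in> carrier R \<Longrightarrow> (c + d) \<odot> x = c \<odot> x \<oplus> d \<odot> x"
    and "\<And>c x y. x \<in> carrier R \<Longrightarrow> y \<in> carrier R \<Longrightarrow> c \<odot> (x \<oplus> y) = c \<odot> x \<oplus> c \<odot> y"
    and "\<And>c d x. x \<in> carrier R \<Longrightarrow> (c * d) \<odot> x = c \<odot> (d \<odot> x)"
    and "\<And>x. x \<in> carrier R \<Longrightarrow> 1 \<odot> x = x"
    and "\<And>c x y. x \<in> carrier R \<Longrightarrow> y \<in> carrier R \<Longrightarrow> (c \<odot> x) \<otimes> y = c \<odot> (x \<otimes> y)"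
    and "\<And>c x y. x \<in> carrier R \<Longrightarrow> y \<in> carrier R \<Longrightarrow> x \<otimes> (c \<odot> y) = c \<odot> (x \<otimes> y)"
  shows "complex_algebra R"
proof -
  have "module complex_field R"
    using assms ring.is_abelian_group[OF assms(1)]
    by (intro moduleI cring_from_type_algebra) (simp_all add: ring_of_type_algebra_def)
  then show ?thesis
    using assms by (simp add: complex_algebra_def)
qed

lemma linear_functional_lincomb:
  "linear_functional R f \<Longrightarrow> complex_algebra R \<Longrightarrow> x \<in> carrier R \<Longrightarrow> y \<in> carrier R \<Longrightarrow>
     f (\<alpha> \<odot>\<^bsub>R\<^esub> x \<oplus>\<^bsub>R\<^esub> \<beta> \<odot>\<^bsub>R\<^esub> y) = \<alpha> * f x + \<beta> * f y"
  by (simp add: linear_functional_def complex_alg.smult_closed[OF complex_algI])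

text \<open>Existence is asked of the restriction because lifted maps are arbitrary off
  \<open>C\<close>; there every candidate is \<open>undefined\<close>, so agreement on
  \<open>C\<close> is enough for uniqueness.\<close>

lemma the_on_eq:
  assumes "P (restrict f C)"
    and "\<And>g x. P g \<Longrightarrow> x \<in> C \<Longrightarrow> g x = f x"
  shows "the_on C P = restrict f C"
  unfolding the_on_def
proof (rule the_equality)
  fix g assume "g \<in> extensional C \<and> P g"
  then show "g = restrict f C"
    using assms(2)[of g] by (intro extensionalityI[of g C]) simp_all
qed (simp add: assms(1))

lemma list_prod_Nil [simp]: "list_prod G [] = \<one>\<^bsub>G\<^esub>"
  and list_prod_Cons [simp]: "list_prod G (x # xs) = x \<otimes>\<^bsub>G\<^esub> list_prod G xs"
  by (simp_all add: list_prod_def)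

lemma (in monoid) list_prod_closed [simp, intro]:
  "set xs \<subseteq> carrier G \<Longrightarrow> list_prod G xs \<in> carrier G"
  by (induction xs) auto

lemma (in monoid) list_prod_append:
  "set xs \<subseteq> carrier G \<Longrightarrow> set ys \<subseteq> carrier G \<Longrightarrow>
     list_prod G (xs @ ys) = list_prod G xs \<otimes> list_prod G ys"
  by (induction xs) (auto simp: m_assoc)

section \<open>Monoid algebras\<close>

abbreviation single :: "'g \<Rightarrow> 'b::zero \<Rightarrow> 'g \<Rightarrow>\<^sub>0 'b" where "single \<equiv> Poly_Mapping.single"
abbreviation keys :: "('g \<Rightarrow>\<^sub>0 'b::zero) \<Rightarrow> 'g set" where "keys \<equiv> Poly_Mapping.keys"
abbreviation scale :: "'b::semiring_0 \<Rightarrow> ('g \<Rightarrow>\<^sub>0 'b) \<Rightarrow> 'g \<Rightarrow>\<^sub>0 'b" where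
  "scale c \<equiv> Poly_Mapping.map ((*) c)"
abbreviation lookup :: "('g \<Rightarrow>\<^sub>0 'b::zero) \<Rightarrow> 'g \<Rightarrow> 'b" where "lookup \<equiv> Poly_Mapping.lookup"

lemma monoid_algebra_simps [simp]:
  "carrier (monoid_algebra G) = {f. keys f \<subseteq> carrier G}"
  "\<one>\<^bsub>monoid_algebra G\<^esub> = single \<one>\<^bsub>G\<^esub> 1"
  "\<zero>\<^bsub>monoid_algebra G\<^esub> = 0"
  "f \<oplus>\<^bsub>monoid_algebra G\<^esub> g = f + g"
  "c \<odot>\<^bsub>monoid_algebra G\<^esub> f = scale c f"
  by (simp_all add: monoid_algebra_def)

lemma keys_add_subset:
  "keys f \<subseteq> S \<Longrightarrow> keys g \<subseteq> S \<Longrightarrow> keys (f + g) \<subseteq> S"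
  using Poly_Mapping.keys_add[of f g] by blast

lemma keys_diff_subset:
  "keys f \<subseteq> S \<Longrightarrow> keys g \<subseteq> S \<Longrightarrow> keys (f - g) \<subseteq> S"
  for f g :: "'a \<Rightarrow>\<^sub>0 'b::ab_group_add"
  using keys_add_subset[of f S "- g"] by (auto simp: in_keys_iff)

text \<open>Splitting \<open>f\<close> into monomials reduces linear and bilinear identities to
  single monoid elements. The bound on the support travels along, because the monoid laws are
  available only inside the carrier.\<close>

lemma keys_induct [consumes 1, case_names zero single add]:
  fixes f :: "'a \<Rightarrow>\<^sub>0 'b::comm_monoid_add"
  assumes "keys f \<subseteq> S"
    and "P 0"
    and "\<And>x c. x \<in> S \<Longrightarrow> P (single x c)"
    and "\<And>f g. keys f \<subseteq> S \<Longrightarrow> keys g \<subseteq> S \<Longrightarrow> P f \<Longrightarrow> P g \<Longrightarrow> P (f + g)"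
  shows "P f"
proof -
  have "T \<subseteq> S \<Longrightarrow> keys (\<Sum>x\<in>T. single x (h x)) \<subseteq> S \<and>
      P (\<Sum>x\<in>T. single x (h x))" if "finite T" for T and h :: "'a \<Rightarrow> 'b"
    using that
  proof (induction T)
    case (insert x T)
    have "keys (single x (h x)) \<subseteq> S"
      using insert.prems by auto
    then show ?case
      using insert assms(3)[of x] assms(4)[of "single x (h x)"] by (simp add: keys_add_subset)
  qed (simp add: assms(2))
  moreover have "f = (\<Sum>x\<in>keys f. single x (lookup f x))"
    by (rule poly_mapping_eqI) (simp add: lookup_sum lookup_single when_def in_keys_iff)
  ultimately show ?thesis
    using assms(1) finite_keys by metis
qed

lemma keys_map_subset: "keys (Poly_Mapping.map h f) \<subseteq> keys f"
  by (auto simp: in_keys_iff Poly_Mapping.map.rep_eq when_def)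

lemma lookup_scale [simp]:
  "lookup (scale c f) x = c * lookup f x"
  for c :: "'b::semiring_0"
  by (simp add: Poly_Mapping.map.rep_eq when_def)

lemma scale_add:
  "scale c (f + g) = scale c f + scale c g"
  for c :: "'b::semiring_0"
  by (rule poly_mapping_eqI) (simp add: lookup_add distrib_left)

lemma scale_zero [simp]: "scale c 0 = 0"
  for c :: "'b::semiring_0"
  by (rule poly_mapping_eqI) simp

definition lin_ext :: "('g \<Rightarrow> complex) \<Rightarrow> ('g \<Rightarrow>\<^sub>0 complex) \<Rightarrow> complex" where
  "lin_ext g f = (\<Sum>x\<in>keys f. lookup f x * g x)"

lemma lin_ext_zero [simp]: "lin_ext g 0 = 0"
  by (simp add: lin_ext_def)

lemma lin_ext_single [simp]: "lin_ext g (single x c) = c * g x"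
  by (simp add: lin_ext_def)

lemma lin_ext_add [simp]: "lin_ext g (f + f') = lin_ext g f + lin_ext g f'"
  unfolding lin_ext_def by (rule setsum_keys_plus_distrib) (simp_all add: distrib_right)

lemma lin_ext_diff [simp]: "lin_ext g (f - f') = lin_ext g f - lin_ext g f'"
  using lin_ext_add[of g "f - f'" f'] by (simp add: algebra_simps)

lemma lin_ext_scale [simp]: "lin_ext g (scale c f) = c * lin_ext g f"
  by (rule keys_induct[OF subset_UNIV, of _ f])
     (simp_all add: scale_add distrib_left)

locale plain_monoid = monoid G for G :: "'g monoid" (structure)
begin

abbreviation conv (infixl "\<star>" 70) where "f \<star> g \<equiv> f \<otimes>\<^bsub>monoid_algebra G\<^esub> g"

lemma conv_eq:
  "f \<star> g = (\<Sum>x\<in>keys f. \<Sum>y\<in>keys g.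
     single (x \<otimes> y) (lookup f x * lookup g y))"
  by (simp add: monoid_algebra_def)

lemma conv_add_left:
  "(f + f') \<star> g = f \<star> g + f' \<star> g"
  unfolding conv_eq
  by (rule setsum_keys_plus_distrib)
     (simp_all add: distrib_right Poly_Mapping.single_add sum.distrib)

lemma conv_add_right:
  "f \<star> (g + g') = f \<star> g + f \<star> g'"
  unfolding conv_eq sum.distrib[symmetric]
  by (intro sum.cong refl setsum_keys_plus_distrib)
     (simp_all add: distrib_left Poly_Mapping.single_add)

lemma conv_zero [simp]:
  "0 \<star> g = 0" "f \<star> 0 = 0"
  by (simp_all add: conv_eq)

lemma conv_single:
  "single x c \<star> single y d =
     single (x \<otimes> y) (c * d)"
  by (simp add: conv_eq)

lemma scale_mult:
  "scale c f \<star> g = scale c (f \<star> g)"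
  "f \<star> scale c g = scale c (f \<star> g)"
proof -
  have single: "scale c (single x d) \<star> g =
      scale c (single x d \<star> g) \<and>
      single x d \<star> scale c g =
      scale c (single x d \<star> g)" for x d
    by (rule keys_induct[OF subset_UNIV, of _ g])
       (simp_all add: conv_single conv_add_right scale_add mult.left_commute mult.assoc)
  show "scale c f \<star> g = scale c (f \<star> g)"
    by (rule keys_induct[OF subset_UNIV, of _ f])
       (use single in \<open>simp_all add: conv_add_left scale_add\<close>)
  show "f \<star> scale c g = scale c (f \<star> g)"
    by (rule keys_induct[OF subset_UNIV, of _ f])
       (use single in \<open>simp_all add: conv_add_left scale_add\<close>)
qed

lemma conv_closed:
  assumes "keys f \<subseteq> carrier G" "keys g \<subseteq> carrier G"
  shows "keys (f \<star> g) \<subseteq> carrier G"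
  using assms(1)
proof (induction f rule: keys_induct)
  case (single x c)
  note x = single
  show ?case
    using assms(2)
  proof (induction g rule: keys_induct)
    case (add f g)
    then show ?case
      by (simp add: conv_add_right keys_add_subset)
  qed (use x in \<open>auto simp: conv_single\<close>)
next
  case (add f f')
  then show ?case
    by (simp add: conv_add_left keys_add_subset)
qed simp

lemma conv_assoc:
  assumes "keys f \<subseteq> carrier G" "keys g \<subseteq> carrier G"
    "keys h \<subseteq> carrier G"
  shows "f \<star> g \<star> h = f \<star> (g \<star> h)"
  using assms(1)
proof (induction f rule: keys_induct)
  case (single x c)
  note x = single
  show ?case
    using assms(2)
  proof (induction g rule: keys_induct)
    case (single y d)
    note y = single
    show ?case
      using assms(3)
      by (induction h rule: keys_induct)
         (use x y in \<open>auto simp: conv_single conv_add_right m_assoc mult_ac\<close>)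
  qed (auto simp: conv_add_left conv_add_right)
qed (auto simp: conv_add_left)

lemma conv_one:
  assumes "keys f \<subseteq> carrier G"
  shows "\<one>\<^bsub>monoid_algebra G\<^esub> \<star> f = f" "f \<star> \<one>\<^bsub>monoid_algebra G\<^esub> = f"
  using assms
  by (induction f rule: keys_induct)
     (auto simp: conv_single conv_add_left conv_add_right)

lemma complex_algebra_monoid_algebra: "complex_algebra (monoid_algebra G)"
proof (rule complex_algebraI)
  show "ring (monoid_algebra G)"
  proof (rule ringI)
    show "abelian_group (monoid_algebra G)"
    proof (rule abelian_groupI)
      fix f assume "f \<in> carrier (monoid_algebra G)"
      then show "\<exists>g\<in>carrier (monoid_algebra G). g \<oplus>\<^bsub>monoid_algebra G\<^esub> f = \<zero>\<^bsub>monoid_algebra G\<^esub>"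
        by (intro bexI[of _ "- f"]) simp_all
    qed (simp_all add: ac_simps keys_add_subset)
    show "monoid (monoid_algebra G)"
      by (rule monoidI)
         (use conv_closed conv_assoc conv_one in auto)
  qed (simp_all add: conv_add_left conv_add_right)
next
  fix c and f assume "f \<in> carrier (monoid_algebra G)"
  then show "c \<odot>\<^bsub>monoid_algebra G\<^esub> f \<in> carrier (monoid_algebra G)"
    using keys_map_subset by fastforce
qed (simp_all add: scale_mult, (rule poly_mapping_eqI, simp add: lookup_add algebra_simps)+)

sublocale MA: complex_alg "monoid_algebra G"
  by (rule complex_algI) (rule complex_algebra_monoid_algebra)

lemma linear_functional_lin_ext: "linear_functional (monoid_algebra G) (lin_ext g)"
  by (simp add: linear_functional_def)

lemma lin_ext_single_mult_single:
  assumes "keys r \<subseteq> carrier G"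
  shows "lin_ext g (single x c \<star> r \<star> single y d) = c * d * lin_ext (\<lambda>w. g (x \<otimes> w \<otimes> y)) r"
  using assms
  by (induction r rule: keys_induct)
     (auto simp: conv_add_right conv_add_left conv_single
       algebra_simps)

text \<open>\<open>J\<close> is the largest two-sided ideal in the kernel of
  \<open>lin_ext g\<close>. By linearity in both outer factors it contains \<open>R\<close> as soon
  as all translates of relations by monoid elements are annihilated, and then it contains the
  generated ideal.\<close>

lemma lin_ext_Idl:
  assumes R: "R \<subseteq> carrier (monoid_algebra G)"
    and g: "\<And>r x y. r \<in> R \<Longrightarrow> x \<in> carrier G \<Longrightarrow> y \<in> carrier G \<Longrightarrow> lin_ext (\<lambda>w. g (x \<otimes> w \<otimes> y)) r = 0"
    and f: "f \<in> Idl\<^bsub>monoid_algebra G\<^esub> R"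
  shows "lin_ext g f = 0"
proof -
  let ?M = "carrier (monoid_algebra G)"
  define J where "J = {f \<in> ?M. \<forall>h\<in>?M. \<forall>h'\<in>?M. lin_ext g (h \<star> f \<star> h') = 0}"
  have "ideal J (monoid_algebra G)"
  proof (rule idealI)
    show "subgroup J (add_monoid (monoid_algebra G))"
    proof (rule MA.add.subgroupI)
      show "J \<noteq> {}"
        by (auto simp: J_def intro!: exI[of _ 0])
    next
      fix f assume f: "f \<in> J"
      then have "\<ominus>\<^bsub>monoid_algebra G\<^esub> f = scale (- 1) f"
        by (simp add: J_def MA.a_inv_eq_smult)
      moreover have "scale (- 1) f \<in> J"
        using f keys_map_subset[of "(*) (- 1)" f] unfolding J_def by (auto simp: scale_mult)
      ultimately show "\<ominus>\<^bsub>monoid_algebra G\<^esub> f \<in> J"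
        by simp
    qed (auto simp: J_def conv_add_left conv_add_right
        simp del: subset_iff simp add: keys_add_subset)
  next
    fix f h assume fh: "f \<in> J" "h \<in> ?M"
    have "k \<star> (h \<star> f) \<star> k' = (k \<star> h) \<star> f \<star> k'" "k \<star> (f \<star> h) \<star> k' = k \<star> f \<star> (h \<star> k')"
      if "k \<in> ?M" "k' \<in> ?M" for k k'
      using fh that unfolding J_def by (simp_all only: mem_Collect_eq MA.m_assoc MA.m_closed)
    then show "h \<star> f \<in> J" "f \<star> h \<in> J"
      using fh MA.m_closed unfolding J_def by simp_all
  qed (rule MA.ring_axioms)
  moreover have "lin_ext g (h \<star> r \<star> h') = 0"
    if r: "r \<in> R" and h: "keys h \<subseteq> carrier G" and h': "keys h' \<subseteq> carrier G" for r h h'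
    using h
  proof (induction h rule: keys_induct)
    case (single x c)
    from h' show ?case
      by (induction h' rule: keys_induct)
         (use R r g single lin_ext_single_mult_single[of r g x c] in
           \<open>auto simp: conv_add_right\<close>)
  qed (simp_all add: conv_add_left)
  then have "R \<subseteq> J"
    using R by (auto simp: J_def)
  ultimately have "f \<in> J"
    using MA.genideal_minimal f by blast
  \<comment> \<open>With both outer factors equal to the unit, membership in \<open>J\<close>
    becomes the vanishing itself.\<close>
  then have f': "f \<in> ?M" "lin_ext g (\<one>\<^bsub>monoid_algebra G\<^esub> \<star> f \<star> \<one>\<^bsub>monoid_algebra G\<^esub>) = 0"
    unfolding J_def using MA.one_closed by blast+
  then show ?thesis
    by (simp only: MA.l_one MA.r_one)
qed

end

section \<open>Quotients\<close>

locale quotient = complex_alg R + ideal J R for R :: "'a calg" (structure) and J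
begin

abbreviation Q :: "'a set calg" where "Q \<equiv> quotient_algebra R J"

lemma quotient_simps [simp]:
  "carrier Q = carrier (R Quot J)" "\<one>\<^bsub>Q\<^esub> = J +> \<one>" "\<zero>\<^bsub>Q\<^esub> = J"
  by (simp_all add: quotient_algebra_def FactRing_def)

lemma carrier_quotient: "carrier (R Quot J) = (\<lambda>x. J +> x) ` carrier R"
  by (auto simp: FactRing_def A_RCOSETS_def')

lemma coset_closed [simp, intro]: "x \<in> carrier R \<Longrightarrow> J +> x \<in> carrier (R Quot J)"
  by (simp add: carrier_quotient)

lemma coset_eq_iff: "x \<in> carrier R \<Longrightarrow> y \<in> carrier R \<Longrightarrow> J +> x = J +> y \<longleftrightarrow> x \<ominus> y \<in> J"
  using quotient_eq_iff_same_a_r_cos[OF is_ideal] by blast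

lemma coset_zero: "J +> \<zero> = J"
  using a_rcos_zero is_ideal zero_closed by blast

lemma coset_add: "x \<in> carrier R \<Longrightarrow> y \<in> carrier R \<Longrightarrow> (J +> x) \<oplus>\<^bsub>Q\<^esub> (J +> y) = J +> (x \<oplus> y)"
  by (simp add: quotient_algebra_def FactRing_def a_rcos_sum)

lemma coset_mult: "x \<in> carrier R \<Longrightarrow> y \<in> carrier R \<Longrightarrow> (J +> x) \<otimes>\<^bsub>Q\<^esub> (J +> y) = J +> (x \<otimes> y)"
  by (simp add: quotient_algebra_def FactRing_def rcoset_mult_add)

text \<open>A scalar acts as left multiplication by \<open>c \<odot> \<one>\<close>, so ring ideals
  are automatically subspaces.\<close>

lemma smult_in_ideal:
  assumes "x \<in> J" shows "c \<odot> x \<in> J"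
proof -
  have "(c \<odot> \<one>) \<otimes> x \<in> J"
    using assms by (intro I_l_closed) auto
  then show ?thesis
    using assms Icarr by (simp add: smult_mult_left)
qed

text \<open>Scalar multiplication of a coset is a union over all representatives. Their differences
  lie in the ideal, which is a subspace, so all members of the union coincide.\<close>

lemma coset_smult:
  assumes x: "x \<in> carrier R" shows "c \<odot>\<^bsub>Q\<^esub> (J +> x) = J +> (c \<odot> x)"
proof -
  have "J +> (c \<odot> y) = J +> (c \<odot> x)" if "y \<in> J +> x" for y
  proof -
    have y: "y \<in> carrier R"
      using that x a_r_coset_subset_G a_subset by blast
    have "J +> y = J +> x"
      using a_repr_independence'[OF that x] by simp
    then have "y \<ominus> x \<in> J"
      using coset_eq_iff[OF y x] by simp
    then have "c \<odot> (y \<ominus> x) \<in> J"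
      by (rule smult_in_ideal)
    also have "c \<odot> (y \<ominus> x) = c \<odot> y \<ominus> c \<odot> x"
      using x y by (simp add: a_minus_def a_inv_eq_smult smult_r_distr flip: smult_assoc)
    finally show ?thesis
      using coset_eq_iff[of "c \<odot> y" "c \<odot> x"] x y by simp
  qed
  moreover have "x \<in> J +> x"
    using x by (rule a_rcos_self)
  ultimately have "(\<Union>y\<in>J +> x. J +> (c \<odot> y)) = J +> (c \<odot> x)"
    by blast
  then show ?thesis
    by (simp add: quotient_algebra_def)
qed

lemma complex_algebra_quotient: "complex_algebra Q"
proof (rule complex_algebraI)
  interpret S: ring "R Quot J"
    by (rule quotient_is_ring)
  \<comment> \<open>\<open>Q\<close> and the quotient ring have different record types; the ring
    laws are carried over through the five common fields.\<close>
  have eqs: "carrier Q = carrier (R Quot J)" "monoid.mult Q = monoid.mult (R Quot J)"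
    "one Q = one (R Quot J)" "zero Q = zero (R Quot J)" "add Q = add (R Quot J)"
    by (simp_all add: quotient_algebra_def)
  show "ring Q"
  proof (rule ringI)
    show "abelian_group Q"
    proof (rule abelian_groupI)
      fix x assume "x \<in> carrier Q"
      then show "\<exists>y\<in>carrier Q. y \<oplus>\<^bsub>Q\<^esub> x = \<zero>\<^bsub>Q\<^esub>"
        unfolding eqs using S.a_inv_closed S.l_neg by blast
    qed (unfold eqs, (rule S.a_closed S.zero_closed S.a_assoc S.a_comm S.l_zero; assumption)+)
    show "monoid Q"
      by (rule monoidI, unfold eqs)
         (rule S.m_closed S.one_closed S.m_assoc S.l_one S.r_one; assumption)+
  qed (unfold eqs, (rule S.l_distr S.r_distr; assumption)+)
qed (auto simp: carrier_quotient coset_smult coset_add coset_mult smult_l_distr smult_r_distr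
      smult_assoc smult_mult_left smult_mult_right)

lemma quotient_lift:
  assumes "\<And>x y. x \<in> carrier R \<Longrightarrow> y \<in> carrier R \<Longrightarrow> J +> x = J +> y \<Longrightarrow> h x = h y"
  shows "\<exists>f. \<forall>x\<in>carrier R. f (J +> x) = h x"
proof (intro exI ballI)
  fix x assume "x \<in> carrier R"
  then have "\<exists>y. y \<in> carrier R \<and> J +> y = J +> x"
    by blast
  from someI_ex[OF this] show "(\<lambda>Y. h (SOME y. y \<in> carrier R \<and> J +> y = Y)) (J +> x) = h x"
    by (elim conjE) (rule assms[OF _ \<open>x \<in> carrier R\<close>])
qed

lemma linear_functional_lift:
  assumes h: "linear_functional R h" and zero: "\<And>x. x \<in> J \<Longrightarrow> h x = 0"
  obtains f where "linear_functional Q f" "\<And>x. x \<in> carrier R \<Longrightarrow> f (J +> x) = h x"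
proof -
  have eq: "h x = h y" if "x \<in> carrier R" "y \<in> carrier R" "J +> x = J +> y" for x y
    using linear_functional_minus[OF h that(1,2)] zero[of "x \<ominus> y"] coset_eq_iff[OF that(1,2)] that(3)
    by simp
  obtain f where f: "\<forall>x\<in>carrier R. f (J +> x) = h x"
    using quotient_lift[of h, OF eq] by (rule exE)
  have "linear_functional Q f"
    unfolding linear_functional_def quotient_simps carrier_quotient ball_simps(9)
    using h by (simp add: coset_add coset_smult f linear_functional_def)
  then show thesis
    by (rule that) (rule f[THEN bspec])
qed

end

section \<open>Algebras presented by generators and relations\<close>

text \<open>The monoid is arbitrary so that one construction covers words, giving the free products
  and the extended algebra, and families of entries, giving the infinite tensor product.\<close>

locale presentation = plain_monoid G for G :: "'g monoid" (structure) +
  fixes Rel :: "('g \<Rightarrow>\<^sub>0 complex) set"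
  assumes Rel: "\<And>r. r \<in> Rel \<Longrightarrow> keys r \<subseteq> carrier G"
begin

lemma Rel_subset: "Rel \<subseteq> carrier (monoid_algebra G)"
  using Rel by auto

sublocale QA: quotient "monoid_algebra G" "Idl\<^bsub>monoid_algebra G\<^esub> Rel"
  using MA.genideal_ideal[OF Rel_subset]
  by (simp add: quotient_def ideal_def MA.complex_alg_axioms)

sublocale Q: complex_alg QA.Q
  by (rule complex_algI) (rule QA.complex_algebra_quotient)

definition coset :: "('g \<Rightarrow>\<^sub>0 complex) \<Rightarrow> ('g \<Rightarrow>\<^sub>0 complex) set" where
  "coset f = Idl\<^bsub>monoid_algebra G\<^esub> Rel +>\<^bsub>monoid_algebra G\<^esub> f"

lemma carrier_Q: "carrier QA.Q = coset ` {f. keys f \<subseteq> carrier G}"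
  using QA.carrier_quotient by (simp add: coset_def)

lemma coset_closed: "keys f \<subseteq> carrier G \<Longrightarrow> coset f \<in> carrier QA.Q"
  unfolding carrier_Q by blast

lemma coset_add:
  "keys f \<subseteq> carrier G \<Longrightarrow> keys g \<subseteq> carrier G \<Longrightarrow>
     coset (f + g) = coset f \<oplus>\<^bsub>QA.Q\<^esub> coset g"
  using QA.coset_add[of f g] by (simp add: coset_def)

lemma coset_zero: "coset 0 = \<zero>\<^bsub>QA.Q\<^esub>"
  using QA.coset_zero by (simp add: coset_def)

lemma coset_mult:
  "keys f \<subseteq> carrier G \<Longrightarrow> keys g \<subseteq> carrier G \<Longrightarrow>
     coset (f \<star> g) = coset f \<otimes>\<^bsub>QA.Q\<^esub> coset g"
  using QA.coset_mult[of f g] by (simp add: coset_def)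

lemma coset_smult:
  "keys f \<subseteq> carrier G \<Longrightarrow>
     coset (scale c f) = c \<odot>\<^bsub>QA.Q\<^esub> coset f"
  using QA.coset_smult[of f c] by (simp add: coset_def)

lemma coset_eq_iff:
  "keys f \<subseteq> carrier G \<Longrightarrow> keys g \<subseteq> carrier G \<Longrightarrow>
     coset f = coset g \<longleftrightarrow> f \<ominus>\<^bsub>monoid_algebra G\<^esub> g \<in> Idl\<^bsub>monoid_algebra G\<^esub> Rel"
  unfolding coset_def by (rule QA.coset_eq_iff) simp_all

lemma coset_relation: "r \<in> Rel \<Longrightarrow> coset r = \<zero>\<^bsub>QA.Q\<^esub>"
  unfolding coset_def QA.quotient_simps
  by (rule MA.a_rcos_zero[OF QA.is_ideal]) (use MA.genideal_self[OF Rel_subset] in blast)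

definition cls :: "'g \<Rightarrow> ('g \<Rightarrow>\<^sub>0 complex) set" where
  "cls w = coset (single w 1)"

lemma cls_closed [simp, intro]: "w \<in> carrier G \<Longrightarrow> cls w \<in> carrier QA.Q"
  unfolding cls_def by (rule coset_closed) simp

lemma cls_mult: "x \<in> carrier G \<Longrightarrow> y \<in> carrier G \<Longrightarrow> cls x \<otimes>\<^bsub>QA.Q\<^esub> cls y = cls (x \<otimes> y)"
  using QA.coset_mult[of "single x 1" "single y 1"]
  by (simp add: cls_def coset_def conv_single)

lemma cls_one: "cls \<one> = \<one>\<^bsub>QA.Q\<^esub>"
  by (simp add: cls_def coset_def)

lemma coset_single:
  "w \<in> carrier G \<Longrightarrow> coset (single w c) = c \<odot>\<^bsub>QA.Q\<^esub> cls w"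
  using QA.coset_smult[of "single w 1" c] by (simp add: cls_def coset_def)

lemma cls_lincomb:
  assumes r: "single w 1 - single u \<alpha> - single v \<beta> \<in> Rel"
    and "w \<in> carrier G" and u: "u \<in> carrier G" and v: "v \<in> carrier G"
  shows "cls w = \<alpha> \<odot>\<^bsub>QA.Q\<^esub> cls u \<oplus>\<^bsub>QA.Q\<^esub> \<beta> \<odot>\<^bsub>QA.Q\<^esub> cls v"
proof -
  define r where "r = single w 1 - single u \<alpha> - single v \<beta>"
  have keys: "keys (single u \<alpha>) \<subseteq> carrier G"
    "keys (single v \<beta>) \<subseteq> carrier G"
    using u v by simp_all
  have "cls w = coset (r + (single u \<alpha> + single v \<beta>))"
    by (simp add: cls_def r_def)
  also have "\<dots> = \<zero>\<^bsub>QA.Q\<^esub> \<oplus>\<^bsub>QA.Q\<^esub>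
      (coset (single u \<alpha>) \<oplus>\<^bsub>QA.Q\<^esub> coset (single v \<beta>))"
    using r unfolding r_def[symmetric]
    by (simp only: coset_add keys keys_add_subset Rel coset_relation)
  also have "\<dots> = coset (single u \<alpha>) \<oplus>\<^bsub>QA.Q\<^esub> coset (single v \<beta>)"
    by (intro Q.l_zero Q.a_closed coset_closed keys)
  finally show ?thesis
    by (simp only: coset_single u v)
qed

lemma cls_eq:
  assumes "single w 1 - single u 1 \<in> Rel"
    and "w \<in> carrier G" "u \<in> carrier G"
  shows "cls w = cls u"
proof -
  \<comment> \<open>A two term relation is a three term one with \<beta> = 0, the third element
    being \<open>u\<close> again.\<close>
  have "cls w = 1 \<odot>\<^bsub>QA.Q\<^esub> cls u \<oplus>\<^bsub>QA.Q\<^esub> 0 \<odot>\<^bsub>QA.Q\<^esub> cls u"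
    using assms by (intro cls_lincomb) simp_all
  then show ?thesis
    by (simp only: Q.smult_one[OF cls_closed] Q.smult_zero_left[OF cls_closed] Q.r_zero[OF cls_closed] assms(3))
qed

lemma cls_induct [consumes 1, case_names zero cls add smult]:
  assumes x: "x \<in> carrier QA.Q"
    and zero: "P \<zero>\<^bsub>QA.Q\<^esub>"
    and cls: "\<And>w. w \<in> carrier G \<Longrightarrow> P (cls w)"
    and add: "\<And>x y. x \<in> carrier QA.Q \<Longrightarrow> y \<in> carrier QA.Q \<Longrightarrow> P x \<Longrightarrow> P y \<Longrightarrow> P (x \<oplus>\<^bsub>QA.Q\<^esub> y)"
    and smult: "\<And>c x. x \<in> carrier QA.Q \<Longrightarrow> P x \<Longrightarrow> P (c \<odot>\<^bsub>QA.Q\<^esub> x)"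
  shows "P x"
proof -
  obtain f where f: "x = coset f" "keys f \<subseteq> carrier G"
    using x unfolding carrier_Q by blast
  from f(2) have "P (coset f)"
  proof (induction f rule: keys_induct)
    case zero
    show ?case
      unfolding coset_zero by (rule assms(2))
  next
    case (single w c)
    show ?case
      unfolding coset_single[OF single] by (rule smult[OF cls_closed[OF single] cls[OF single]])
  next
    case (add f g)
    show ?case
      unfolding coset_add[OF add(1,2)]
      by (rule assms(4)[OF coset_closed[OF add(1)] coset_closed[OF add(2)] add(3,4)])
  qed
  then show ?thesis
    unfolding f(1) .
qed

lemma functional_eqI:
  assumes f: "linear_functional QA.Q f" and g: "linear_functional QA.Q g"
    and eq: "\<And>w. w \<in> carrier G \<Longrightarrow> f (cls w) = g (cls w)"
    and x: "x \<in> carrier QA.Q"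
  shows "f x = g x"
  using x
proof (induction x rule: cls_induct)
  case zero
  show ?case
    unfolding Q.linear_functional_zero[OF f] Q.linear_functional_zero[OF g] ..
qed (use f g eq in \<open>simp_all only: linear_functional_def\<close>)

text \<open>Vanishing on the relations alone would not suffice: a functional descends only if it
  kills the whole ideal, hence the test on all translates by \<open>x\<close> and
  \<open>y\<close>.\<close>

lemma functional_exists:
  assumes "\<And>r x y. r \<in> Rel \<Longrightarrow> x \<in> carrier G \<Longrightarrow> y \<in> carrier G \<Longrightarrow> lin_ext (\<lambda>w. g (x \<otimes> w \<otimes> y)) r = 0"
  shows "\<exists>f. linear_functional QA.Q f \<and> (\<forall>w\<in>carrier G. f (cls w) = g w)"
proof -
  have "lin_ext g f = 0" if "f \<in> Idl\<^bsub>monoid_algebra G\<^esub> Rel" for f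
    by (rule lin_ext_Idl[OF Rel_subset assms that])
  from QA.linear_functional_lift[OF linear_functional_lin_ext this, folded coset_def]
  obtain f where f: "linear_functional QA.Q f"
    "\<And>x. x \<in> carrier (monoid_algebra G) \<Longrightarrow> f (coset x) = lin_ext g x"
    by blast
  show ?thesis
    by (intro exI[of _ f] conjI f(1)) (simp add: cls_def f(2))
qed

end

lemma plain_monoid_word_monoid: "plain_monoid (word_monoid S)"
  unfolding plain_monoid_def by (rule monoidI) (auto simp: word_monoid_def)

lemma word_monoid_simps [simp]:
  "carrier (word_monoid S) = lists S" "\<one>\<^bsub>word_monoid S\<^esub> = []" "u \<otimes>\<^bsub>word_monoid S\<^esub> v = u @ v"
  by (simp_all add: word_monoid_def)

lemma lin_ext_algebra_relations:
  assumes r: "r \<in> algebra_relations A e"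
    and lin: "\<And>\<alpha> \<beta> a b. a \<in> carrier A \<Longrightarrow> b \<in> carrier A \<Longrightarrow>
      g [e (\<alpha> \<odot>\<^bsub>A\<^esub> a \<oplus>\<^bsub>A\<^esub> \<beta> \<odot>\<^bsub>A\<^esub> b)] = \<alpha> * g [e a] + \<beta> * g [e b]"
    and mult: "\<And>a b. a \<in> carrier A \<Longrightarrow> b \<in> carrier A \<Longrightarrow> g [e a, e b] = g [e (a \<otimes>\<^bsub>A\<^esub> b)]"
  shows "lin_ext g r = 0"
  using r unfolding algebra_relations_def by (auto simp: lin mult)

lemma keys_algebra_relations:
  assumes "complex_algebra A" and e: "\<And>a. a \<in> carrier A \<Longrightarrow> e a \<in> S" and r: "r \<in> algebra_relations A e"
  shows "keys r \<subseteq> lists S"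
proof -
  interpret complex_alg A
    using assms(1) by (rule complex_algI)
  show ?thesis
    using r unfolding algebra_relations_def
    by (elim UnE CollectE exE conjE; hypsubst; intro keys_diff_subset; simp add: e)
qed

lemma keys_unit_relation:
  assumes "complex_algebra A" and e: "\<And>a. a \<in> carrier A \<Longrightarrow> e a \<in> S"
  shows "keys (unit_relation A e) \<subseteq> lists S"
proof -
  interpret complex_alg A
    using assms(1) by (rule complex_algI)
  show ?thesis
    unfolding unit_relation_def by (intro keys_diff_subset) (simp_all add: e)
qed

locale word_presentation = presentation "word_monoid S" Rel
  for S :: "'x set" and Rel :: "('x list \<Rightarrow>\<^sub>0 complex) set"
begin

lemma presented_algebra_eq: "presented_algebra S Rel = QA.Q"
  by (simp add: presented_algebra_def relation_ideal_def)

lemma generator_eq: "generator S Rel x = cls [x]"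
  by (simp add: generator_def relation_ideal_def cls_def coset_def)

lemma list_prod_generators: "w \<in> lists S \<Longrightarrow> list_prod QA.Q (map (\<lambda>x. cls [x]) w) = cls w"
proof (induction w)
  case Nil
  show ?case
    using cls_one by (simp only: list.map list_prod_Nil word_monoid_simps)
qed (simp add: cls_mult)

lemma word_functional_exists:
  assumes "\<And>r x y. r \<in> Rel \<Longrightarrow> x \<in> lists S \<Longrightarrow> y \<in> lists S \<Longrightarrow> lin_ext (\<lambda>w. g (x @ w @ y)) r = 0"
  shows "\<exists>f. linear_functional QA.Q f \<and> (\<forall>w\<in>lists S. f (cls w) = g w)"
  using functional_exists[of g] assms by simp

lemma cls_append: "u \<in> lists S \<Longrightarrow> v \<in> lists S \<Longrightarrow> cls (u @ v) = cls u \<otimes>\<^bsub>QA.Q\<^esub> cls v"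
  by (simp add: cls_mult)

text \<open>The product of classes is well defined, hence relations may be applied inside a
  word.\<close>

lemma cls_context:
  assumes "cls u = cls v" "u \<in> lists S" "v \<in> lists S" "x \<in> lists S" "y \<in> lists S"
  shows "cls (x @ u @ y) = cls (x @ v @ y)"
  using assms cls_append[of x "u @ y"] cls_append[of x "v @ y"] cls_append[of u y] cls_append[of v y]
  by simp

end

section \<open>The algebra with an adjoined idempotent\<close>

locale nc_space = complex_alg A for A :: "'a calg" (structure) +
  fixes \<phi> :: "'a \<Rightarrow> complex"
  assumes linear: "linear_functional A \<phi>" and unit: "\<phi> \<one> = 1"
begin

lemma phi_add: "x \<in> carrier A \<Longrightarrow> y \<in> carrier A \<Longrightarrow> \<phi> (x \<oplus> y) = \<phi> x + \<phi> y"
  and phi_smult: "x \<in> carrier A \<Longrightarrow> \<phi> (c \<odot> x) = c * \<phi> x"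
  using linear by (simp_all add: linear_functional_def)

definition center :: "'a \<Rightarrow> 'a" where
  "center a = a \<oplus> (- \<phi> a) \<odot> \<one>"

lemma center_closed [simp, intro]: "a \<in> carrier A \<Longrightarrow> center a \<in> carrier A"
  by (simp add: center_def)

lemma phi_center [simp]: "a \<in> carrier A \<Longrightarrow> \<phi> (center a) = 0"
  by (simp add: center_def phi_add phi_smult unit)

text \<open>The factor 1 stays visible to match the shape \<open>\<alpha> x + \<beta> y\<close> in
  which the linearity lemmas are stated.\<close>

lemma center_decomposition: "a \<in> carrier A \<Longrightarrow> 1 \<odot> center a \<oplus> \<phi> a \<odot> \<one> = a"
  by (simp add: center_def a_assoc flip: smult_l_distr)

lemma center_lincomb:
  assumes "a \<in> carrier A" "b \<in> carrier A"
  shows "center (\<alpha> \<odot> a \<oplus> \<beta> \<odot> b) = \<alpha> \<odot> center a \<oplus> \<beta> \<odot> center b"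
proof -
  have "\<alpha> \<odot> center a \<oplus> \<beta> \<odot> center b =
      \<alpha> \<odot> a \<oplus> \<beta> \<odot> b \<oplus> ((- \<alpha> * \<phi> a) \<odot> \<one> \<oplus> (- \<beta> * \<phi> b) \<odot> \<one>)"
    using assms by (simp add: center_def smult_r_distr a_ac flip: smult_assoc)
  then show ?thesis
    using assms by (simp add: center_def phi_add phi_smult flip: smult_l_distr)
qed

lemma phi_lincomb:
  "a \<in> carrier A \<Longrightarrow> b \<in> carrier A \<Longrightarrow> \<phi> (\<alpha> \<odot> a \<oplus> \<beta> \<odot> b) = \<alpha> * \<phi> a + \<beta> * \<phi> b"
  by (simp add: phi_add phi_smult)

text \<open>Zero in disguise: with both coefficients 0, linearity in a letter kills every term that
  contains the centred unit.\<close>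

lemma center_one: "center \<one> = 0 \<odot> \<one> \<oplus> 0 \<odot> \<one>"
  using smult_l_distr[of \<one> 1 "- 1"] by (simp add: center_def unit)

abbreviation EL :: "'a option list set" where "EL \<equiv> lists (ext_letters A)"

text \<open>The extended algebra acts on \<open>A\<close>, with \<open>p\<close> as the rank one idempotent \<open>x \<mapsto> \<phi>(x) 1\<close>;
  the functional is \<open>y \<mapsto> \<phi>(y 1)\<close>.\<close>

fun ext_action :: "'a option \<Rightarrow> 'a \<Rightarrow> 'a" where
  "ext_action None x = \<phi> x \<odot> \<one>"
| "ext_action (Some a) x = a \<otimes> x"

definition ext_word_value :: "'a option list \<Rightarrow> complex" where
  "ext_word_value w = \<phi> (foldr ext_action w \<one>)"

lemma ext_action_closed:
  "y \<in> ext_letters A \<Longrightarrow> x \<in> carrier A \<Longrightarrow> ext_action y x \<in> carrier A"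
  by (auto simp: ext_letters_def)

lemma foldr_ext_action_closed:
  "w \<in> EL \<Longrightarrow> x \<in> carrier A \<Longrightarrow> foldr ext_action w x \<in> carrier A"
  by (induction w) (auto intro: ext_action_closed)

lemma foldr_ext_action_lincomb:
  assumes "w \<in> EL" "x \<in> carrier A" "y \<in> carrier A"
  shows "foldr ext_action w (\<alpha> \<odot> x \<oplus> \<beta> \<odot> y) =
    \<alpha> \<odot> foldr ext_action w x \<oplus> \<beta> \<odot> foldr ext_action w y"
  using assms(1)
proof (induction w)
  case (Cons z w)
  have "foldr ext_action w x \<in> carrier A" "foldr ext_action w y \<in> carrier A"
    using Cons.hyps assms foldr_ext_action_closed by (auto simp: lists_eq_set)
  then show ?case
    using Cons by (cases z)
      (auto simp: ext_letters_def r_distr smult_mult_right phi_add phi_smult smult_l_distr smult_assoc)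
qed simp

text \<open>After \<open>p\<close> has acted, the vector is a multiple of the unit, and the word to
  the left of \<open>p\<close> contributes its own value. This is the source of the factorization at
  \<open>p\<close>.\<close>

lemma foldr_ext_action_smult_one:
  assumes "w \<in> EL"
  shows "\<phi> (foldr ext_action w (c \<odot> \<one>)) = c * \<phi> (foldr ext_action w \<one>)"
proof -
  have "foldr ext_action w (c \<odot> \<one> \<oplus> 0 \<odot> \<one>) = c \<odot> foldr ext_action w \<one> \<oplus> 0 \<odot> foldr ext_action w \<one>"
    using assms by (intro foldr_ext_action_lincomb) auto
  then show ?thesis
    using assms by (simp add: foldr_ext_action_closed phi_smult)
qed

sublocale E: word_presentation "ext_letters A" "ext_relations A"
proof (intro word_presentation.intro presentation.intro presentation_axioms.intro plain_monoid_word_monoid)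
  fix r assume "r \<in> ext_relations A"
  then show "keys r \<subseteq> carrier (word_monoid (ext_letters A))"
    unfolding ext_relations_def
    using keys_algebra_relations[OF complex_algebra, of Some "ext_letters A" r]
      keys_unit_relation[OF complex_algebra, of Some "ext_letters A"]
  proof (elim UnE singletonE)
    assume "r = single [None, None] 1 - single [None] 1"
    then show ?thesis
      by (simp only: word_monoid_simps) (intro keys_diff_subset; simp add: ext_letters_def)
  qed (auto simp: ext_letters_def)
qed

lemma ext_algebra_eq: "ext_algebra A = E.QA.Q"
  by (simp only: ext_algebra_def E.presented_algebra_eq)

lemma ext_emb_eq: "ext_emb A a = E.cls [Some a]"
  by (simp only: ext_emb_def E.generator_eq)

lemma ext_idem_eq: "ext_idem A = E.cls [None]"
  by (simp only: ext_idem_def E.generator_eq)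

abbreviation EA :: "'a ext calg" where "EA \<equiv> ext_algebra A"

sublocale X: complex_alg EA
  unfolding ext_algebra_eq by (rule E.Q.complex_alg_axioms)

lemma Some_ext_letters: "Some a \<in> ext_letters A \<longleftrightarrow> a \<in> carrier A"
  and None_ext_letters: "None \<in> ext_letters A"
  by (auto simp: ext_letters_def)

lemma ext_emb_closed [simp, intro]: "a \<in> carrier A \<Longrightarrow> ext_emb A a \<in> carrier (EA)"
  unfolding ext_emb_eq ext_algebra_eq by (rule E.cls_closed) (simp add: Some_ext_letters)

lemma ext_idem_closed [simp, intro]: "ext_idem A \<in> carrier (EA)"
  unfolding ext_idem_eq ext_algebra_eq by (rule E.cls_closed) (simp add: None_ext_letters)

lemma ext_emb_lincomb:
  assumes "a \<in> carrier A" "b \<in> carrier A"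
  shows "ext_emb A (\<alpha> \<odot> a \<oplus> \<beta> \<odot> b) =
    \<alpha> \<odot>\<^bsub>EA\<^esub> ext_emb A a \<oplus>\<^bsub>EA\<^esub> \<beta> \<odot>\<^bsub>EA\<^esub> ext_emb A b"
  unfolding ext_emb_eq ext_algebra_eq
  by (rule E.cls_lincomb)
     (use assms in \<open>auto simp: Some_ext_letters ext_relations_def algebra_relations_def\<close>)

lemma cls_emb_emb: "a \<in> carrier A \<Longrightarrow> b \<in> carrier A \<Longrightarrow> E.cls [Some a, Some b] = E.cls [Some (a \<otimes> b)]"
  by (rule E.cls_eq) (auto simp: Some_ext_letters ext_relations_def algebra_relations_def)

lemma cls_emb_one: "E.cls [Some \<one>] = E.cls []"
  by (rule E.cls_eq) (auto simp: Some_ext_letters ext_relations_def unit_relation_def)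

lemma cls_idem_idem: "E.cls [None, None] = E.cls [None]"
  by (rule E.cls_eq) (auto simp: None_ext_letters ext_relations_def)

lemma ext_emb_mult:
  "a \<in> carrier A \<Longrightarrow> b \<in> carrier A \<Longrightarrow>
     ext_emb A a \<otimes>\<^bsub>EA\<^esub> ext_emb A b = ext_emb A (a \<otimes> b)"
  unfolding ext_emb_eq ext_algebra_eq
  by (subst E.cls_mult) (simp_all add: Some_ext_letters cls_emb_emb)

lemma ext_emb_one: "ext_emb A \<one> = \<one>\<^bsub>EA\<^esub>"
  unfolding ext_emb_eq ext_algebra_eq cls_emb_one using E.cls_one by simp

lemma ext_idem_idem: "ext_idem A \<otimes>\<^bsub>EA\<^esub> ext_idem A = ext_idem A"
  unfolding ext_idem_eq ext_algebra_eq
  by (subst E.cls_mult) (simp_all add: None_ext_letters cls_idem_idem)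

definition normal_word :: "nat \<Rightarrow> 'a \<Rightarrow> 'a list \<Rightarrow> nat \<Rightarrow> 'a option list" where
  "normal_word \<gamma> a as \<delta> =
     replicate \<gamma> None @ Some a # concat (map (\<lambda>b. [None, Some b]) as) @ replicate \<delta> None"

lemma normal_word_letters:
  "a \<in> carrier A \<Longrightarrow> as \<in> lists (carrier A) \<Longrightarrow> normal_word \<gamma> a as \<delta> \<in> EL"
  unfolding normal_word_def by (auto simp: Some_ext_letters None_ext_letters split: if_splits)

lemma list_prod_normal_word:
  assumes "a \<in> carrier A" "as \<in> lists (carrier A)"
  shows "list_prod (EA) (replicate \<gamma> (ext_idem A) @ ext_emb A a #
      concat (map (\<lambda>b. [ext_idem A, ext_emb A b]) as) @ replicate \<delta> (ext_idem A)) =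
    E.cls (normal_word \<gamma> a as \<delta>)"
proof -
  have "replicate \<gamma> (ext_idem A) @ ext_emb A a #
      concat (map (\<lambda>b. [ext_idem A, ext_emb A b]) as) @ replicate \<delta> (ext_idem A) =
    map (\<lambda>x. E.cls [x]) (normal_word \<gamma> a as \<delta>)"
    by (simp add: normal_word_def ext_idem_eq ext_emb_eq map_concat comp_def)
  then show ?thesis
    using E.list_prod_generators[OF normal_word_letters[OF assms]] by (simp only: ext_algebra_eq)
qed

lemma ext_word_value_normal_word:
  assumes "a \<in> carrier A" "as \<in> lists (carrier A)"
  shows "ext_word_value (normal_word \<gamma> a as \<delta>) = \<phi> a * (\<Prod>b\<leftarrow>as. \<phi> b)"
proof -
  have idem: "\<phi> ((ext_action None ^^ \<gamma>) x) = \<phi> x" if "x \<in> carrier A" for x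
    using that by (induction \<gamma>) (auto simp: phi_smult unit)
  have one: "(ext_action None ^^ \<delta>) \<one> = \<one>"
    by (induction \<delta>) (simp_all add: unit)
  have "foldr ext_action (concat (map (\<lambda>b. [None, Some b]) as)) \<one> = (\<Prod>b\<leftarrow>as. \<phi> b) \<odot> \<one>"
    using assms(2) by (induction as) (auto simp: smult_mult_right phi_smult mult.commute)
  then show ?thesis
    using assms by (simp add: ext_word_value_def normal_word_def one idem smult_mult_right phi_smult mult.commute)
qed

text \<open>Prepending a letter preserves the shape: the only collisions are \<open>p p = p\<close>
  and the product of two neighbours in \<open>A\<close>. The prescribed values therefore determine
  \<open>ext_functional\<close>.\<close>

lemma ext_normal_form:
  assumes "w \<in> EL"
  shows "E.cls w = E.cls [None] \<or>
    (\<exists>\<gamma>\<in>{0, 1}. \<exists>\<delta>\<in>{0, 1}. \<exists>a\<in>carrier A. \<exists>as\<in>lists (carrier A). E.cls w = E.cls (normal_word \<gamma> a as \<delta>))"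
  using assms
proof (induction w)
  case Nil
  \<comment> \<open>The empty word is represented by the internal unit, which is identified with the
    unit of the extended algebra.\<close>
  have "E.cls [] = E.cls (normal_word 0 \<one> [] 0)"
    by (simp add: normal_word_def cls_emb_one)
  then show ?case
    by blast
next
  case (Cons x w)
  have step: "E.cls (x # w) = E.cls (x # v)" if "E.cls w = E.cls v" "v \<in> EL" for v
    using E.cls_context[OF that(1) _ that(2), of "[x]" "[]"] Cons.hyps by simp
  from Cons.IH show ?case
  proof (elim disjE bexE)
    assume "E.cls w = E.cls [None]"
    then have w: "E.cls (x # w) = E.cls [x, None]"
      by (intro step) (simp_all add: None_ext_letters)
    show ?thesis
    proof (cases x)
      case None
      then show ?thesis
        using w cls_idem_idem by simp
    next
      case (Some b)
      then have "E.cls (x # w) = E.cls (normal_word 0 b [] 1)" "b \<in> carrier A"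
        using w Cons.hyps by (simp_all add: normal_word_def Some_ext_letters)
      then show ?thesis
        by blast
    qed
  next
    fix \<gamma> \<delta> a as
    assume *: "\<gamma> \<in> {0, 1::nat}" "\<delta> \<in> {0, 1::nat}" "a \<in> carrier A" "as \<in> lists (carrier A)"
      "E.cls w = E.cls (normal_word \<gamma> a as \<delta>)"
    have w: "E.cls (x # w) = E.cls (x # normal_word \<gamma> a as \<delta>)"
      by (rule step[OF *(5) normal_word_letters[OF *(3,4)]])
    have tail: "concat (map (\<lambda>b. [None, Some b]) as) @ replicate \<delta> None \<in> EL"
      using normal_word_letters[OF *(3,4), of 0 \<delta>] by (simp add: normal_word_def)
    show ?thesis
    proof (cases x)
      case None
      show ?thesis
      proof (cases "\<gamma> = 0")
        case True
        then have "E.cls (x # w) = E.cls (normal_word 1 a as \<delta>)"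
          using w None by (simp add: normal_word_def)
        then show ?thesis
          using * by blast
      next
        case False
        then have "E.cls (x # w) = E.cls ([] @ [None, None] @ Some a # concat (map (\<lambda>b. [None, Some b]) as) @ replicate \<delta> None)"
          using w None * by (simp add: normal_word_def)
        also have "\<dots> = E.cls ([] @ [None] @ Some a # concat (map (\<lambda>b. [None, Some b]) as) @ replicate \<delta> None)"
          by (rule E.cls_context[OF cls_idem_idem]) (use tail * in \<open>simp_all add: None_ext_letters Some_ext_letters\<close>)
        also have "\<dots> = E.cls (normal_word 1 a as \<delta>)"
          by (simp add: normal_word_def)
        finally show ?thesis
          using * by blast
      qed
    next
      case (Some b)
      then have b: "b \<in> carrier A"
        using Cons.hyps by (simp add: Some_ext_letters)
      show ?thesis
      proof (cases "\<gamma> = 0")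
        case True
        then have "E.cls (x # w) = E.cls ([] @ [Some b, Some a] @ concat (map (\<lambda>b. [None, Some b]) as) @ replicate \<delta> None)"
          using w Some by (simp add: normal_word_def)
        also have "\<dots> = E.cls ([] @ [Some (b \<otimes> a)] @ concat (map (\<lambda>b. [None, Some b]) as) @ replicate \<delta> None)"
          by (rule E.cls_context[OF cls_emb_emb]) (use tail * b in \<open>simp_all add: Some_ext_letters\<close>)
        also have "\<dots> = E.cls (normal_word 0 (b \<otimes> a) as \<delta>)"
          by (simp add: normal_word_def)
        finally show ?thesis
          using * b by blast
      next
        case False
        then have "E.cls (x # w) = E.cls (normal_word 0 b (a # as) \<delta>)"
          using w Some * by (simp add: normal_word_def)
        moreover have "a # as \<in> lists (carrier A)"
          using * by simp
        ultimately show ?thesis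
          using * b by blast
      qed
    qed
  qed
qed

section \<open>The functional on the extended algebra and its factorization at the
  idempotent\<close>

definition ext_spec :: "('a ext \<Rightarrow> complex) \<Rightarrow> bool" where
  "ext_spec f \<longleftrightarrow> linear_functional (EA) f \<and> f (ext_idem A) = 1 \<and>
     (\<forall>\<gamma>\<in>{0, 1}. \<forall>\<delta>\<in>{0, 1}. \<forall>a\<in>carrier A. \<forall>as\<in>lists (carrier A).
        f (E.cls (normal_word \<gamma> a as \<delta>)) = \<phi> a * (\<Prod>b\<leftarrow>as. \<phi> b))"

lemma ext_functional_eq: "ext_functional A \<phi> = the_on (carrier (EA)) ext_spec"
  unfolding ext_functional_def ext_spec_def
  by (simp only: list_prod_normal_word cong: ball_cong)

abbreviation ext_fun where "ext_fun \<equiv> ext_functional A \<phi>"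

text \<open>The action on \<open>A\<close> respects the relations, \<open>p p = p\<close> because
  \<phi> is 1 at the unit; this gives existence. Uniqueness is the normal form.\<close>

lemma ext_functional_props:
  "linear_functional (EA) (ext_fun)"
  "\<And>w. w \<in> EL \<Longrightarrow> ext_fun (E.cls w) = ext_word_value w"
proof -
  have closed: "foldr ext_action w \<one> \<in> carrier A" if "w \<in> EL" for w
    using that by (rule foldr_ext_action_closed) simp
  have lincomb: "ext_word_value (x @ [Some (\<alpha> \<odot> a \<oplus> \<beta> \<odot> b)] @ y) =
      \<alpha> * ext_word_value (x @ [Some a] @ y) + \<beta> * ext_word_value (x @ [Some b] @ y)"
    if "x \<in> EL" "y \<in> EL" "a \<in> carrier A" "b \<in> carrier A" for x y a b \<alpha> \<beta>
    using that by (simp add: ext_word_value_def l_distr smult_mult_left closed foldr_ext_action_lincomb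
        foldr_ext_action_closed phi_add phi_smult)
  have "lin_ext (\<lambda>w. ext_word_value (x @ w @ y)) r = 0"
    if "r \<in> ext_relations A" "x \<in> EL" "y \<in> EL" for r x y
    using that(1) unfolding ext_relations_def
  proof (elim UnE)
    assume "r \<in> algebra_relations A Some"
    then show ?thesis
      by (rule lin_ext_algebra_relations)
         (use that lincomb in \<open>simp_all add: ext_word_value_def closed m_assoc\<close>)
  qed (use that closed in \<open>auto simp: unit_relation_def ext_word_value_def phi_smult unit\<close>)
  then have "\<exists>f. linear_functional E.QA.Q f \<and> (\<forall>w\<in>EL. f (E.cls w) = ext_word_value w)"
    by (rule E.word_functional_exists)
  then obtain f where f: "linear_functional (EA) f"
      "\<And>w. w \<in> EL \<Longrightarrow> f (E.cls w) = ext_word_value w"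
    unfolding ext_algebra_eq by blast
  have cls_closed: "w \<in> EL \<Longrightarrow> E.cls w \<in> carrier (EA)" for w
    unfolding ext_algebra_eq by (rule E.cls_closed) simp
  have "the_on (carrier (EA)) ext_spec = restrict f (carrier (EA))"
  proof (rule the_on_eq)
    have "f (ext_idem A) = 1"
      unfolding ext_idem_eq by (subst f(2)) (simp_all add: None_ext_letters ext_word_value_def unit phi_smult)
    then show "ext_spec (restrict f (carrier (EA)))"
      unfolding ext_spec_def
      using X.linear_functional_restrict[OF f(1)]
      by (simp add: cls_closed f(2) normal_word_letters ext_word_value_normal_word)
  next
    fix g x assume g: "ext_spec g" and x: "x \<in> carrier (EA)"
    have "g (E.cls w) = f (E.cls w)" if w: "w \<in> EL" for w
      using ext_normal_form[OF w]
    proof (elim disjE bexE)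
      assume "E.cls w = E.cls [None]"
      then show ?thesis
        using g f(2)[of "[None]"]
        by (simp add: ext_spec_def ext_idem_eq None_ext_letters ext_word_value_def unit phi_smult)
    next
      fix \<gamma> \<delta> a as
      assume *: "\<gamma> \<in> {0, 1::nat}" "\<delta> \<in> {0, 1::nat}" "a \<in> carrier A" "as \<in> lists (carrier A)"
        "E.cls w = E.cls (normal_word \<gamma> a as \<delta>)"
      then have "g (E.cls (normal_word \<gamma> a as \<delta>)) = \<phi> a * (\<Prod>b\<leftarrow>as. \<phi> b)"
        using g unfolding ext_spec_def by blast
      then show ?thesis
        using * by (simp only: f(2) normal_word_letters ext_word_value_normal_word)
    qed
    then show "g x = f x"
      using E.functional_eqI[of g f x] g f(1) x unfolding ext_algebra_eq ext_spec_def by simp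
  qed
  then have "ext_fun = restrict f (carrier (EA))"
    unfolding ext_functional_eq .
  then show "linear_functional (EA) (ext_fun)"
    "\<And>w. w \<in> EL \<Longrightarrow> ext_fun (E.cls w) = ext_word_value w"
    using X.linear_functional_restrict[OF f(1)] f(2) cls_closed by simp_all
qed

lemma ext_functional_emb: "a \<in> carrier A \<Longrightarrow> ext_fun (ext_emb A a) = \<phi> a"
  unfolding ext_emb_eq by (subst ext_functional_props(2)) (simp_all add: Some_ext_letters ext_word_value_def)

lemma ext_functional_one: "ext_fun \<one>\<^bsub>EA\<^esub> = 1"
  using ext_functional_emb[of \<one>] by (simp add: ext_emb_one unit)

lemma ext_functional_idem: "ext_fun (ext_idem A) = 1"
  unfolding ext_idem_eq
  by (subst ext_functional_props(2)) (simp_all add: None_ext_letters ext_word_value_def unit phi_smult)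

text \<open>In a word \<open>u p v\<close>, read from the right, \<open>p\<close> turns the vector
  reached by \<open>v\<close> into its expectation times the unit, and \<open>u\<close> then acts on
  this multiple. Linearity extends the identity first in \<open>z\<close>, then in
  \<open>y\<close>.\<close>

lemma ext_functional_mult_idem_mult:
  assumes y: "y \<in> carrier (EA)" and z: "z \<in> carrier (EA)"
  shows "ext_fun (y \<otimes>\<^bsub>EA\<^esub> (ext_idem A \<otimes>\<^bsub>EA\<^esub> z)) =
    ext_fun y * ext_fun z"
proof -
  let ?f = ext_fun
  note lin = ext_functional_props(1)
  have words: "?f (E.cls u \<otimes>\<^bsub>EA\<^esub> (ext_idem A \<otimes>\<^bsub>EA\<^esub> E.cls v)) = ?f (E.cls u) * ?f (E.cls v)"
    if u: "u \<in> EL" and v: "v \<in> EL" for u v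
  proof -
    have "E.cls u \<otimes>\<^bsub>EA\<^esub> (ext_idem A \<otimes>\<^bsub>EA\<^esub> E.cls v) = E.cls (u @ [None] @ v)"
      unfolding ext_algebra_eq ext_idem_eq using u v by (simp only: E.cls_mult word_monoid_simps
          append_in_lists_conv lists.Cons[OF None_ext_letters lists.Nil] simp_thms)
    also have "?f \<dots> = ?f (E.cls u) * ?f (E.cls v)"
      using u v by (simp add: ext_functional_props(2) None_ext_letters ext_word_value_def foldr_ext_action_smult_one)
    finally show ?thesis .
  qed
  have left: "?f (E.cls u \<otimes>\<^bsub>EA\<^esub> (ext_idem A \<otimes>\<^bsub>EA\<^esub> z)) = ?f (E.cls u) * ?f z"
    if u: "u \<in> EL" for u
  proof -
    have uc: "E.cls u \<in> carrier (EA)"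
      unfolding ext_algebra_eq by (rule E.cls_closed) (simp add: u)
    show ?thesis
    proof (rule E.functional_eqI[folded ext_algebra_eq, OF _ _ _ z])
      show "linear_functional (EA) (\<lambda>z. ?f (E.cls u \<otimes>\<^bsub>EA\<^esub> (ext_idem A \<otimes>\<^bsub>EA\<^esub> z)))"
        using lin uc by (simp add: linear_functional_def X.r_distr X.smult_mult_right)
      show "linear_functional (EA) (\<lambda>z. ?f (E.cls u) * ?f z)"
        using lin by (simp add: linear_functional_def distrib_left)
    qed (simp add: words u)
  qed
  show ?thesis
  proof (rule E.functional_eqI[folded ext_algebra_eq, OF _ _ _ y])
    show "linear_functional (EA) (\<lambda>y. ?f (y \<otimes>\<^bsub>EA\<^esub> (ext_idem A \<otimes>\<^bsub>EA\<^esub> z)))"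
      using lin z by (simp add: linear_functional_def X.l_distr X.smult_mult_left)
    show "linear_functional (EA) (\<lambda>y. ?f y * ?f z)"
      using lin by (simp add: linear_functional_def distrib_right)
  qed (simp add: left)
qed

end

lemma nc_spaceI: "nc_prob_space A \<phi> \<Longrightarrow> nc_space A \<phi>"
  by (simp add: nc_space_def nc_space_axioms_def nc_prob_space_def complex_algI)

section \<open>The infinite tensor product\<close>

locale nc_family =
  fixes I :: "'i set" and A :: "'i \<Rightarrow> 'a calg" and \<phi> :: "'i \<Rightarrow> 'a \<Rightarrow> complex"
  assumes nc_space: "\<And>i. i \<in> I \<Longrightarrow> nc_space (A i) (\<phi> i)"
begin

abbreviation ext :: "'i \<times> nat \<Rightarrow> 'a ext calg" where "ext s \<equiv> ext_algebra (A (fst s))"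
abbreviation C :: "'i \<Rightarrow> 'a set" where "C i \<equiv> carrier (A i)"
abbreviation idem :: "'i \<times> nat \<Rightarrow> 'a ext" where "idem s \<equiv> ext_idem (A (fst s))"
abbreviation val :: "'i \<times> nat \<Rightarrow> 'a ext \<Rightarrow> complex" where
  "val s \<equiv> ext_functional (A (fst s)) (\<phi> (fst s))"
abbreviation TM :: "('i, 'a) tfam monoid" where "TM \<equiv> tensor_monoid I A"
abbreviation family_mult (infixl "\<bullet>" 70) where "x \<bullet> y \<equiv> x \<otimes>\<^bsub>TM\<^esub> y"

lemma site_space: "s \<in> sites I \<Longrightarrow> nc_space (A (fst s)) (\<phi> (fst s))"
  using nc_space by (auto simp: sites_def)

lemma tensor_monoid_one: "\<one>\<^bsub>TM\<^esub> = (\<lambda>s\<in>sites I. \<one>\<^bsub>ext s\<^esub>)"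
  and tensor_monoid_mult: "x \<bullet> y = (\<lambda>s\<in>sites I. x s \<otimes>\<^bsub>ext s\<^esub> y s)"
  by (simp_all add: tensor_monoid_def)

lemma tensor_monoid_carrier_iff: "x \<in> carrier TM \<longleftrightarrow>
    x \<in> extensional (sites I) \<and> (\<forall>s\<in>sites I. x s \<in> carrier (ext s)) \<and>
    finite {s \<in> sites I. x s \<noteq> \<one>\<^bsub>ext s\<^esub> \<and> x s \<noteq> idem s}"
  by (auto simp: tensor_monoid_def PiE_def Pi_def)

lemma tensor_entry_closed: "x \<in> carrier TM \<Longrightarrow> s \<in> sites I \<Longrightarrow> x s \<in> carrier (ext s)"
  by (simp add: tensor_monoid_carrier_iff)

lemma site_one_closed: "s \<in> sites I \<Longrightarrow> \<one>\<^bsub>ext s\<^esub> \<in> carrier (ext s)"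
  and site_idem_closed: "s \<in> sites I \<Longrightarrow> idem s \<in> carrier (ext s)"
proof -
  assume "s \<in> sites I"
  then interpret nc_space "A (fst s)" "\<phi> (fst s)"
    by (rule site_space)
  show "\<one>\<^bsub>ext s\<^esub> \<in> carrier (ext s)" "idem s \<in> carrier (ext s)"
    by simp_all
qed

text \<open>Idempotence of \<open>p\<close> makes \<open>{1, p}\<close> closed under products, so an
  exceptional site of a product is exceptional for one of the factors.\<close>

lemma tensor_monoid_mult_closed:
  assumes x: "x \<in> carrier TM" and y: "y \<in> carrier TM"
  shows "x \<bullet> y \<in> carrier TM"
proof -
  have closed: "x s \<otimes>\<^bsub>ext s\<^esub> y s \<in> carrier (ext s)" if s: "s \<in> sites I" for s
  proof -
    interpret nc_space "A (fst s)" "\<phi> (fst s)"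
      using s by (rule site_space)
    show ?thesis
      using tensor_entry_closed x y s by simp
  qed
  let ?N = "\<lambda>x. {s \<in> sites I. x s \<noteq> \<one>\<^bsub>ext s\<^esub> \<and> x s \<noteq> idem s}"
  have "?N (x \<bullet> y) \<subseteq> ?N x \<union> ?N y"
  proof
    fix s assume s: "s \<in> ?N (x \<bullet> y)"
    then interpret nc_space "A (fst s)" "\<phi> (fst s)"
      using site_space by blast
    show "s \<in> ?N x \<union> ?N y"
      using s by (auto simp: tensor_monoid_mult ext_idem_idem)
  qed
  moreover have "finite (?N x)" "finite (?N y)"
    using x y by (simp_all add: tensor_monoid_carrier_iff)
  ultimately have "finite (?N (x \<bullet> y))"
    by (meson finite_UnI finite_subset)
  then show ?thesis
    using closed unfolding tensor_monoid_carrier_iff by (simp add: tensor_monoid_mult)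
qed

lemma tensor_monoid_one_closed: "\<one>\<^bsub>TM\<^esub> \<in> carrier TM"
  using site_one_closed by (simp add: tensor_monoid_carrier_iff tensor_monoid_one)

lemma tensor_ext:
  "x \<in> carrier TM \<Longrightarrow> y \<in> carrier TM \<Longrightarrow> (\<And>s. s \<in> sites I \<Longrightarrow> x s = y s) \<Longrightarrow> x = y"
  by (rule extensionalityI[of _ "sites I"]) (simp_all add: tensor_monoid_carrier_iff)

lemma plain_monoid_tensor_monoid: "plain_monoid TM"
  unfolding plain_monoid_def
proof (rule monoidI)
  fix x y z assume xyz: "x \<in> carrier TM" "y \<in> carrier TM" "z \<in> carrier TM"
  show "x \<bullet> y \<bullet> z = x \<bullet> (y \<bullet> z)"
  proof (rule tensor_ext)
    fix s assume s: "s \<in> sites I"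
    then interpret nc_space "A (fst s)" "\<phi> (fst s)"
      by (rule site_space)
    show "(x \<bullet> y \<bullet> z) s = (x \<bullet> (y \<bullet> z)) s"
      using s xyz by (simp add: tensor_monoid_mult X.m_assoc tensor_entry_closed)
  qed (intro tensor_monoid_mult_closed xyz)+
next
  fix x assume x: "x \<in> carrier TM"
  have *: "(\<one>\<^bsub>TM\<^esub> \<bullet> x) s = x s \<and> (x \<bullet> \<one>\<^bsub>TM\<^esub>) s = x s" if s: "s \<in> sites I" for s
  proof -
    interpret nc_space "A (fst s)" "\<phi> (fst s)"
      using s by (rule site_space)
    show ?thesis
      using s x by (simp add: tensor_monoid_mult tensor_monoid_one tensor_entry_closed)
  qed
  show "\<one>\<^bsub>TM\<^esub> \<bullet> x = x"
    by (rule tensor_ext) (use * x tensor_monoid_mult_closed tensor_monoid_one_closed in simp_all)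
  show "x \<bullet> \<one>\<^bsub>TM\<^esub> = x"
    by (rule tensor_ext) (use * x tensor_monoid_mult_closed tensor_monoid_one_closed in simp_all)
qed (simp_all add: tensor_monoid_mult_closed tensor_monoid_one_closed)

lemma tensor_upd_closed:
  assumes x: "x \<in> carrier TM" and s: "s \<in> sites I" and u: "u \<in> carrier (ext s)"
  shows "x(s := u) \<in> carrier TM"
proof -
  have "finite {t \<in> sites I. x t \<noteq> \<one>\<^bsub>ext t\<^esub> \<and> x t \<noteq> idem t}"
    using x by (simp add: tensor_monoid_carrier_iff)
  then have "finite (insert s {t \<in> sites I. x t \<noteq> \<one>\<^bsub>ext t\<^esub> \<and> x t \<noteq> idem t})"
    by simp
  then have "finite {t \<in> sites I. (x(s := u)) t \<noteq> \<one>\<^bsub>ext t\<^esub> \<and> (x(s := u)) t \<noteq> idem t}"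
    by (rule rev_finite_subset) auto
  then show ?thesis
    using x s u unfolding tensor_monoid_carrier_iff by (auto simp: extensional_def)
qed

sublocale T: presentation TM "multilinearity_relations I A"
proof (intro presentation.intro presentation_axioms.intro plain_monoid_tensor_monoid)
  fix r assume "r \<in> multilinearity_relations I A"
  then obtain x s \<alpha> \<beta> u v where *: "x \<in> carrier TM" "s \<in> sites I" "u \<in> carrier (ext s)" "v \<in> carrier (ext s)"
    and r: "r = single (x(s := \<alpha> \<odot>\<^bsub>ext s\<^esub> u \<oplus>\<^bsub>ext s\<^esub> \<beta> \<odot>\<^bsub>ext s\<^esub> v)) 1
        - single (x(s := u)) \<alpha> - single (x(s := v)) \<beta>"
    unfolding multilinearity_relations_def by blast
  interpret nc_space "A (fst s)" "\<phi> (fst s)"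
    using *(2) by (rule site_space)
  show "keys r \<subseteq> carrier TM"
    unfolding r using * by (intro keys_diff_subset) (simp_all add: tensor_upd_closed)
qed

lemma tensor_algebra_eq: "tensor_algebra I A = T.QA.Q"
  by (simp add: tensor_algebra_def multilinearity_ideal_def)

lemma simple_tensor_eq: "simple_tensor I A x = T.cls x"
  by (simp add: simple_tensor_def multilinearity_ideal_def T.cls_def T.coset_def)

abbreviation TA :: "('i, 'a) tensor calg" where "TA \<equiv> tensor_algebra I A"

sublocale TA: complex_alg TA
  unfolding tensor_algebra_eq by (rule T.Q.complex_alg_axioms)

lemma simple_tensor_closed [simp, intro]: "x \<in> carrier TM \<Longrightarrow> simple_tensor I A x \<in> carrier TA"
  unfolding simple_tensor_eq tensor_algebra_eq by (rule T.cls_closed)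

lemma simple_tensor_mult:
  "x \<in> carrier TM \<Longrightarrow> y \<in> carrier TM \<Longrightarrow>
     simple_tensor I A x \<otimes>\<^bsub>TA\<^esub> simple_tensor I A y = simple_tensor I A (x \<bullet> y)"
  unfolding simple_tensor_eq tensor_algebra_eq by (rule T.cls_mult)

lemma simple_tensor_one: "simple_tensor I A \<one>\<^bsub>TM\<^esub> = \<one>\<^bsub>TA\<^esub>"
  unfolding simple_tensor_eq tensor_algebra_eq by (rule T.cls_one)

lemma simple_tensor_lincomb:
  assumes "x \<in> carrier TM" "s \<in> sites I" "u \<in> carrier (ext s)" "v \<in> carrier (ext s)"
  shows "simple_tensor I A (x(s := \<alpha> \<odot>\<^bsub>ext s\<^esub> u \<oplus>\<^bsub>ext s\<^esub> \<beta> \<odot>\<^bsub>ext s\<^esub> v)) =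
    \<alpha> \<odot>\<^bsub>TA\<^esub> simple_tensor I A (x(s := u)) \<oplus>\<^bsub>TA\<^esub> \<beta> \<odot>\<^bsub>TA\<^esub> simple_tensor I A (x(s := v))"
proof -
  interpret nc_space "A (fst s)" "\<phi> (fst s)"
    using assms(2) by (rule site_space)
  show ?thesis
    unfolding simple_tensor_eq tensor_algebra_eq
  proof (rule T.cls_lincomb)
    show "single (x(s := \<alpha> \<odot>\<^bsub>ext s\<^esub> u \<oplus>\<^bsub>ext s\<^esub> \<beta> \<odot>\<^bsub>ext s\<^esub> v)) 1
        - single (x(s := u)) \<alpha> - single (x(s := v)) \<beta> \<in> multilinearity_relations I A"
      unfolding multilinearity_relations_def using assms by blast
  qed (use assms tensor_upd_closed in simp_all)
qed

section \<open>The product functional on simple tensors\<close>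

definition tensor_value :: "('i, 'a) tfam \<Rightarrow> complex" where
  "tensor_value x = (\<Prod>s | s \<in> sites I \<and> val s (x s) \<noteq> 1. val s (x s))"

lemma val_one: "s \<in> sites I \<Longrightarrow> val s \<one>\<^bsub>ext s\<^esub> = 1"
  using site_space by (rule nc_space.ext_functional_one)

lemma val_idem: "s \<in> sites I \<Longrightarrow> val s (idem s) = 1"
  using site_space by (rule nc_space.ext_functional_idem)

lemma finite_val_support:
  assumes "x \<in> carrier TM"
  shows "finite {s \<in> sites I. val s (x s) \<noteq> 1}"
proof -
  have "{s \<in> sites I. val s (x s) \<noteq> 1} \<subseteq>
      {s \<in> sites I. x s \<noteq> \<one>\<^bsub>ext s\<^esub> \<and> x s \<noteq> idem s}"
    using val_one val_idem by auto
  then show ?thesis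
    using assms finite_subset by (auto simp: tensor_monoid_carrier_iff)
qed

text \<open>The set of factors different from 1 changes with the entry at \<open>s\<close>, so the
  products are first taken over one common finite set containing \<open>s\<close>. The unit at
  \<open>s\<close>, of value 1, serves as the neutral entry for what remains.\<close>

lemma tensor_value_upd:
  assumes x: "x \<in> carrier TM" and s: "s \<in> sites I"
  shows "tensor_value (x(s := u)) = val s u * tensor_value (x(s := \<one>\<^bsub>ext s\<^esub>))"
proof -
  let ?S = "{t \<in> sites I. val t (x t) \<noteq> 1} - {s}"
  have fin: "finite ?S"
    using finite_val_support[OF x] by simp
  have "tensor_value (x(s := w)) = (\<Prod>t\<in>insert s ?S. val t ((x(s := w)) t))" for w
    unfolding tensor_value_def using fin s by (intro prod.mono_neutral_left) (auto split: if_splits)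
  also have "\<dots> w = val s w * (\<Prod>t\<in>?S. val t (x t))" for w
    using fin by (subst prod.insert) (auto intro!: prod.cong)
  finally show ?thesis
    using s by (simp add: val_one)
qed

lemma tensor_value_cong:
  assumes "\<And>s. s \<in> sites I \<Longrightarrow> val s (x s) = val s (y s)"
  shows "tensor_value x = tensor_value y"
  unfolding tensor_value_def using assms by (intro prod.cong) auto

text \<open>A translate of a multilinearity relation by \<open>y\<close> and \<open>z\<close> still
  varies only at the site \<open>s\<close>, where \<open>u\<close> and \<open>v\<close> are
  multiplied by \<open>y s\<close> from the left and by \<open>z s\<close> from the right. It
  vanishes by linearity of the local functional. Uniqueness holds since simple tensors span.\<close>

lemma TF_props:
  "linear_functional TA (tensor_functional I A \<phi>)"
  "\<And>x. x \<in> carrier TM \<Longrightarrow> tensor_functional I A \<phi> (simple_tensor I A x) = tensor_value x"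
proof -
  have zero: "lin_ext (\<lambda>w. tensor_value (y \<bullet> w \<bullet> z)) r = 0"
    if r: "r \<in> multilinearity_relations I A" and y: "y \<in> carrier TM" and z: "z \<in> carrier TM" for r y z
  proof -
    obtain x s \<alpha> \<beta> u v where *: "x \<in> carrier TM" "s \<in> sites I" "u \<in> carrier (ext s)" "v \<in> carrier (ext s)"
      and r_eq: "r = single (x(s := \<alpha> \<odot>\<^bsub>ext s\<^esub> u \<oplus>\<^bsub>ext s\<^esub> \<beta> \<odot>\<^bsub>ext s\<^esub> v)) 1
        - single (x(s := u)) \<alpha> - single (x(s := v)) \<beta>"
      using r unfolding multilinearity_relations_def by blast
    interpret nc_space "A (fst s)" "\<phi> (fst s)"
      using *(2) by (rule site_space)
    let ?X = "y \<bullet> x \<bullet> z"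
    have X: "?X \<in> carrier TM"
      using * y z by (intro tensor_monoid_mult_closed)
    have ys: "y s \<in> carrier (ext s)" "z s \<in> carrier (ext s)"
      using y z *(2) by (auto intro: tensor_entry_closed)
    have upd: "y \<bullet> x(s := w) \<bullet> z = ?X(s := y s \<otimes>\<^bsub>ext s\<^esub> w \<otimes>\<^bsub>ext s\<^esub> z s)" for w
      using *(2) by (auto simp: tensor_monoid_mult fun_eq_iff)
    have "val s (y s \<otimes>\<^bsub>ext s\<^esub> (\<alpha> \<odot>\<^bsub>ext s\<^esub> u \<oplus>\<^bsub>ext s\<^esub> \<beta> \<odot>\<^bsub>ext s\<^esub> v) \<otimes>\<^bsub>ext s\<^esub> z s) =
        \<alpha> * val s (y s \<otimes>\<^bsub>ext s\<^esub> u \<otimes>\<^bsub>ext s\<^esub> z s) + \<beta> * val s (y s \<otimes>\<^bsub>ext s\<^esub> v \<otimes>\<^bsub>ext s\<^esub> z s)"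
      unfolding X.mult_lincomb[OF *(3,4) ys]
      using ext_functional_props(1) X.complex_algebra
      by (rule linear_functional_lincomb) (use *(3,4) ys in simp_all)
    then show ?thesis
      unfolding r_eq lin_ext_diff lin_ext_single upd tensor_value_upd[OF X *(2), of "_ \<otimes>\<^bsub>ext s\<^esub> _"]
      by (simp add: algebra_simps)
  qed
  have "\<exists>f. linear_functional T.QA.Q f \<and> (\<forall>x\<in>carrier TM. f (T.cls x) = tensor_value x)"
    by (rule T.functional_exists) (rule zero)
  then obtain f where f: "linear_functional TA f"
      "\<And>x. x \<in> carrier TM \<Longrightarrow> f (simple_tensor I A x) = tensor_value x"
    unfolding simple_tensor_eq tensor_algebra_eq by blast
  have "tensor_functional I A \<phi> = restrict f (carrier TA)"
    unfolding tensor_functional_def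
  proof (rule the_on_eq)
    show "linear_functional TA (restrict f (carrier TA)) \<and>
        (\<forall>x\<in>carrier TM. restrict f (carrier TA) (simple_tensor I A x) =
          (\<Prod>s | s \<in> sites I \<and> val s (x s) \<noteq> 1. val s (x s)))"
      using TA.linear_functional_restrict[OF f(1)] f(2) by (simp add: tensor_value_def)
  next
    fix g x assume "linear_functional TA g \<and> (\<forall>x\<in>carrier TM. g (simple_tensor I A x) =
          (\<Prod>s | s \<in> sites I \<and> val s (x s) \<noteq> 1. val s (x s)))" "x \<in> carrier TA"
    then show "g x = f x"
      using f unfolding simple_tensor_eq tensor_algebra_eq tensor_value_def
      by (intro T.functional_eqI[of g f x]) simp_all
  qed
  then show "linear_functional TA (tensor_functional I A \<phi>)"
    "\<And>x. x \<in> carrier TM \<Longrightarrow> tensor_functional I A \<phi> (simple_tensor I A x) = tensor_value x"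
    using TA.linear_functional_restrict[OF f(1)] f(2) by simp_all
qed

text \<open>Where \<open>q\<close> has \<open>p\<close>, the entry of \<open>x\<close> is the unit,
  and \<open>y s\<close> followed by \<open>p\<close> has the value of \<open>y s\<close>. Nothing
  may stand to the right of \<open>x\<close> here, which is why stacks are kept as the rightmost
  factor.\<close>

lemma tensor_value_absorb:
  assumes y: "y \<in> carrier TM" and x: "x \<in> carrier TM"
    and q: "\<And>s. s \<in> sites I \<Longrightarrow> q s = \<one>\<^bsub>ext s\<^esub> \<or> q s = idem s \<and> x s = \<one>\<^bsub>ext s\<^esub>"
  shows "tensor_value (y \<bullet> (q \<bullet> x)) = tensor_value (y \<bullet> x)"
proof (rule tensor_value_cong)
  fix s assume s: "s \<in> sites I"
  then interpret nc_space "A (fst s)" "\<phi> (fst s)"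
    by (rule site_space)
  have "y s \<in> carrier (ext s)" "x s \<in> carrier (ext s)"
    using x y s by (auto intro: tensor_entry_closed)
  then show "val s ((y \<bullet> (q \<bullet> x)) s) = val s ((y \<bullet> x) s)"
    using q[OF s] s ext_functional_mult_idem_mult[of "y s" "x s"]
    by (auto simp: tensor_monoid_mult ext_functional_one)
qed

text \<open>At \<open>t\<close> the entry is the product of \<open>y t\<close>, \<open>p\<close> and
  \<open>x t\<close>, whose value splits at \<open>p\<close>; so \<open>x t\<close> can be replaced
  by the unit at the cost of its value.\<close>

lemma tensor_value_factor:
  assumes y: "y \<in> carrier TM" and x: "x \<in> carrier TM" and q: "q \<in> carrier TM"
    and t: "t \<in> sites I" and qt: "q t = idem t"
  shows "tensor_value (y \<bullet> (q \<bullet> x)) =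
    val t (x t) * tensor_value (y \<bullet> (q \<bullet> x(t := \<one>\<^bsub>ext t\<^esub>)))"
proof -
  interpret nc_space "A (fst t)" "\<phi> (fst t)"
    using t by (rule site_space)
  let ?X = "y \<bullet> (q \<bullet> x)"
  have X: "?X \<in> carrier TM"
    using x y q by (intro tensor_monoid_mult_closed)
  have yt: "y t \<in> carrier (ext t)" "x t \<in> carrier (ext t)"
    using x y t by (auto intro: tensor_entry_closed)
  have "?X = ?X(t := y t \<otimes>\<^bsub>ext t\<^esub> (idem t \<otimes>\<^bsub>ext t\<^esub> x t))"
    using t qt by (auto simp: tensor_monoid_mult fun_eq_iff)
  from arg_cong[OF this, of tensor_value]
  have 1: "tensor_value ?X = val t (y t) * val t (x t) * tensor_value (?X(t := \<one>\<^bsub>ext t\<^esub>))"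
    unfolding tensor_value_upd[OF X t, of "_ \<otimes>\<^bsub>ext t\<^esub> _"] ext_functional_mult_idem_mult[OF yt] .
  have "y \<bullet> (q \<bullet> x(t := \<one>\<^bsub>ext t\<^esub>)) =
      ?X(t := y t \<otimes>\<^bsub>ext t\<^esub> (idem t \<otimes>\<^bsub>ext t\<^esub> \<one>\<^bsub>ext t\<^esub>))"
    using t qt by (auto simp: tensor_monoid_mult fun_eq_iff)
  from arg_cong[OF this, of tensor_value]
  have "tensor_value (y \<bullet> (q \<bullet> x(t := \<one>\<^bsub>ext t\<^esub>))) =
      val t (y t) * tensor_value (?X(t := \<one>\<^bsub>ext t\<^esub>))"
    unfolding tensor_value_upd[OF X t, of "_ \<otimes>\<^bsub>ext t\<^esub> _"]
      ext_functional_mult_idem_mult[OF yt(1) X.one_closed] ext_functional_one mult_1_right .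
  then show ?thesis
    using 1 by simp
qed

end

lemma linear_functional_comp:
  "linear_functional B f \<Longrightarrow> algebra_hom A B h \<Longrightarrow> linear_functional A (\<lambda>x. f (h x))"
  by (simp add: linear_functional_def algebra_hom_def ring_hom_def Pi_def)

section \<open>Free products\<close>

locale presentation_pair = P1: presentation G R1 + P2: presentation G R2
  for G :: "'g monoid" (structure) and R1 R2 +
  assumes subset: "R1 \<subseteq> R2"
begin

text \<open>More relations generate a larger ideal, so each coset of the smaller ideal lies in one
  coset of the larger one. With the unit relations added this is the map \<tau>.\<close>

lemma quotient_hom:
  "\<exists>h. algebra_hom P1.QA.Q P2.QA.Q h \<and> (\<forall>w\<in>carrier G. h (P1.cls w) = P2.cls w)"
proof -
  have "R1 \<subseteq> Idl\<^bsub>monoid_algebra G\<^esub> R2"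
    using subset P1.MA.genideal_self[OF P2.Rel_subset] by blast
  then have Idl: "Idl\<^bsub>monoid_algebra G\<^esub> R1 \<subseteq> Idl\<^bsub>monoid_algebra G\<^esub> R2"
    by (rule P1.MA.genideal_minimal[OF P2.QA.is_ideal])
  have "P2.coset f = P2.coset g"
    if "f \<in> carrier (monoid_algebra G)" "g \<in> carrier (monoid_algebra G)" "P1.coset f = P1.coset g" for f g
    using that P1.coset_eq_iff[of f g] P2.coset_eq_iff[of f g] Idl by auto
  then have "\<exists>h. \<forall>f\<in>carrier (monoid_algebra G). h (P1.coset f) = P2.coset f"
    unfolding P1.coset_def by (rule P1.QA.quotient_lift)
  then obtain h where "\<forall>f\<in>carrier (monoid_algebra G). h (P1.coset f) = P2.coset f"
    by (rule exE)
  then have h: "h (P1.coset f) = P2.coset f" if "keys f \<subseteq> carrier G" for f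
    using that by simp
  have "h \<in> ring_hom P1.QA.Q P2.QA.Q"
  proof (rule ring_hom_memI)
    fix x assume "x \<in> carrier P1.QA.Q"
    then obtain f where f: "x = P1.coset f" "keys f \<subseteq> carrier G"
      unfolding P1.carrier_Q by blast
    show "h x \<in> carrier P2.QA.Q"
      unfolding f(1) h[OF f(2)] by (rule P2.coset_closed[OF f(2)])
    fix y assume "y \<in> carrier P1.QA.Q"
    then obtain g where g: "y = P1.coset g" "keys g \<subseteq> carrier G"
      unfolding P1.carrier_Q by blast
    show "h (x \<otimes>\<^bsub>P1.QA.Q\<^esub> y) = h x \<otimes>\<^bsub>P2.QA.Q\<^esub> h y"
      unfolding f(1) g(1) h[OF f(2)] h[OF g(2)] P1.coset_mult[OF f(2) g(2), symmetric]
        P2.coset_mult[OF f(2) g(2), symmetric]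
      by (rule h) (rule P1.conv_closed[OF f(2) g(2)])
    show "h (x \<oplus>\<^bsub>P1.QA.Q\<^esub> y) = h x \<oplus>\<^bsub>P2.QA.Q\<^esub> h y"
      unfolding f(1) g(1) h[OF f(2)] h[OF g(2)] P1.coset_add[OF f(2) g(2), symmetric]
        P2.coset_add[OF f(2) g(2), symmetric]
      by (rule h) (rule keys_add_subset[OF f(2) g(2)])
  next
    show "h \<one>\<^bsub>P1.QA.Q\<^esub> = \<one>\<^bsub>P2.QA.Q\<^esub>"
      unfolding P1.cls_one[symmetric] P2.cls_one[symmetric] P1.cls_def P2.cls_def
      by (rule h) simp
  qed
  moreover have "h (c \<odot>\<^bsub>P1.QA.Q\<^esub> x) = c \<odot>\<^bsub>P2.QA.Q\<^esub> h x" if "x \<in> carrier P1.QA.Q" for c x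
  proof -
    obtain f where f: "x = P1.coset f" "keys f \<subseteq> carrier G"
      using \<open>x \<in> carrier P1.QA.Q\<close> unfolding P1.carrier_Q by blast
    show ?thesis
      unfolding f(1) h[OF f(2)] P1.coset_smult[OF f(2), symmetric] P2.coset_smult[OF f(2), symmetric]
      by (rule h) (rule subset_trans[OF keys_map_subset f(2)])
  qed
  moreover have "h (P1.cls w) = P2.cls w" if "w \<in> carrier G" for w
    unfolding P1.cls_def P2.cls_def by (rule h) (simp add: that)
  ultimately show ?thesis
    unfolding algebra_hom_def by blast
qed

end

lemma algebra_homD:
  assumes "algebra_hom A B h" "x \<in> carrier A"
  shows "h x \<in> carrier B" "h (c \<odot>\<^bsub>A\<^esub> x) = c \<odot>\<^bsub>B\<^esub> h x"
    "y \<in> carrier A \<Longrightarrow> h (x \<otimes>\<^bsub>A\<^esub> y) = h x \<otimes>\<^bsub>B\<^esub> h y"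
    "y \<in> carrier A \<Longrightarrow> h (x \<oplus>\<^bsub>A\<^esub> y) = h x \<oplus>\<^bsub>B\<^esub> h y"
  using assms by (auto simp: algebra_hom_def ring_hom_def)

lemma algebra_hom_zero:
  assumes "algebra_hom A B h" "complex_algebra A" "complex_algebra B"
  shows "h \<zero>\<^bsub>A\<^esub> = \<zero>\<^bsub>B\<^esub>"
proof -
  interpret A: complex_alg A + B: complex_alg B
    using assms(2,3) by (simp_all add: complex_algI)
  show ?thesis
    using algebra_homD(1)[OF assms(1) A.one_closed] algebra_homD(2)[OF assms(1) A.one_closed, of 0]
    by simp
qed

context nc_family
begin

abbreviation L :: "('i \<times> 'a) set" where "L \<equiv> letters I A"
abbreviation W :: "('i \<times> 'a) list set" where "W \<equiv> alternating_words I A"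

lemma letter_iff: "(i, a) \<in> L \<longleftrightarrow> i \<in> I \<and> a \<in> C i"
  by (auto simp: letters_def)

lemma words_iff: "u \<in> W \<longleftrightarrow> u \<in> lists L \<and> distinct_adj (map fst u)"
  by (simp add: alternating_words_def)

lemma complex_algebra_component: "i \<in> I \<Longrightarrow> complex_algebra (A i)"
  using nc_space complex_alg.complex_algebra nc_space.axioms(1) by metis

lemma nonunital_relations_keys:
  "r \<in> nonunital_relations I A \<Longrightarrow> keys r \<subseteq> lists L"
  unfolding nonunital_relations_def
  by (elim UN_E, rule keys_algebra_relations[rotated 2], assumption)
     (auto simp: letter_iff complex_algebra_component)

lemma unital_relations_keys:
  "r \<in> unital_relations I A \<Longrightarrow> keys r \<subseteq> lists L"
  unfolding unital_relations_def
proof (elim UnE imageE)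
  fix i assume "r = unit_relation (A i) (Pair i)" "i \<in> I"
  then show "keys r \<subseteq> lists L"
    using keys_unit_relation[OF complex_algebra_component, of i "Pair i" L] by (simp add: letter_iff)
qed (rule nonunital_relations_keys)

sublocale N: word_presentation L "nonunital_relations I A"
  by (intro word_presentation.intro presentation.intro presentation_axioms.intro plain_monoid_word_monoid)
     (simp only: nonunital_relations_keys word_monoid_simps)

sublocale U: word_presentation L "unital_relations I A"
  by (intro word_presentation.intro presentation.intro presentation_axioms.intro plain_monoid_word_monoid)
     (simp only: unital_relations_keys word_monoid_simps)

abbreviation FS :: "('i, 'a) fp calg" where "FS \<equiv> free_product_sep I A"
abbreviation FU :: "('i, 'a) fp calg" where "FU \<equiv> free_product I A"

lemma free_product_sep_eq: "FS = N.QA.Q"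
  by (simp only: free_product_sep_def N.presented_algebra_eq)

lemma free_product_eq: "FU = U.QA.Q"
  by (simp only: free_product_def U.presented_algebra_eq)

sublocale FS: complex_alg FS
  unfolding free_product_sep_eq by (rule N.Q.complex_alg_axioms)

sublocale FU: complex_alg FU
  unfolding free_product_eq by (rule U.Q.complex_alg_axioms)

lemma emb_sep_eq: "emb_sep I A i a = N.cls [(i, a)]"
  by (simp only: emb_sep_def N.generator_eq)

lemma emb_eq: "emb I A i a = U.cls [(i, a)]"
  by (simp only: emb_def U.generator_eq)

lemma word_sep_eq: "u \<in> lists L \<Longrightarrow> word_sep I A u = N.cls u"
  unfolding word_sep_def emb_sep_eq free_product_sep_eq case_prod_eta
  by (subst N.list_prod_generators[symmetric]) (simp_all add: case_prod_unfold)

lemma word_eq: "u \<in> lists L \<Longrightarrow> word I A u = U.cls u"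
  unfolding word_def emb_eq free_product_eq
  by (subst U.list_prod_generators[symmetric]) (simp_all add: case_prod_unfold)

lemma N_cls_closed: "u \<in> lists L \<Longrightarrow> N.cls u \<in> carrier FS"
  unfolding free_product_sep_eq by (rule N.cls_closed) simp

lemma U_cls_closed: "u \<in> lists L \<Longrightarrow> U.cls u \<in> carrier FU"
  unfolding free_product_eq by (rule U.cls_closed) simp

text \<open>Enlarging the relation ideal gives existence. For uniqueness, a homomorphism is fixed on
  letters, hence on words, hence on their span.\<close>

lemma canonical_hom_props:
  "algebra_hom FS FU (canonical_hom I A)"
  "w \<in> lists L \<Longrightarrow> canonical_hom I A (N.cls w) = U.cls w"
proof -
  interpret presentation_pair "word_monoid L" "nonunital_relations I A" "unital_relations I A"
    by (intro presentation_pair.intro presentation_pair_axioms.intro N.presentation_axioms U.presentation_axioms)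
       (simp add: unital_relations_def)
  obtain h where h: "algebra_hom FS FU h" "\<And>w. w \<in> lists L \<Longrightarrow> h (N.cls w) = U.cls w"
    using quotient_hom unfolding free_product_sep_eq free_product_eq word_monoid_simps by blast
  have "canonical_hom I A = restrict h (carrier FS)"
    unfolding canonical_hom_def
  proof (rule the_on_eq)
    have "algebra_hom FS FU (restrict h (carrier FS))"
      using h(1) by (simp add: algebra_hom_def ring_hom_def Pi_def)
    moreover have "restrict h (carrier FS) (emb_sep I A i a) = emb I A i a" if "i \<in> I" "a \<in> C i" for i a
      using that h(2)[of "[(i, a)]"] N_cls_closed[of "[(i, a)]"] by (simp add: emb_sep_eq emb_eq letter_iff)
    ultimately show "algebra_hom FS FU (restrict h (carrier FS)) \<and>
        (\<forall>i\<in>I. \<forall>a\<in>C i. restrict h (carrier FS) (emb_sep I A i a) = emb I A i a)"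
      by blast
  next
    fix g x
    assume g: "algebra_hom FS FU g \<and> (\<forall>i\<in>I. \<forall>a\<in>C i. g (emb_sep I A i a) = emb I A i a)"
      and x: "x \<in> carrier FS"
    note g_hom = conjunct1[OF g]
    have words: "g (N.cls w) = h (N.cls w)" if "w \<in> lists L" for w
      using that
    proof (induction w)
      case Nil
      have "g \<one>\<^bsub>FS\<^esub> = \<one>\<^bsub>FU\<^esub>" "h \<one>\<^bsub>FS\<^esub> = \<one>\<^bsub>FU\<^esub>"
        using g h by (auto simp: algebra_hom_def ring_hom_def)
      then show ?case
        using N.cls_one by (simp add: free_product_sep_eq del: N.QA.quotient_simps)
    next
      case (Cons x w)
      have x: "[x] \<in> lists L" and w: "w \<in> lists L"
        using Cons.hyps by auto
      have "N.cls (x # w) = N.cls [x] \<otimes>\<^bsub>FS\<^esub> N.cls w"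
        unfolding free_product_sep_eq using N.cls_append[OF x w] by simp
      then have "g (N.cls (x # w)) = g (N.cls [x]) \<otimes>\<^bsub>FU\<^esub> g (N.cls w)"
        using algebra_homD(3)[OF g_hom] N_cls_closed x w by simp
      also have "g (N.cls [x]) = U.cls [x]"
        using g x by (cases x) (simp add: emb_sep_eq emb_eq letter_iff)
      also have "g (N.cls w) = U.cls w"
        using Cons.IH h(2) w by simp
      also have "U.cls [x] \<otimes>\<^bsub>FU\<^esub> U.cls w = U.cls (x # w)"
        unfolding free_product_eq using U.cls_append[OF x w] by simp
      also have "\<dots> = h (N.cls (x # w))"
        using h(2)[of "x # w"] x w by simp
      finally show ?case .
    qed
    show "g x = h x"
      using x unfolding free_product_sep_eq
    proof (induction x rule: N.cls_induct)
      case zero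
      show ?case
        using algebra_hom_zero[OF g_hom] algebra_hom_zero[OF h(1)] FS.complex_algebra FU.complex_algebra
        unfolding free_product_sep_eq by simp
    next
      case (add x y)
      then show ?case
        using algebra_homD(4)[OF g_hom] algebra_homD(4)[OF h(1)] unfolding free_product_sep_eq by simp
    next
      case (smult c x)
      then show ?case
        using algebra_homD(2)[OF g_hom] algebra_homD(2)[OF h(1)] unfolding free_product_sep_eq by simp
    qed (simp add: words)
  qed
  then show "algebra_hom FS FU (canonical_hom I A)"
    "w \<in> lists L \<Longrightarrow> canonical_hom I A (N.cls w) = U.cls w"
    using h N_cls_closed by (simp_all add: algebra_hom_def ring_hom_def Pi_def)
qed


section \<open>Alternating normal forms in the free product without identified units\<close>

fun merge_cons :: "'i \<times> 'a \<Rightarrow> ('i \<times> 'a) list \<Rightarrow> ('i \<times> 'a) list" where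
  "merge_cons x [] = [x]"
| "merge_cons (i, a) ((j, b) # w) = (if i = j then (i, a \<otimes>\<^bsub>A i\<^esub> b) # w else (i, a) # (j, b) # w)"

text \<open>Neighbours with equal labels are multiplied but internal units are kept, so the length
  of the result is the degree \<open>n\<close> of the summand \<open>F\<^sub>n\<close> in which the
  word lies.\<close>

definition merge :: "('i \<times> 'a) list \<Rightarrow> ('i \<times> 'a) list" where
  "merge w = foldr merge_cons w []"

lemma mult_component:
  "i \<in> I \<Longrightarrow> a \<in> C i \<Longrightarrow> b \<in> C i \<Longrightarrow> a \<otimes>\<^bsub>A i\<^esub> b \<in> C i"
  using ring.ring_simprules(5)[OF complex_alg.axioms(1)[OF complex_algI[OF complex_algebra_component]]] .

lemma assoc_component:
  "i \<in> I \<Longrightarrow> a \<in> C i \<Longrightarrow> b \<in> C i \<Longrightarrow> c \<in> C i \<Longrightarrow>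
     a \<otimes>\<^bsub>A i\<^esub> b \<otimes>\<^bsub>A i\<^esub> c = a \<otimes>\<^bsub>A i\<^esub> (b \<otimes>\<^bsub>A i\<^esub> c)"
  by (rule monoid.m_assoc[OF ring.is_monoid[OF complex_alg.axioms(1)[OF complex_algI[OF complex_algebra_component]]]])

lemma merge_cons_alternating:
  assumes "x \<in> L" "w \<in> W" shows "merge_cons x w \<in> W"
proof (cases w)
  case (Cons y v)
  obtain i a j b where "x = (i, a)" "y = (j, b)"
    by fastforce
  then show ?thesis
    using assms Cons by (cases v) (auto simp: words_iff letter_iff mult_component)
qed (use assms in \<open>cases x; simp add: words_iff\<close>)

lemma foldr_merge_cons_alternating:
  "w \<in> lists L \<Longrightarrow> v \<in> W \<Longrightarrow> foldr merge_cons w v \<in> W"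
  by (induction w) (auto intro: merge_cons_alternating)

lemma merge_alternating: "w \<in> lists L \<Longrightarrow> merge w \<in> W"
  unfolding merge_def by (rule foldr_merge_cons_alternating) (simp_all add: words_iff)

lemma merge_eq_self: "w \<in> W \<Longrightarrow> merge w = w"
proof (induction w)
  case (Cons x w)
  then have "merge w = w"
    by (auto simp: words_iff dest: distinct_adj_ConsD)
  then have "merge (x # w) = merge_cons x w"
    by (simp add: merge_def)
  also have "\<dots> = x # w"
    using Cons.prems by (cases x; cases w) (auto simp: words_iff)
  finally show ?case .
qed (simp add: merge_def)

lemma merge_cons_merge_cons:
  assumes "i \<in> I" "a \<in> C i" "b \<in> C i" "w \<in> lists L"
  shows "merge_cons (i, a) (merge_cons (i, b) w) = merge_cons (i, a \<otimes>\<^bsub>A i\<^esub> b) w"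
  using assms by (cases w) (auto simp: assoc_component letter_iff split: prod.splits)

lemma N_cls_product:
  "i \<in> I \<Longrightarrow> a \<in> C i \<Longrightarrow> b \<in> C i \<Longrightarrow>
     N.cls [(i, a), (i, b)] = N.cls [(i, a \<otimes>\<^bsub>A i\<^esub> b)]"
  by (rule N.cls_eq)
     (auto simp: nonunital_relations_def algebra_relations_def letter_iff mult_component)

lemma U_cls_product:
  "i \<in> I \<Longrightarrow> a \<in> C i \<Longrightarrow> b \<in> C i \<Longrightarrow>
     U.cls [(i, a), (i, b)] = U.cls [(i, a \<otimes>\<^bsub>A i\<^esub> b)]"
  by (rule U.cls_eq)
     (auto simp: unital_relations_def nonunital_relations_def algebra_relations_def letter_iff mult_component)

lemma N_cls_merge_cons:
  assumes "x \<in> L" "w \<in> lists L" shows "N.cls (x # w) = N.cls (merge_cons x w)"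
proof (cases w)
  case (Cons y v)
  obtain i a j b where xy: "x = (i, a)" "y = (j, b)"
    by fastforce
  show ?thesis
  proof (cases "i = j")
    case True
    then have "N.cls ([] @ [(i, a), (i, b)] @ v) = N.cls ([] @ [(i, a \<otimes>\<^bsub>A i\<^esub> b)] @ v)"
      using assms Cons xy
      by (intro N.cls_context N_cls_product) (auto simp: letter_iff mult_component)
    then show ?thesis
      using xy Cons True by simp
  qed (simp add: xy Cons)
qed simp

lemma N_cls_merge: "w \<in> lists L \<Longrightarrow> N.cls w = N.cls (merge w)"
proof (induction w)
  case (Cons x w)
  have m: "merge w \<in> lists L"
    using merge_alternating[of w] Cons.prems by (auto simp: words_iff)
  have "N.cls (x # w) = N.cls (x # merge w)"
    using N.cls_context[of w "merge w" "[x]" "[]"] Cons m by simp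
  also have "\<dots> = N.cls (merge (x # w))"
    using N_cls_merge_cons[OF _ m] Cons.prems by (simp add: merge_def)
  finally show ?case .
qed (simp add: merge_def)

text \<open>Merging rewrites every word as an alternating one with the same class, so the
  alternating words span.\<close>

lemma sep_induct [consumes 1, case_names zero word add smult]:
  assumes x: "x \<in> carrier FS"
    and "P \<zero>\<^bsub>FS\<^esub>"
    and "\<And>u. u \<in> W \<Longrightarrow> P (N.cls u)"
    and "\<And>x y. x \<in> carrier FS \<Longrightarrow> y \<in> carrier FS \<Longrightarrow> P x \<Longrightarrow> P y \<Longrightarrow> P (x \<oplus>\<^bsub>FS\<^esub> y)"
    and "\<And>c x. x \<in> carrier FS \<Longrightarrow> P x \<Longrightarrow> P (c \<odot>\<^bsub>FS\<^esub> x)"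
  shows "P x"
  using assms unfolding free_product_sep_eq
proof (induction x rule: N.cls_induct)
  case (cls w)
  then show ?case
    using N_cls_merge[of w] merge_alternating[of w] by simp
qed blast+

text \<open>Such an \<open>h\<close> amounts to a linear functional on the direct sum of the tensor
  products of the \<open>A i\<close> along alternating sequences of labels.\<close>

definition multilinear_on_words :: "(('i \<times> 'a) list \<Rightarrow> complex) \<Rightarrow> bool" where
  "multilinear_on_words h \<longleftrightarrow> (\<forall>p q i a b \<alpha> \<beta>. i \<in> I \<longrightarrow> a \<in> C i \<longrightarrow> b \<in> C i \<longrightarrow>
     p @ (i, a) # q \<in> W \<longrightarrow>
     h (p @ (i, \<alpha> \<odot>\<^bsub>A i\<^esub> a \<oplus>\<^bsub>A i\<^esub> \<beta> \<odot>\<^bsub>A i\<^esub> b) # q) = \<alpha> * h (p @ (i, a) # q) + \<beta> * h (p @ (i, b) # q))"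

text \<open>Which letters merge depends on the labels alone. Hence \<open>p\<close>,
  \<open>q\<close>, \<open>c\<close> and \<open>d\<close> are the same for all \<open>t\<close>,
  with \<open>c\<close> and \<open>d\<close> collecting the neighbours of label \<open>i\<close>. So
  the merged word depends linearly on a letter even where letters are fused.\<close>

lemma merge_letter:
  assumes "x \<in> lists L" "y \<in> lists L" and i: "i \<in> I"
  obtains p q c d where "c \<in> C i" "d \<in> C i"
    "\<And>t. t \<in> C i \<Longrightarrow> merge (x @ (i, t) # y) = p @ (i, c \<otimes>\<^bsub>A i\<^esub> t \<otimes>\<^bsub>A i\<^esub> d) # q"
proof -
  interpret Ai: nc_space "A i" "\<phi> i"
    using i by (rule nc_space)
  have m: "merge y \<in> lists L"
    using merge_alternating assms by (auto simp: words_iff)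
  have "\<exists>p q c d. c \<in> C i \<and> d \<in> C i \<and>
    (\<forall>t\<in>C i. foldr merge_cons x (merge_cons (i, t) (merge y)) = p @ (i, c \<otimes>\<^bsub>A i\<^esub> t \<otimes>\<^bsub>A i\<^esub> d) # q)"
    using assms(1)
  proof (induction x)
    case Nil
    consider (merge) b v where "merge y = (i, b) # v" | (keep) "\<And>t. merge_cons (i, t) (merge y) = (i, t) # merge y"
      by (cases "merge y") (auto, metis)
    then show ?case
    proof cases
      case merge
      then have "b \<in> C i"
        using m by (simp add: letter_iff)
      then show ?thesis
        using merge by (intro exI[of _ "[]"] exI[of _ v] exI[of _ "\<one>\<^bsub>A i\<^esub>"] exI[of _ b]) simp
    next
      case keep
      then show ?thesis
        by (intro exI[of _ "[]"] exI[of _ "merge y"] exI[of _ "\<one>\<^bsub>A i\<^esub>"]) simp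
    qed
  next
    case (Cons z x)
    then obtain p q c d where *: "c \<in> C i" "d \<in> C i"
      "\<And>t. t \<in> C i \<Longrightarrow> foldr merge_cons x (merge_cons (i, t) (merge y)) = p @ (i, c \<otimes>\<^bsub>A i\<^esub> t \<otimes>\<^bsub>A i\<^esub> d) # q"
      by blast
    obtain k e where z: "z = (k, e)"
      by fastforce
    show ?case
    proof (cases p)
      case Nil
      show ?thesis
      proof (cases "k = i")
        case True
        then have e: "e \<in> C i"
          using Cons.hyps z by (simp add: letter_iff)
        then show ?thesis
          using * Nil z True
          by (intro exI[of _ "[]"] exI[of _ q] exI[of _ "e \<otimes>\<^bsub>A i\<^esub> c"] exI[of _ d]) (simp add: Ai.m_assoc)
      next
        case False
        then show ?thesis
          using * Nil z by (intro exI[of _ "[z]"] exI[of _ q] exI[of _ c] exI[of _ d]) simp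
      qed
    next
      case (Cons l p')
      \<comment> \<open>A letter put in front can only meet the head of the nonempty prefix, so the
        place of \<open>t\<close> is untouched.\<close>
      then show ?thesis
        using * z by (intro exI[of _ "merge_cons z [l] @ p'"] exI[of _ q] exI[of _ c] exI[of _ d])
          (cases l; simp)
    qed
  qed
  then show thesis
    using that by (auto simp: merge_def)
qed

text \<open>Composing \<open>h\<close> with \<open>merge\<close> gives a function on all words.
  Relations for products do not change the merged word, and those for linear combinations reduce to
  multilinearity in the single letter \<open>c t d\<close>.\<close>

lemma sep_functional_exists:
  assumes h: "multilinear_on_words h"
  shows "\<exists>f. linear_functional FS f \<and> (\<forall>u\<in>W. f (N.cls u) = h u)"
proof -
  have "lin_ext (\<lambda>w. h (merge (x @ w @ y))) r = 0"
    if r: "r \<in> nonunital_relations I A" and xy: "x \<in> lists L" "y \<in> lists L" for r x y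
  proof -
    obtain i where i: "i \<in> I" and alg: "r \<in> algebra_relations (A i) (Pair i)"
      using r unfolding nonunital_relations_def by blast
    interpret Ai: nc_space "A i" "\<phi> i"
      using i by (rule nc_space)
    show ?thesis
      using alg
    proof (rule lin_ext_algebra_relations)
      fix \<alpha> \<beta> a b assume ab: "a \<in> C i" "b \<in> C i"
      obtain p q c d where *: "c \<in> C i" "d \<in> C i"
        "\<And>t. t \<in> C i \<Longrightarrow> merge (x @ (i, t) # y) = p @ (i, c \<otimes>\<^bsub>A i\<^esub> t \<otimes>\<^bsub>A i\<^esub> d) # q"
        by (rule merge_letter[OF xy i]) blast
      have "p @ (i, c \<otimes>\<^bsub>A i\<^esub> a \<otimes>\<^bsub>A i\<^esub> d) # q \<in> W"
        unfolding *(3)[OF ab(1), symmetric] using xy i ab by (intro merge_alternating) (simp add: letter_iff)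
      then show "h (merge (x @ [(i, \<alpha> \<odot>\<^bsub>A i\<^esub> a \<oplus>\<^bsub>A i\<^esub> \<beta> \<odot>\<^bsub>A i\<^esub> b)] @ y)) =
          \<alpha> * h (merge (x @ [(i, a)] @ y)) + \<beta> * h (merge (x @ [(i, b)] @ y))"
        using h * ab i by (simp add: Ai.mult_lincomb multilinear_on_words_def)
      have "merge y \<in> lists L"
        using merge_alternating[OF xy(2)] by (simp add: words_iff)
      then show "h (merge (x @ [(i, a), (i, b)] @ y)) = h (merge (x @ [(i, a \<otimes>\<^bsub>A i\<^esub> b)] @ y))"
        using merge_cons_merge_cons[OF i ab, of "merge y"] by (simp add: merge_def)
    qed
  qed
  then have "\<exists>f. linear_functional N.QA.Q f \<and> (\<forall>w\<in>lists L. f (N.cls w) = h (merge w))"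
    by (rule N.word_functional_exists)
  then show ?thesis
    unfolding free_product_sep_eq
    using merge_eq_self words_iff by metis
qed

lemma sep_functional_eqI:
  assumes "linear_functional FS f" "linear_functional FS g"
    and "\<And>u. u \<in> W \<Longrightarrow> f (N.cls u) = g (N.cls u)" and x: "x \<in> carrier FS"
  shows "f x = g x"
  using x
proof (induction x rule: sep_induct)
  case zero
  then show ?case
    using assms(1,2) FS.linear_functional_zero by metis
qed (use assms in \<open>simp_all add: linear_functional_def\<close>)

section \<open>The free product functional\<close>

abbreviation ctr :: "'i \<Rightarrow> 'a \<Rightarrow> 'a" where "ctr i \<equiv> nc_space.center (A i) (\<phi> i)"

text \<open>The first argument is a word in reverse order, read from its last letter on; the second one is
  the stack on which it acts.\<close>

function free_eval :: "('i \<times> 'a) list \<Rightarrow> ('i \<times> 'a) list \<Rightarrow> complex" where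
  "free_eval [] [] = 1"
| "free_eval [] [(i, a)] = \<phi> i a"
| "free_eval [] (x # y # s) = 0"
| "free_eval (x # u) [] = free_eval u [x]"
| "free_eval ((k, b) # u) ((i, a) # s) =
     (if k = i then free_eval u ((k, b \<otimes>\<^bsub>A k\<^esub> a) # s)
      else free_eval u ((k, b) # (i, ctr i a) # s) + \<phi> i a * free_eval ((k, b) # u) s)"
  by pat_completeness auto
termination
  \<comment> \<open>The word gets shorter in every call except the one that pops the top of the
    stack.\<close>
  by (relation "measures [\<lambda>(u, s). length u, \<lambda>(u, s). length s]") auto

definition stacks :: "('i \<times> 'a) list set" where
  "stacks = {s \<in> W. \<forall>(i, a)\<in>set (tl s). \<phi> i a = 0}"

definition centred_words :: "('i \<times> 'a) list set" where
  "centred_words = {s \<in> W. \<forall>(i, a)\<in>set s. \<phi> i a = 0}"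

lemma Nil_stacks [simp]: "[] \<in> stacks" "[] \<in> centred_words"
  by (simp_all add: stacks_def centred_words_def words_iff)

lemma Cons_stacks_iff:
  "(i, a) # s \<in> stacks \<longleftrightarrow> i \<in> I \<and> a \<in> C i \<and> s \<in> centred_words \<and> (s = [] \<or> i \<noteq> fst (hd s))"
  by (cases s) (auto simp: stacks_def centred_words_def words_iff letter_iff)

lemma Cons_centred_iff:
  "(i, a) # s \<in> centred_words \<longleftrightarrow>
     i \<in> I \<and> a \<in> C i \<and> \<phi> i a = 0 \<and> s \<in> centred_words \<and> (s = [] \<or> i \<noteq> fst (hd s))"
  by (cases s) (auto simp: centred_words_def words_iff letter_iff)

lemma centred_imp_stack: "s \<in> centred_words \<Longrightarrow> s \<in> stacks"
  by (cases s) (auto simp: stacks_def centred_words_def)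

lemma stacks_lists: "s \<in> stacks \<Longrightarrow> s \<in> lists L"
  by (simp add: stacks_def words_iff)

lemma centred_lists: "s \<in> centred_words \<Longrightarrow> s \<in> lists L"
  by (simp add: centred_words_def words_iff)

lemma ctr_closed: "i \<in> I \<Longrightarrow> a \<in> C i \<Longrightarrow> ctr i a \<in> C i"
  using nc_space.center_closed[OF nc_space] .

lemma phi_ctr: "i \<in> I \<Longrightarrow> a \<in> C i \<Longrightarrow> \<phi> i (ctr i a) = 0"
  using nc_space.phi_center[OF nc_space] .

lemma push_stacks:
  "(i, a) # s \<in> stacks \<Longrightarrow> (k, b) \<in> L \<Longrightarrow> k \<noteq> i \<Longrightarrow> (k, b) # (i, ctr i a) # s \<in> stacks"
  by (simp add: Cons_stacks_iff Cons_centred_iff letter_iff ctr_closed phi_ctr)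

lemma lincomb_closed:
  "i \<in> I \<Longrightarrow> a \<in> C i \<Longrightarrow> b \<in> C i \<Longrightarrow>
     \<alpha> \<odot>\<^bsub>A i\<^esub> a \<oplus>\<^bsub>A i\<^esub> \<beta> \<odot>\<^bsub>A i\<^esub> b \<in> C i"
proof -
  assume *: "i \<in> I" "a \<in> C i" "b \<in> C i"
  interpret Ai: nc_space "A i" "\<phi> i"
    using *(1) by (rule nc_space)
  show ?thesis
    using * by simp
qed

text \<open>The induction is nested like the recursion: most calls shorten the word, the popping
  call keeps the word and shortens the stack. A top is centred, evaluated by \<phi>, or multiplied
  by the letter read, and all three operations are linear.\<close>

lemma free_eval_stack_lincomb:
  assumes "u \<in> lists L" "s \<in> lists L" "s' \<in> lists L" "i \<in> I" "x \<in> C i" "y \<in> C i"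
  shows "free_eval u (s @ (i, \<alpha> \<odot>\<^bsub>A i\<^esub> x \<oplus>\<^bsub>A i\<^esub> \<beta> \<odot>\<^bsub>A i\<^esub> y) # s') =
    \<alpha> * free_eval u (s @ (i, x) # s') + \<beta> * free_eval u (s @ (i, y) # s')"
  using assms
proof (induction u arbitrary: s s' x y)
  case Nil
  interpret Ai: nc_space "A i" "\<phi> i"
    using Nil.prems by (intro nc_space)
  show ?case
    using Nil.prems by (cases s rule: remdups_adj.cases; cases s') (auto simp: Ai.phi_lincomb)
next
  case (Cons z u)
  interpret Ai: nc_space "A i" "\<phi> i"
    using Cons.prems by (intro nc_space)
  obtain k b where z: "z = (k, b)"
    by fastforce
  have kb: "k \<in> I" "b \<in> C k" and u: "u \<in> lists L"
    using Cons.hyps z by (auto simp: letter_iff)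
  note IH = Cons.IH
  note s' = \<open>s' \<in> lists L\<close> and i = \<open>i \<in> I\<close>
  show ?case
    using \<open>s \<in> lists L\<close> \<open>x \<in> C i\<close> \<open>y \<in> C i\<close>
  proof (induction s)
    case Nil
    show ?case
    proof (cases "k = i")
      case True
      have "b \<otimes>\<^bsub>A i\<^esub> (\<alpha> \<odot>\<^bsub>A i\<^esub> x \<oplus>\<^bsub>A i\<^esub> \<beta> \<odot>\<^bsub>A i\<^esub> y) =
          \<alpha> \<odot>\<^bsub>A i\<^esub> (b \<otimes>\<^bsub>A i\<^esub> x) \<oplus>\<^bsub>A i\<^esub> \<beta> \<odot>\<^bsub>A i\<^esub> (b \<otimes>\<^bsub>A i\<^esub> y)"
        using kb Nil True by (simp add: Ai.r_distr Ai.smult_mult_right)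
      then show ?thesis
        using IH[of "[]" s' "b \<otimes>\<^bsub>A i\<^esub> x" "b \<otimes>\<^bsub>A i\<^esub> y"] Nil s' i kb True z by simp
    next
      case False
      then show ?thesis
        using IH[of "[(k, b)]" s' "ctr i x" "ctr i y"] Nil s' i kb z
        by (simp add: letter_iff Ai.center_lincomb Ai.phi_lincomb algebra_simps)
    qed
  next
    case (Cons t s)
    obtain j a where t: "t = (j, a)"
      by fastforce
    have ja: "j \<in> I" "a \<in> C j" "s \<in> lists L"
      using Cons.hyps t by (auto simp: letter_iff)
    show ?case
    proof (cases "k = j")
      case True
      then show ?thesis
        using IH[of "(k, b \<otimes>\<^bsub>A k\<^esub> a) # s" s' x y] Cons.prems s' i kb ja z t
        by (simp add: letter_iff mult_component)
    next
      case False
      then show ?thesis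
        using IH[of "(k, b) # (j, ctr j a) # s" s' x y] Cons s' i kb ja z t
        by (simp add: letter_iff ctr_closed algebra_simps)
    qed
  qed
qed


text \<open>Popping costs the factor \<phi> of a centred letter, and neighbouring labels never
  agree, so the stack can only grow. It ends with a centred letter or with at least two letters,
  both of value 0. This is the vanishing condition of freeness.\<close>

lemma free_eval_null:
  assumes "u \<in> lists L" "s \<in> centred_words" "distinct_adj (map fst (rev u @ s))"
    and "\<forall>(i, a)\<in>set u. \<phi> i a = 0"
  shows "free_eval u s = (if u = [] \<and> s = [] then 1 else 0)"
  using assms
proof (induction u arbitrary: s)
  case Nil
  then show ?case
    by (cases s rule: remdups_adj.cases) (auto simp: Cons_centred_iff)
next
  case (Cons z u)
  obtain k b where z: "z = (k, b)"
    by fastforce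
  have kb: "k \<in> I" "b \<in> C k" "\<phi> k b = 0"
    using Cons.hyps Cons.prems z by (auto simp: letter_iff)
  show ?case
  proof (cases s)
    case Nil
    then show ?thesis
      using Cons.IH[of "[(k, b)]"] Cons.prems kb z by (simp add: Cons_centred_iff)
  next
    case (Cons t s')
    obtain i a where t: "t = (i, a)"
      by fastforce
    have ki: "k \<noteq> i"
      using Cons.prems(2) z t Cons by (simp add: distinct_adj_append_iff)
    have "i \<in> I" "a \<in> C i" "\<phi> i a = 0"
      using Cons.prems(1) Cons t by (auto simp: Cons_centred_iff)
    then have "(k, b) # (i, ctr i a) # s' \<in> centred_words"
      using Cons.prems(1) Cons t kb ki by (simp add: Cons_centred_iff ctr_closed phi_ctr)
    then show ?thesis
      using Cons.IH[of "(k, b) # (i, ctr i a) # s'"] Cons.prems Cons ki z t \<open>\<phi> i a = 0\<close> by simp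
  qed
qed

text \<open>A unit on top of a centred stack is invisible: the stack \<open>[1]\<close> stands for the vacuum \<open>[]\<close>.\<close>

lemma free_eval_unit_top:
  assumes u: "u \<in> lists L" and s: "s \<in> centred_words" and k: "k \<in> I" and top: "s = [] \<or> k \<noteq> fst (hd s)"
  shows "free_eval u ((k, \<one>\<^bsub>A k\<^esub>) # s) = free_eval u s"
proof -
  interpret Ak: nc_space "A k" "\<phi> k"
    using k by (rule nc_space)
  show ?thesis
  proof (cases u)
    case Nil
    then show ?thesis
      using s by (cases s rule: remdups_adj.cases) (auto simp: Ak.unit Cons_centred_iff)
  next
    case (Cons z u')
    obtain l b where z: "z = (l, b)"
      by fastforce
    have lb: "l \<in> I" "b \<in> C l" "u' \<in> lists L"
      using u Cons z by (auto simp: letter_iff)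
    show ?thesis
    proof (cases "l = k")
      case True
      show ?thesis
      proof (cases s)
        case Nil
        then show ?thesis
          using Cons z True lb by simp
      next
        case (Cons t s')
        obtain i a where t: "t = (i, a)"
          by fastforce
        have ia: "i \<in> I" "a \<in> C i" "\<phi> i a = 0" "s' \<in> lists L"
          using s Cons t centred_lists by (auto simp: Cons_centred_iff)
        interpret Ai: nc_space "A i" "\<phi> i"
          using ia(1) by (rule nc_space)
        \<comment> \<open>The top of a centred stack is its own centred part, so reading a letter of
          another label just pushes that letter.\<close>
        have "ctr i a = a"
          using ia by (simp add: Ai.center_def)
        then show ?thesis
          using \<open>u = z # u'\<close> Cons t z True lb ia top by simp
      qed
    next
      case False
      \<comment> \<open>The unit that gets covered is centred to zero; the other summand of the
        recursion has coefficient \<phi>(1) = 1 and is the right-hand side.\<close>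
      have "free_eval u' ([(l, b)] @ (k, 0 \<odot>\<^bsub>A k\<^esub> \<one>\<^bsub>A k\<^esub> \<oplus>\<^bsub>A k\<^esub> 0 \<odot>\<^bsub>A k\<^esub> \<one>\<^bsub>A k\<^esub>) # s) = 0"
        using lb k centred_lists[OF s] by (subst free_eval_stack_lincomb) (simp_all add: letter_iff)
      then show ?thesis
        using Cons z False by (simp add: Ak.center_one Ak.unit del: Ak.smult_zero_left)
    qed
  qed
qed

text \<open>Reading the unit splits the top into \<open>ctr i a\<close> and the scalar \<phi>(a).
  The unit is invisible above the former, and the scalar is returned to the stack as a multiple of
  the internal unit of label \<open>i\<close>. Linearity in the stack puts the two parts together
  again.\<close>

lemma free_eval_unit:
  assumes "u \<in> lists L" "s \<in> stacks" "k \<in> I"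
  shows "free_eval ((k, \<one>\<^bsub>A k\<^esub>) # u) s = free_eval u s"
  using assms(2)
proof (induction s)
  case Nil
  then show ?case
    using free_eval_unit_top[of u "[]" k] assms by simp
next
  case (Cons t s)
  obtain i a where t: "t = (i, a)"
    by fastforce
  have ia: "i \<in> I" "a \<in> C i" and s: "s \<in> centred_words" "s = [] \<or> i \<noteq> fst (hd s)"
    using Cons.prems t by (auto simp: Cons_stacks_iff)
  interpret Ai: nc_space "A i" "\<phi> i"
    using ia(1) by (rule nc_space)
  show ?case
  proof (cases "k = i")
    case True
    then show ?thesis
      using t ia by simp
  next
    case False
    have "free_eval ((k, \<one>\<^bsub>A k\<^esub>) # u) (t # s) =
        free_eval u ((k, \<one>\<^bsub>A k\<^esub>) # (i, ctr i a) # s) + \<phi> i a * free_eval u s"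
      using Cons.IH centred_imp_stack[OF s(1)] False t by simp
    also have "free_eval u ((k, \<one>\<^bsub>A k\<^esub>) # (i, ctr i a) # s) = free_eval u ((i, ctr i a) # s)"
      using assms False s ia by (intro free_eval_unit_top) (simp_all add: Cons_centred_iff ctr_closed phi_ctr)
    also have "free_eval u s = free_eval u ((i, \<one>\<^bsub>A i\<^esub>) # s)"
      using assms s ia by (intro free_eval_unit_top[symmetric])
    also have "free_eval u ((i, ctr i a) # s) + \<phi> i a * free_eval u ((i, \<one>\<^bsub>A i\<^esub>) # s) =
        free_eval u ([] @ (i, 1 \<odot>\<^bsub>A i\<^esub> ctr i a \<oplus>\<^bsub>A i\<^esub> \<phi> i a \<odot>\<^bsub>A i\<^esub> \<one>\<^bsub>A i\<^esub>) # s)"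
      using assms s ia centred_lists by (subst free_eval_stack_lincomb) (simp_all add: ctr_closed)
    also have "\<dots> = free_eval u (t # s)"
      unfolding Ai.center_decomposition[OF ia(2)] t by simp
    finally show ?thesis .
  qed
qed

text \<open>The word is reversed, hence the order of the factors: \<open>b\<close> is read first and
  then multiplied by \<open>a\<close> from the left.\<close>

lemma free_eval_product:
  assumes "i \<in> I" "a \<in> C i" "b \<in> C i" "s \<in> lists L"
  shows "free_eval ((i, b) # (i, a) # u) s = free_eval ((i, a \<otimes>\<^bsub>A i\<^esub> b) # u) s"
  using assms(4)
proof (induction s)
  case (Cons t s)
  then show ?case
    using assms by (cases t) (auto simp: letter_iff assoc_component)
qed simp

lemma free_eval_lincomb:
  assumes "i \<in> I" "a \<in> C i" "b \<in> C i" "s \<in> lists L" "u \<in> lists L"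
  shows "free_eval ((i, \<alpha> \<odot>\<^bsub>A i\<^esub> a \<oplus>\<^bsub>A i\<^esub> \<beta> \<odot>\<^bsub>A i\<^esub> b) # u) s =
    \<alpha> * free_eval ((i, a) # u) s + \<beta> * free_eval ((i, b) # u) s"
  using assms(4)
proof (induction s)
  case Nil
  then show ?case
    using free_eval_stack_lincomb[of u "[]" "[]" i a b] assms by simp
next
  case (Cons t s)
  obtain j c where t: "t = (j, c)"
    by fastforce
  have jc: "j \<in> I" "c \<in> C j" "s \<in> lists L"
    using Cons.hyps t by (auto simp: letter_iff)
  interpret Ai: nc_space "A i" "\<phi> i"
    using assms(1) by (rule nc_space)
  show ?case
  proof (cases "i = j")
    case True
    have "(\<alpha> \<odot>\<^bsub>A i\<^esub> a \<oplus>\<^bsub>A i\<^esub> \<beta> \<odot>\<^bsub>A i\<^esub> b) \<otimes>\<^bsub>A i\<^esub> c =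
        \<alpha> \<odot>\<^bsub>A i\<^esub> (a \<otimes>\<^bsub>A i\<^esub> c) \<oplus>\<^bsub>A i\<^esub> \<beta> \<odot>\<^bsub>A i\<^esub> (b \<otimes>\<^bsub>A i\<^esub> c)"
      using assms jc(2)[folded True] by (simp add: Ai.l_distr Ai.smult_mult_left)
    then show ?thesis
      using free_eval_stack_lincomb[of u "[]" s i "a \<otimes>\<^bsub>A i\<^esub> c" "b \<otimes>\<^bsub>A i\<^esub> c"] assms jc t True
      by (simp add: mult_component)
  next
    case False
    then show ?thesis
      using free_eval_stack_lincomb[of u "[]" "(j, ctr j c) # s" i a b] Cons.IH assms jc t
      by (simp add: letter_iff ctr_closed algebra_simps)
  qed
qed

text \<open>Reading \<open>v\<close> turns \<open>s\<close> into a combination of stacks that is the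
  same for the three words. So a relation needs checking only at the beginning of the unread word,
  provided this is done for every stack.\<close>

lemma free_eval_cong:
  assumes eq: "\<And>s. s \<in> stacks \<Longrightarrow> free_eval x s = \<alpha> * free_eval y s + \<beta> * free_eval z s"
    and "v \<in> lists L" "s \<in> stacks"
  shows "free_eval (v @ x) s = \<alpha> * free_eval (v @ y) s + \<beta> * free_eval (v @ z) s"
  using assms(2,3)
proof (induction v arbitrary: s)
  case Nil
  then show ?case
    using eq by simp
next
  case (Cons t v)
  obtain k b where t: "t = (k, b)"
    by fastforce
  have kb: "k \<in> I" "b \<in> C k"
    using Cons.hyps t by (auto simp: letter_iff)
  note IH = Cons.IH
  show ?case
    using Cons.prems
  proof (induction s)
    case Nil
    then show ?case
      using IH[of "[t]"] t kb by (simp add: Cons_stacks_iff)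
  next
    case (Cons r s)
    obtain i a where r: "r = (i, a)"
      by fastforce
    have ia: "i \<in> I" "a \<in> C i" "s \<in> centred_words" "s = [] \<or> i \<noteq> fst (hd s)"
      using Cons.prems r by (auto simp: Cons_stacks_iff)
    show ?case
    proof (cases "k = i")
      case True
      then show ?thesis
        using IH[of "(k, b \<otimes>\<^bsub>A k\<^esub> a) # s"] ia t r kb by (simp add: Cons_stacks_iff mult_component)
    next
      case False
      then have "(k, b) # (i, ctr i a) # s \<in> stacks"
        using push_stacks[of i a s k b] Cons.prems r kb by (simp add: letter_iff)
      from IH[OF this] show ?thesis
        using Cons.IH centred_imp_stack[OF ia(3)] t r False by (simp add: algebra_simps)
    qed
  qed
qed

text \<open>Reading starts at the end of the word, so \<open>rev y\<close> is taken care of by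
  \<open>free_eval_cong\<close>, and each relation is checked in front of \<open>rev x\<close> on an
  arbitrary stack.\<close>

lemma unital_functional_exists:
  "\<exists>f. linear_functional FU f \<and> (\<forall>w\<in>lists L. f (U.cls w) = free_eval (rev w) [])"
proof -
  have "lin_ext (\<lambda>w. free_eval (rev (x @ w @ y)) []) r = 0"
    if "r \<in> unital_relations I A" "x \<in> lists L" "y \<in> lists L" for r x y
  proof -
    have xy: "rev x \<in> lists L" "rev y \<in> lists L"
      using that by (auto simp: lists_eq_set)
    have cong: "free_eval (rev (x @ t @ y)) [] = \<alpha> * free_eval (rev (x @ u @ y)) [] + \<beta> * free_eval (rev (x @ v @ y)) []"
      if "\<And>s. s \<in> stacks \<Longrightarrow> free_eval (rev t @ rev x) s = \<alpha> * free_eval (rev u @ rev x) s + \<beta> * free_eval (rev v @ rev x) s"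
      for t u v \<alpha> \<beta>
      using free_eval_cong[OF that xy(2), of "[]"] by simp
    from that(1) consider
        (alg) i where "i \<in> I" "r \<in> algebra_relations (A i) (Pair i)"
      | (unit) i where "i \<in> I" "r = unit_relation (A i) (Pair i)"
      unfolding unital_relations_def nonunital_relations_def by blast
    then show ?thesis
    proof cases
      case alg
      show ?thesis
        using alg(2)
      proof (rule lin_ext_algebra_relations)
        fix \<alpha> \<beta> a b assume ab: "a \<in> C i" "b \<in> C i"
        show "free_eval (rev (x @ [(i, \<alpha> \<odot>\<^bsub>A i\<^esub> a \<oplus>\<^bsub>A i\<^esub> \<beta> \<odot>\<^bsub>A i\<^esub> b)] @ y)) [] =
            \<alpha> * free_eval (rev (x @ [(i, a)] @ y)) [] + \<beta> * free_eval (rev (x @ [(i, b)] @ y)) []"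
          by (rule cong) (use free_eval_lincomb[OF alg(1) ab] xy stacks_lists in simp)
        show "free_eval (rev (x @ [(i, a), (i, b)] @ y)) [] = free_eval (rev (x @ [(i, a \<otimes>\<^bsub>A i\<^esub> b)] @ y)) []"
          \<comment> \<open>A two term relation has \<beta> = 0, with the empty word as a
            dummy.\<close>
          using cong[of "[(i, a), (i, b)]" 1 "[(i, a \<otimes>\<^bsub>A i\<^esub> b)]" 0 "[]"]
            free_eval_product[OF alg(1) ab] stacks_lists by simp
      qed
    next
      case unit
      then show ?thesis
        using cong[of "[(i, \<one>\<^bsub>A i\<^esub>)]" 1 "[]" 0 "[]"] free_eval_unit[OF xy(1) _ unit(1)]
        by (simp add: unit_relation_def)
    qed
  qed
  then show ?thesis
    unfolding free_product_eq by (rule U.word_functional_exists)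
qed

section \<open>Uniqueness of the free product functional\<close>

definition voiculescu :: "(('i, 'a) fp \<Rightarrow> complex) \<Rightarrow> bool" where
  "voiculescu f \<longleftrightarrow> linear_functional FU f \<and> f \<one>\<^bsub>FU\<^esub> = 1 \<and>
     (\<forall>i\<in>I. \<forall>a\<in>C i. f (emb I A i a) = \<phi> i a) \<and>
     (\<forall>u\<in>W. u \<noteq> [] \<and> (\<forall>(i, a)\<in>set u. \<phi> i a = 0) \<longrightarrow> f (word I A u) = 0)"

text \<open>The internal unit is identified with the empty word, so the scalar part of a letter
  drops out of the word.\<close>

lemma U_cls_center:
  assumes "x \<in> lists L" "y \<in> lists L" "i \<in> I" "a \<in> C i"
  shows "U.cls (x @ (i, a) # y) = 1 \<odot>\<^bsub>FU\<^esub> U.cls (x @ (i, ctr i a) # y) \<oplus>\<^bsub>FU\<^esub> \<phi> i a \<odot>\<^bsub>FU\<^esub> U.cls (x @ y)"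
proof -
  interpret Ai: nc_space "A i" "\<phi> i"
    using assms(3) by (rule nc_space)
  have letters: "[(i, a)] \<in> lists L" "[(i, ctr i a)] \<in> lists L" "[(i, \<one>\<^bsub>A i\<^esub>)] \<in> lists L"
    using assms by (simp_all add: letter_iff)
  have one: "U.cls [(i, \<one>\<^bsub>A i\<^esub>)] = U.cls []"
    by (rule U.cls_eq) (use assms letters in \<open>auto simp: unital_relations_def unit_relation_def\<close>)
  have "U.cls [(i, 1 \<odot>\<^bsub>A i\<^esub> ctr i a \<oplus>\<^bsub>A i\<^esub> \<phi> i a \<odot>\<^bsub>A i\<^esub> \<one>\<^bsub>A i\<^esub>)] =
      1 \<odot>\<^bsub>FU\<^esub> U.cls [(i, ctr i a)] \<oplus>\<^bsub>FU\<^esub> \<phi> i a \<odot>\<^bsub>FU\<^esub> U.cls [(i, \<one>\<^bsub>A i\<^esub>)]"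
    unfolding free_product_eq
  proof (rule U.cls_lincomb)
    have "single [(i, 1 \<odot>\<^bsub>A i\<^esub> ctr i a \<oplus>\<^bsub>A i\<^esub> \<phi> i a \<odot>\<^bsub>A i\<^esub> \<one>\<^bsub>A i\<^esub>)] 1 -
        single [(i, ctr i a)] 1 - single [(i, \<one>\<^bsub>A i\<^esub>)] (\<phi> i a) \<in> algebra_relations (A i) (Pair i)"
      unfolding algebra_relations_def using assms ctr_closed by blast
    then show "single [(i, 1 \<odot>\<^bsub>A i\<^esub> ctr i a \<oplus>\<^bsub>A i\<^esub> \<phi> i a \<odot>\<^bsub>A i\<^esub> \<one>\<^bsub>A i\<^esub>)] 1 -
        single [(i, ctr i a)] 1 - single [(i, \<one>\<^bsub>A i\<^esub>)] (\<phi> i a) \<in> unital_relations I A"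
      unfolding unital_relations_def nonunital_relations_def using assms by blast
  qed (use letters assms in \<open>simp_all add: letter_iff\<close>)
  then have eq: "U.cls [(i, a)] = 1 \<odot>\<^bsub>FU\<^esub> U.cls [(i, ctr i a)] \<oplus>\<^bsub>FU\<^esub> \<phi> i a \<odot>\<^bsub>FU\<^esub> U.cls []"
    unfolding Ai.center_decomposition[OF assms(4)] one .
  have split: "U.cls (x @ t @ y) = U.cls x \<otimes>\<^bsub>FU\<^esub> U.cls t \<otimes>\<^bsub>FU\<^esub> U.cls y" if "t \<in> lists L" for t
    using U.cls_append[of x "t @ y"] U.cls_append[of t y] that assms
      FU.m_assoc[OF U_cls_closed[of x] U_cls_closed[of t] U_cls_closed[of y]]
    unfolding free_product_eq by simp
  have "U.cls x \<otimes>\<^bsub>FU\<^esub> U.cls [(i, a)] \<otimes>\<^bsub>FU\<^esub> U.cls y =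
      1 \<odot>\<^bsub>FU\<^esub> (U.cls x \<otimes>\<^bsub>FU\<^esub> U.cls [(i, ctr i a)] \<otimes>\<^bsub>FU\<^esub> U.cls y) \<oplus>\<^bsub>FU\<^esub>
      \<phi> i a \<odot>\<^bsub>FU\<^esub> (U.cls x \<otimes>\<^bsub>FU\<^esub> U.cls [] \<otimes>\<^bsub>FU\<^esub> U.cls y)"
    unfolding eq by (rule FU.mult_lincomb) (use letters assms U_cls_closed in simp_all)
  then show ?thesis
    using split[OF letters(1)] split[OF letters(2)] split[of "[]"] by simp
qed

text \<open>Lexicographic induction on the length and the number of letters that are not centred.
  Merging equal neighbours shortens the word; splitting a letter leaves one word with fewer
  uncentred letters and one shorter word. What remains is empty or alternating and centred, where
  the values are prescribed.\<close>

lemma voiculescu_unique: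
  assumes f: "voiculescu f" and g: "voiculescu g" and "w \<in> lists L"
  shows "f (U.cls w) = g (U.cls w)"
  using assms(3)
proof (induction w rule: wf_induct_rule[OF wf_measures[of "[length, \<lambda>w. length (filter (\<lambda>(i, a). \<phi> i a \<noteq> 0) w)]"]])
  case (1 w)
  have IH: "f (U.cls v) = g (U.cls v)" if "length v < length w" "v \<in> lists L" for v
    using 1 that by simp
  have w: "w \<in> lists L"
    using 1 by simp
  consider (empty) "w = []" | (adj) x i a b y where "w = x @ [(i, a), (i, b)] @ y"
    | (centred) "w \<noteq> []" "w \<in> W" "\<forall>(i, a)\<in>set w. \<phi> i a = 0"
    | (letter) x i a y where "w = x @ (i, a) # y" "\<phi> i a \<noteq> 0"
  proof (cases "w \<in> W")
    case True
    then show ?thesis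
      using that(1,3,4) by (metis (mono_tags, lifting) case_prodI2 split_list)
  next
    case False
    then have "\<not> distinct_adj (map fst w)"
      using w by (simp add: words_iff)
    then obtain n where n: "Suc n < length w" "fst (w ! n) = fst (w ! Suc n)"
      by (auto simp: distinct_adj_conv_nth)
    have "w = take n w @ [w ! n, w ! Suc n] @ drop (Suc (Suc n)) w"
      using n by (simp add: Cons_nth_drop_Suc)
    also have "[w ! n, w ! Suc n] = [(fst (w ! n), snd (w ! n)), (fst (w ! n), snd (w ! Suc n))]"
      using n(2) by (simp add: prod_eq_iff)
    finally show ?thesis
      by (rule that(2))
  qed
  then show ?case
  proof cases
    case empty
    have "U.cls [] = \<one>\<^bsub>FU\<^esub>"
      using U.cls_one unfolding free_product_eq word_monoid_simps .
    then show ?thesis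
      using f g empty by (simp add: voiculescu_def)
  next
    case adj
    have ab: "i \<in> I" "a \<in> C i" "b \<in> C i" "x \<in> lists L" "y \<in> lists L"
      using w adj by (auto simp: letter_iff)
    have "U.cls w = U.cls (x @ [(i, a \<otimes>\<^bsub>A i\<^esub> b)] @ y)"
      unfolding adj
      by (rule U.cls_context[OF U_cls_product]) (use ab in \<open>simp_all add: letter_iff mult_component\<close>)
    moreover have "f (U.cls (x @ [(i, a \<otimes>\<^bsub>A i\<^esub> b)] @ y)) = g (U.cls (x @ [(i, a \<otimes>\<^bsub>A i\<^esub> b)] @ y))"
      by (rule IH) (use adj ab in \<open>simp_all add: letter_iff mult_component\<close>)
    ultimately show ?thesis
      by simp
  next
    case centred
    then have "f (word I A w) = 0" "g (word I A w) = 0"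
      using f g unfolding voiculescu_def by blast+
    then show ?thesis
      using word_eq[OF w] by simp
  next
    case letter
    have a: "i \<in> I" "a \<in> C i" "x \<in> lists L" "y \<in> lists L"
      using w letter by (auto simp: letter_iff)
    have "f (U.cls (x @ (i, ctr i a) # y)) = g (U.cls (x @ (i, ctr i a) # y))"
      using a letter by (intro "1.IH") (simp_all add: letter_iff ctr_closed phi_ctr)
    moreover have "f (U.cls (x @ y)) = g (U.cls (x @ y))"
      using a letter by (intro IH) simp_all
    moreover have closed: "U.cls (x @ (i, ctr i a) # y) \<in> carrier FU" "U.cls (x @ y) \<in> carrier FU"
      by (rule U_cls_closed; use a in \<open>simp add: letter_iff ctr_closed\<close>)+
    ultimately show ?thesis
      using f g unfolding letter(1) U_cls_center[OF a(3,4,1,2)] voiculescu_def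
      by (simp only: linear_functional_lincomb[OF _ FU.complex_algebra])
  qed
qed

lemma FPF_props:
  "linear_functional FU (free_product_functional I A \<phi>)"
  "w \<in> lists L \<Longrightarrow> free_product_functional I A \<phi> (U.cls w) = free_eval (rev w) []"
proof -
  obtain f where f: "linear_functional FU f" "\<And>w. w \<in> lists L \<Longrightarrow> f (U.cls w) = free_eval (rev w) []"
    using unital_functional_exists by blast
  let ?f = "restrict f (carrier FU)"
  have cls: "?f (U.cls w) = free_eval (rev w) []" if "w \<in> lists L" for w
    using that f(2) U_cls_closed by simp
  have voi: "voiculescu ?f"
    unfolding voiculescu_def
  proof (intro conjI ballI impI)
    show "linear_functional FU ?f"
      by (rule FU.linear_functional_restrict[OF f(1)])
    have "U.cls [] = \<one>\<^bsub>FU\<^esub>"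
      using U.cls_one unfolding free_product_eq word_monoid_simps .
    then show "?f \<one>\<^bsub>FU\<^esub> = 1"
      using cls[of "[]"] by simp
  next
    fix i a assume "i \<in> I" "a \<in> C i"
    then show "?f (emb I A i a) = \<phi> i a"
      using cls[of "[(i, a)]"] by (simp add: emb_eq letter_iff)
  next
    fix u assume u: "u \<in> W" "u \<noteq> [] \<and> (\<forall>(i, a)\<in>set u. \<phi> i a = 0)"
    then have "free_eval (rev u) [] = 0"
      using free_eval_null[of "rev u" "[]"] by (auto simp: words_iff lists_eq_set)
    then show "?f (word I A u) = 0"
      using u cls[of u] by (simp add: word_eq words_iff)
  qed
  have "free_product_functional I A \<phi> = the_on (carrier FU) voiculescu"
    unfolding free_product_functional_def
    by (rule arg_cong[of _ _ "the_on (carrier FU)"]) (simp only: voiculescu_def fun_eq_iff simp_thms)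
  also have "\<dots> = ?f"
  proof (rule the_on_eq)
    fix g x assume g: "voiculescu g" and x: "x \<in> carrier FU"
    have lin: "linear_functional U.QA.Q g" "linear_functional U.QA.Q f"
      using g f(1) by (simp_all only: voiculescu_def free_product_eq)
    have words: "g (U.cls w) = f (U.cls w)" if "w \<in> lists L" for w
      using voiculescu_unique[OF g voi that] U_cls_closed[OF that] by simp
    show "g x = f x"
    proof (rule U.functional_eqI[OF lin])
      show "x \<in> carrier U.QA.Q"
        using x unfolding free_product_eq .
    qed (simp only: word_monoid_simps words)
  qed (rule voi)
  finally have eq: "free_product_functional I A \<phi> = ?f" .
  show "linear_functional FU (free_product_functional I A \<phi>)"
    unfolding eq by (rule FU.linear_functional_restrict[OF f(1)])
  show "w \<in> lists L \<Longrightarrow> free_product_functional I A \<phi> (U.cls w) = free_eval (rev w) []"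
    unfolding eq by (rule cls)
qed

section \<open>The free and the boolean product evaluated on words\<close>

abbreviation free_after_hom where
  "free_after_hom x \<equiv> free_product_functional I A \<phi> (canonical_hom I A x)"

lemma free_product_functional_canonical_hom:
  "linear_functional FS free_after_hom"
  "u \<in> lists L \<Longrightarrow> free_after_hom (N.cls u) = free_eval (rev u) []"
  using linear_functional_comp[OF FPF_props(1) canonical_hom_props(1)]
  by (simp_all add: canonical_hom_props(2) FPF_props(2))

lemma boolean_product_functional_props:
  "linear_functional FS (boolean_product_functional I A \<phi>)"
  "u \<in> W \<Longrightarrow> boolean_product_functional I A \<phi> (N.cls u) = (\<Prod>(i, a)\<leftarrow>u. \<phi> i a)"
proof -
  have "multilinear_on_words (\<lambda>u. \<Prod>(i, a)\<leftarrow>u. \<phi> i a)"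
    unfolding multilinear_on_words_def
    by (auto simp: nc_space.phi_lincomb[OF nc_space] algebra_simps)
  from sep_functional_exists[OF this]
  obtain f where f: "linear_functional FS f" "\<And>u. u \<in> W \<Longrightarrow> f (N.cls u) = (\<Prod>(i, a)\<leftarrow>u. \<phi> i a)"
    by blast
  have W: "[] \<in> W" "\<And>u. u \<in> W \<Longrightarrow> u \<in> lists L"
    by (simp_all add: words_iff)
  have one: "N.cls [] = \<one>\<^bsub>FS\<^esub>"
    using N.cls_one unfolding free_product_sep_eq word_monoid_simps .
  have "boolean_product_functional I A \<phi> = restrict f (carrier FS)"
    unfolding boolean_product_functional_def
  proof (rule the_on_eq)
    show "linear_functional FS (restrict f (carrier FS)) \<and> restrict f (carrier FS) \<one>\<^bsub>FS\<^esub> = 1 \<and>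
      (\<forall>u\<in>W. u \<noteq> [] \<longrightarrow> restrict f (carrier FS) (word_sep I A u) = (\<Prod>(i, a)\<leftarrow>u. \<phi> i a))"
      using FS.linear_functional_restrict[OF f(1)] f(2) f(2)[OF W(1)] one
      by (simp add: W word_sep_eq N_cls_closed)
  next
    fix g x
    assume g: "linear_functional FS g \<and> g \<one>\<^bsub>FS\<^esub> = 1 \<and>
      (\<forall>u\<in>W. u \<noteq> [] \<longrightarrow> g (word_sep I A u) = (\<Prod>(i, a)\<leftarrow>u. \<phi> i a))" and x: "x \<in> carrier FS"
    have words: "g (N.cls u) = f (N.cls u)" if "u \<in> W" for u
      using g f(2)[OF that] that one word_sep_eq[OF W(2)[OF that]] by (cases "u = []") auto
    show "g x = f x"
      using g by (intro sep_functional_eqI[of g f x] f(1) words x) simp_all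
  qed
  then show "linear_functional FS (boolean_product_functional I A \<phi>)"
    "u \<in> W \<Longrightarrow> boolean_product_functional I A \<phi> (N.cls u) = (\<Prod>(i, a)\<leftarrow>u. \<phi> i a)"
    using FS.linear_functional_restrict[OF f(1)] f(2) W N_cls_closed by simp_all
qed

section \<open>Replicas acting on stacks\<close>

abbreviation TF :: "('i, 'a) tensor \<Rightarrow> complex" where "TF \<equiv> tensor_functional I A \<phi>"
abbreviation st :: "('i, 'a) tfam \<Rightarrow> ('i, 'a) tensor" where "st \<equiv> simple_tensor I A"
abbreviation tensor_mult (infixl "\<cdot>" 70) where "x \<cdot> y \<equiv> x \<otimes>\<^bsub>TA\<^esub> y"
abbreviation P_op where "P_op \<equiv> P_tensor I A"
abbreviation \<psi> where "\<psi> \<equiv> motzkin_functional I A \<phi>"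

section \<open>Stacks as simple tensors\<close>

lemma site_iff: "(k, m) \<in> sites I \<longleftrightarrow> k \<in> I \<and> 1 \<le> m"
  by (auto simp: sites_def)

lemma ext_emb_component: "k \<in> I \<Longrightarrow> a \<in> C k \<Longrightarrow> ext_emb (A k) a \<in> carrier (ext_algebra (A k))"
  by (rule nc_space.ext_emb_closed[OF nc_space])

lemma ext_one_component: "k \<in> I \<Longrightarrow> \<one>\<^bsub>ext_algebra (A k)\<^esub> \<in> carrier (ext_algebra (A k))"
  using site_one_closed[of "(k, 1)"] by (simp add: site_iff)

lemma ext_mult_one:
  "k \<in> I \<Longrightarrow> x \<in> carrier (ext_algebra (A k)) \<Longrightarrow> x \<otimes>\<^bsub>ext_algebra (A k)\<^esub> \<one>\<^bsub>ext_algebra (A k)\<^esub> = x"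
  "k \<in> I \<Longrightarrow> x \<in> carrier (ext_algebra (A k)) \<Longrightarrow> \<one>\<^bsub>ext_algebra (A k)\<^esub> \<otimes>\<^bsub>ext_algebra (A k)\<^esub> x = x"
proof -
  assume *: "k \<in> I" "x \<in> carrier (ext_algebra (A k))"
  interpret nc_space "A k" "\<phi> k"
    using *(1) by (rule nc_space)
  show "x \<otimes>\<^bsub>ext_algebra (A k)\<^esub> \<one>\<^bsub>ext_algebra (A k)\<^esub> = x"
    "\<one>\<^bsub>ext_algebra (A k)\<^esub> \<otimes>\<^bsub>ext_algebra (A k)\<^esub> x = x"
    using * by simp_all
qed

text \<open>Heights are counted from the bottom, so pushing a letter leaves the sites of the others
  unchanged and always uses a new height.\<close>

fun stack_fam :: "('i \<times> 'a) list \<Rightarrow> ('i, 'a) tfam" where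
  "stack_fam [] = \<one>\<^bsub>TM\<^esub>"
| "stack_fam ((i, a) # s) = (stack_fam s)((i, Suc (length s)) := ext_emb (A i) a)"

abbreviation stack_tensor where "stack_tensor s \<equiv> st (stack_fam s)"

lemma stack_fam_closed: "s \<in> lists L \<Longrightarrow> stack_fam s \<in> carrier TM"
proof (induction s)
  case (Cons t s)
  obtain i a where t: "t = (i, a)"
    by fastforce
  have "i \<in> I" "a \<in> C i" "stack_fam s \<in> carrier TM"
    using Cons t by (simp_all add: letter_iff)
  then show ?case
    unfolding t stack_fam.simps
    by (intro tensor_upd_closed) (simp_all add: site_iff ext_emb_component)
qed (simp add: tensor_monoid_one_closed)

lemma stack_fam_above:
  "(k, m) \<in> sites I \<Longrightarrow> length s < m \<Longrightarrow> stack_fam s (k, m) = \<one>\<^bsub>ext_algebra (A k)\<^esub>"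
proof (induction s)
  case Nil
  then show ?case
    by (simp add: tensor_monoid_one)
next
  case (Cons t s)
  then show ?case
    by (cases t) simp
qed

lemma stack_fam_entry: "stack_fam (s @ (i, a) # s') (i, Suc (length s')) = ext_emb (A i) a"
proof (induction s)
  case (Cons t s)
  then show ?case
    by (cases t) simp
qed simp

lemma stack_fam_upd_above:
  assumes "s \<in> lists L" "(k, m) \<in> sites I" "length s < m"
  shows "(stack_fam s)((k, m) := \<one>\<^bsub>ext_algebra (A k)\<^esub>) = stack_fam s"
  using stack_fam_above[OF assms(2,3)] by (simp add: fun_upd_idem)

section \<open>Projections and replicas in the tensor product\<close>

definition P_family :: "'i \<Rightarrow> nat \<Rightarrow> ('i, 'a) tfam" where
  "P_family i j = (\<lambda>(k, m)\<in>sites I. if k = i \<or> m < j then \<one>\<^bsub>ext_algebra (A k)\<^esub> else ext_idem (A k))"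

lemma P_family_cases:
  "s \<in> sites I \<Longrightarrow> P_family i j s = \<one>\<^bsub>ext s\<^esub> \<or> P_family i j s = idem s"
  by (cases s) (simp add: P_family_def)

lemma P_family_closed: "P_family i j \<in> carrier TM"
proof -
  have "{s \<in> sites I. P_family i j s \<noteq> \<one>\<^bsub>ext s\<^esub> \<and> P_family i j s \<noteq> idem s} = {}"
    using P_family_cases by blast
  then have "finite {s \<in> sites I. P_family i j s \<noteq> \<one>\<^bsub>ext s\<^esub> \<and> P_family i j s \<noteq> idem s}"
    by (simp only: finite.emptyI)
  moreover have "P_family i j s \<in> carrier (ext s)" if "s \<in> sites I" for s
    using P_family_cases[OF that, of i j] site_one_closed[OF that] site_idem_closed[OF that] by metis
  moreover have "P_family i j \<in> extensional (sites I)"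
    by (simp add: P_family_def)
  ultimately show ?thesis
    unfolding tensor_monoid_carrier_iff by blast
qed

lemma P_tensor_eq: "P_op i j = (if j = 0 then \<zero>\<^bsub>TA\<^esub> else st (P_family i j))"
  by (simp add: P_tensor_def P_family_def)

lemma P_tensor_closed: "P_op i j \<in> carrier TA"
  by (simp add: P_tensor_eq P_family_closed)

lemma p_tensor_closed: "p_tensor I A i j \<in> carrier TA"
  by (simp add: p_tensor_def P_tensor_closed)

definition iota_family :: "'i \<Rightarrow> nat \<Rightarrow> 'a \<Rightarrow> ('i, 'a) tfam" where
  "iota_family i j a =
    (\<lambda>(k, m)\<in>sites I. if k = i \<and> m = j then ext_emb (A k) a else \<one>\<^bsub>ext_algebra (A k)\<^esub>)"

lemma iota_eq: "iota I A i j a = st (iota_family i j a)"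
  by (simp add: iota_def iota_family_def)

lemma iota_family_upd:
  assumes "i \<in> I" "1 \<le> j"
  shows "iota_family i j a = (\<one>\<^bsub>TM\<^esub>)((i, j) := ext_emb (A i) a)"
  using assms by (auto simp: iota_family_def tensor_monoid_one fun_eq_iff restrict_def site_iff)

lemma iota_family_closed:
  assumes "i \<in> I" "a \<in> C i"
  shows "iota_family i j a \<in> carrier TM"
proof (cases "1 \<le> j")
  case True
  then show ?thesis
    unfolding iota_family_upd[OF assms(1) True]
    using assms by (intro tensor_upd_closed tensor_monoid_one_closed) (auto simp: site_iff ext_emb_component)
next
  case False
  then have "iota_family i j a = \<one>\<^bsub>TM\<^esub>"
    by (auto simp: iota_family_def tensor_monoid_one fun_eq_iff restrict_def site_iff)
  then show ?thesis
    by (simp add: tensor_monoid_one_closed)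
qed

lemma iota_closed: "i \<in> I \<Longrightarrow> a \<in> C i \<Longrightarrow> iota I A i j a \<in> carrier TA"
  by (simp add: iota_eq iota_family_closed)

lemma replica_closed: "i \<in> I \<Longrightarrow> a \<in> C i \<Longrightarrow> replica I A i a j \<in> carrier TA"
  by (simp add: replica_def iota_closed p_tensor_closed)

lemma iota_lincomb:
  assumes i: "i \<in> I" and j: "1 \<le> j" and ab: "a \<in> C i" "b \<in> C i"
  shows "iota I A i j (\<alpha> \<odot>\<^bsub>A i\<^esub> a \<oplus>\<^bsub>A i\<^esub> \<beta> \<odot>\<^bsub>A i\<^esub> b) =
    \<alpha> \<odot>\<^bsub>TA\<^esub> iota I A i j a \<oplus>\<^bsub>TA\<^esub> \<beta> \<odot>\<^bsub>TA\<^esub> iota I A i j b"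
  unfolding iota_eq iota_family_upd[OF i j] nc_space.ext_emb_lincomb[OF nc_space[OF i] ab]
  using simple_tensor_lincomb[OF tensor_monoid_one_closed, of "(i, j)" "ext_emb (A i) a" "ext_emb (A i) b"]
    assms by (simp add: site_iff ext_emb_component)

text \<open>At the height just above the stack there are only units, so the letter is entered there
  unchanged.\<close>

lemma iota_stack_push:
  assumes k: "k \<in> I" "b \<in> C k" and s: "s \<in> lists L"
  shows "iota I A k (Suc (length s)) b \<cdot> stack_tensor s = stack_tensor ((k, b) # s)"
proof -
  have "iota_family k (Suc (length s)) b \<bullet> stack_fam s = stack_fam ((k, b) # s)"
  proof (rule tensor_ext)
    fix t assume t: "t \<in> sites I"
    then have "stack_fam s t \<in> carrier (ext t)"
      using tensor_entry_closed stack_fam_closed s by blast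
    then show "(iota_family k (Suc (length s)) b \<bullet> stack_fam s) t = stack_fam ((k, b) # s) t"
      using t k stack_fam_above[of k "Suc (length s)" s]
      by (cases t) (auto simp: tensor_monoid_mult iota_family_def site_iff ext_mult_one ext_emb_component)
  qed (use assms in \<open>auto intro!: tensor_monoid_mult_closed iota_family_closed stack_fam_closed simp: letter_iff simp del: stack_fam.simps\<close>)
  then show ?thesis
    unfolding iota_eq using simple_tensor_mult[OF iota_family_closed[OF k] stack_fam_closed[OF s]] by simp
qed

lemma iota_stack_multiply:
  assumes k: "k \<in> I" "b \<in> C k" and s: "(k, a) # s \<in> lists L"
  shows "iota I A k (Suc (length s)) b \<cdot> stack_tensor ((k, a) # s) =
    stack_tensor ((k, b \<otimes>\<^bsub>A k\<^esub> a) # s)"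
proof -
  have a: "a \<in> C k"
    using s by (simp add: letter_iff)
  interpret Ak: nc_space "A k" "\<phi> k"
    using k(1) by (rule nc_space)
  have "iota_family k (Suc (length s)) b \<bullet> stack_fam ((k, a) # s) = stack_fam ((k, b \<otimes>\<^bsub>A k\<^esub> a) # s)"
  proof (rule tensor_ext)
    fix t assume t: "t \<in> sites I"
    then have "stack_fam s t \<in> carrier (ext t)"
      using tensor_entry_closed stack_fam_closed s by (metis Cons_in_lists_iff)
    then show "(iota_family k (Suc (length s)) b \<bullet> stack_fam ((k, a) # s)) t =
        stack_fam ((k, b \<otimes>\<^bsub>A k\<^esub> a) # s) t"
      using t k a by (cases t) (auto simp: tensor_monoid_mult iota_family_def site_iff ext_mult_one Ak.ext_emb_mult)
  qed (use assms a in \<open>auto intro!: tensor_monoid_mult_closed iota_family_closed stack_fam_closed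
      simp: letter_iff simp del: stack_fam.simps\<close>)
  then show ?thesis
    unfolding iota_eq using simple_tensor_mult[OF iota_family_closed[OF k] stack_fam_closed[OF s]] by simp
qed

text \<open>The entry at the top site is split; its scalar part is a multiple of the unit, which
  removes the letter from the stack. This is an identity of tensors, not only of values under
  \<Phi>.\<close>

lemma stack_center:
  assumes "(i, a) # s \<in> lists L"
  shows "stack_tensor ((i, a) # s) =
    1 \<odot>\<^bsub>TA\<^esub> stack_tensor ((i, ctr i a) # s) \<oplus>\<^bsub>TA\<^esub> \<phi> i a \<odot>\<^bsub>TA\<^esub> stack_tensor s"
proof -
  have ia: "i \<in> I" "a \<in> C i" "s \<in> lists L"
    using assms by (auto simp: letter_iff)
  interpret Ai: nc_space "A i" "\<phi> i"
    using ia(1) by (rule nc_space)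
  have site: "(i, Suc (length s)) \<in> sites I"
    using ia by (simp add: site_iff)
  have "ext_emb (A i) a = ext_emb (A i) (1 \<odot>\<^bsub>A i\<^esub> ctr i a \<oplus>\<^bsub>A i\<^esub> \<phi> i a \<odot>\<^bsub>A i\<^esub> \<one>\<^bsub>A i\<^esub>)"
    by (simp only: Ai.center_decomposition[OF ia(2)])
  also have "\<dots> = 1 \<odot>\<^bsub>ext_algebra (A i)\<^esub> ext_emb (A i) (ctr i a) \<oplus>\<^bsub>ext_algebra (A i)\<^esub>
      \<phi> i a \<odot>\<^bsub>ext_algebra (A i)\<^esub> \<one>\<^bsub>ext_algebra (A i)\<^esub>"
    unfolding Ai.ext_emb_one[symmetric] by (rule Ai.ext_emb_lincomb) (simp_all add: ia)
  finally show ?thesis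
    using simple_tensor_lincomb[OF stack_fam_closed[OF ia(3)] site, of "ext_emb (A i) (ctr i a)" "\<one>\<^bsub>ext_algebra (A i)\<^esub>" 1 "\<phi> i a"]
      stack_fam_upd_above[OF ia(3) site] ia
    by (simp only: stack_fam.simps fst_conv Ai.ext_emb_closed Ai.center_closed Ai.X.one_closed lessI)
qed

text \<open>\<open>Y\<close> will be built from the replicas still to be read. Since simple tensors
  span, an identity under \<Phi> may be tested with a simple tensor in its place, where \<Phi> is an
  explicit product over sites.\<close>

lemma tensor_functional_eqI:
  assumes uv: "u \<in> carrier TA" "v \<in> carrier TA"
    and eq: "\<And>y. y \<in> carrier TM \<Longrightarrow> TF (st y \<cdot> u) = c * TF (st y \<cdot> v)"
    and Y: "Y \<in> carrier TA"
  shows "TF (Y \<cdot> u) = c * TF (Y \<cdot> v)"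
proof -
  have lin: "linear_functional TA (\<lambda>Y. TF (Y \<cdot> Z))" if "Z \<in> carrier TA" for Z
    using TA.linear_functional_mult[OF TF_props(1) TA.one_closed that] that
    by (simp add: linear_functional_def TA.l_one)
  have "linear_functional TA (\<lambda>Y. c * TF (Y \<cdot> v))"
    using lin[OF uv(2)] by (simp add: linear_functional_def distrib_left)
  from T.functional_eqI[folded tensor_algebra_eq simple_tensor_eq, OF lin[OF uv(1)] this eq Y]
  show ?thesis .
qed

text \<open>Every \<open>p\<close> contributed by \<open>P_k(j)\<close> meets a unit on its right
  and then has no effect on the value.\<close>

lemma P_absorb:
  assumes Y: "Y \<in> carrier TA" and s: "s \<in> lists L" and j: "1 \<le> j"
    and units: "\<And>l m. (l, m) \<in> sites I \<Longrightarrow> l \<noteq> k \<Longrightarrow> j \<le> m \<Longrightarrow> stack_fam s (l, m) = \<one>\<^bsub>ext_algebra (A l)\<^esub>"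
  shows "TF (Y \<cdot> (P_op k j \<cdot> stack_tensor s)) = TF (Y \<cdot> stack_tensor s)"
proof -
  note V = stack_fam_closed[OF s] and P = P_family_closed[of k j]
  have "TF (Y \<cdot> (st (P_family k j) \<cdot> stack_tensor s)) = 1 * TF (Y \<cdot> stack_tensor s)"
  proof (rule tensor_functional_eqI[OF _ _ _ Y])
    fix y assume y: "y \<in> carrier TM"
    have "tensor_value (y \<bullet> (P_family k j \<bullet> stack_fam s)) = tensor_value (y \<bullet> stack_fam s)"
    proof (rule tensor_value_absorb[OF y V])
      fix t assume "t \<in> sites I"
      moreover obtain l m where "t = (l, m)"
        by fastforce
      ultimately show "P_family k j t = \<one>\<^bsub>ext t\<^esub> \<or>
          P_family k j t = idem t \<and> stack_fam s t = \<one>\<^bsub>ext t\<^esub>"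
        using units by (cases "l = k \<or> m < j") (simp_all add: P_family_def)
    qed
    then show "TF (st y \<cdot> (st (P_family k j) \<cdot> stack_tensor s)) = 1 * TF (st y \<cdot> stack_tensor s)"
      using y V P by (simp add: simple_tensor_mult tensor_monoid_mult_closed TF_props(2))
  qed (use V P in auto)
  then show ?thesis
    using j by (simp add: P_tensor_eq)
qed

text \<open>The letter \<open>a\<close> sits at height \<open>Suc (length s')\<close>, within the
  range where \<open>P_k(j)\<close> has \<open>p\<close> at label \<open>i\<close>, so it splits
  off.\<close>

lemma P_factor:
  assumes Y: "Y \<in> carrier TA" and s: "s @ (i, a) # s' \<in> lists L" and j: "1 \<le> j"
    and ki: "k \<noteq> i" and le: "j \<le> Suc (length s')"
  shows "TF (Y \<cdot> (P_op k j \<cdot> stack_tensor (s @ (i, a) # s'))) =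
    \<phi> i a * TF (Y \<cdot> (P_op k j \<cdot>
      st ((stack_fam (s @ (i, a) # s'))((i, Suc (length s')) := \<one>\<^bsub>ext_algebra (A i)\<^esub>))))"
proof -
  let ?V = "stack_fam (s @ (i, a) # s')" and ?t = "(i, Suc (length s'))"
  note V = stack_fam_closed[OF s] and P = P_family_closed[of k j]
  have ia: "i \<in> I" "a \<in> C i"
    using s by (auto simp: letter_iff)
  have t: "?t \<in> sites I"
    using ia by (simp add: site_iff)
  have V': "?V(?t := \<one>\<^bsub>ext_algebra (A i)\<^esub>) \<in> carrier TM"
    using V t by (rule tensor_upd_closed) (simp add: ext_one_component ia)
  have "TF (Y \<cdot> (st (P_family k j) \<cdot> st ?V)) =
      \<phi> i a * TF (Y \<cdot> (st (P_family k j) \<cdot> st (?V(?t := \<one>\<^bsub>ext_algebra (A i)\<^esub>))))"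
  proof (rule tensor_functional_eqI[OF _ _ _ Y])
    fix y assume y: "y \<in> carrier TM"
    have "tensor_value (y \<bullet> (P_family k j \<bullet> ?V)) =
        \<phi> i a * tensor_value (y \<bullet> (P_family k j \<bullet> ?V(?t := \<one>\<^bsub>ext_algebra (A i)\<^esub>)))"
      using tensor_value_factor[OF y V P t] t ki le ia
      by (simp add: P_family_def stack_fam_entry nc_space.ext_functional_emb[OF nc_space])
    then show "TF (st y \<cdot> (st (P_family k j) \<cdot> st ?V)) =
        \<phi> i a * TF (st y \<cdot> (st (P_family k j) \<cdot> st (?V(?t := \<one>\<^bsub>ext_algebra (A i)\<^esub>))))"
      using y V V' P by (simp only: simple_tensor_mult tensor_monoid_mult_closed TF_props(2))
  qed (use V V' P in auto)
  then show ?thesis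
    using j by (simp add: P_tensor_eq)
qed

text \<open>A centred letter of label other than \<open>k\<close> at height at least
  \<open>j\<close> splits off with the factor 0. Neighbouring labels differ, so the part of the
  stack from height \<open>j\<close> on survives only if it is empty or a single letter of label
  \<open>k\<close>; then every \<open>p\<close> meets a unit.\<close>

lemma P_centred:
  assumes Y: "Y \<in> carrier TA" and s: "s \<in> centred_words" and j: "1 \<le> j"
  shows "TF (Y \<cdot> (P_op k j \<cdot> stack_tensor s)) =
    (if length s < j \<or> length s = j \<and> fst (hd s) = k then TF (Y \<cdot> stack_tensor s) else 0)"
proof -
  note sL = centred_lists[OF s]
  have null: "TF (Y \<cdot> (P_op k j \<cdot> stack_tensor s)) = 0"
    if "s = s1 @ (i, a) # s2" "k \<noteq> i" "j \<le> Suc (length s2)" for s1 i a s2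
  proof -
    have "\<phi> i a = 0"
      using s that(1) by (auto simp: centred_words_def)
    then show ?thesis
      using P_factor[OF Y, of s1 i a s2 j k] sL j that by simp
  qed
  consider (low) "length s < j" | (top) a s' where "s = (k, a) # s'" "length s = j"
    | (kill) i a s' where "s = (i, a) # s'" "i \<noteq> k" "j \<le> length s"
    | (kill2) a l b s' where "s = (k, a) # (l, b) # s'" "l \<noteq> k" "j < length s"
  proof (cases s)
    case Nil
    then show ?thesis
      using that(1) j by simp
  next
    case (Cons t s')
    obtain i a where t: "t = (i, a)"
      by fastforce
    show ?thesis
    proof (cases "i = k")
      case True
      show ?thesis
      proof (cases s')
        case Nil
        then show ?thesis
          using that(1,2) Cons t True j by (cases "j = 1") auto
      next
        case (Cons r s'')
        obtain l b where r: "r = (l, b)"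
          by fastforce
        then have "l \<noteq> k"
          using s \<open>s = t # s'\<close> Cons t True by (auto simp: Cons_centred_iff)
        then show ?thesis
          using that(1,2,4) \<open>s = t # s'\<close> Cons t True r by (metis linorder_neqE_nat)
      qed
    next
      case False
      then show ?thesis
        using that(1,3) Cons t by (metis linorder_not_le)
    qed
  qed
  then show ?thesis
  proof cases
    case low
    have "TF (Y \<cdot> (P_op k j \<cdot> stack_tensor s)) = TF (Y \<cdot> stack_tensor s)"
      using low by (intro P_absorb[OF Y sL j] stack_fam_above) auto
    then show ?thesis
      using low by simp
  next
    case top
    have "TF (Y \<cdot> (P_op k j \<cdot> stack_tensor s)) = TF (Y \<cdot> stack_tensor s)"
    proof (rule P_absorb[OF Y sL j])
      fix l m assume *: "(l, m) \<in> sites I" "l \<noteq> k" "j \<le> m"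
      then show "stack_fam s (l, m) = \<one>\<^bsub>ext_algebra (A l)\<^esub>"
        using stack_fam_above[OF *(1), of s'] top by auto
    qed
    then show ?thesis
      using top by simp
  next
    case kill
    then show ?thesis
      using null[of "[]" i a s'] by auto
  next
    case kill2
    then show ?thesis
      using null[of "[(k, a)]" l b s'] by auto
  qed
qed

text \<open>Only the top may be uncentred. Once covered by a \<open>p\<close> it leaves as
  \<phi>(a), and the remaining stack is centred throughout.\<close>

lemma P_stack:
  assumes Y: "Y \<in> carrier TA" and s: "(i, a) # s \<in> stacks" and j: "1 \<le> j" and ki: "k \<noteq> i"
  shows "TF (Y \<cdot> (P_op k j \<cdot> stack_tensor ((i, a) # s))) =
    (if Suc (length s) < j then TF (Y \<cdot> stack_tensor ((i, a) # s))
     else \<phi> i a * (if length s < j \<or> length s = j \<and> fst (hd s) = k then TF (Y \<cdot> stack_tensor s) else 0))"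
proof (cases "Suc (length s) < j")
  case True
  have "TF (Y \<cdot> (P_op k j \<cdot> stack_tensor ((i, a) # s))) =
      TF (Y \<cdot> stack_tensor ((i, a) # s))"
    using True by (intro P_absorb[OF Y stacks_lists[OF s] j] stack_fam_above) auto
  then show ?thesis
    using True by simp
next
  case False
  have ia: "i \<in> I" and sc: "s \<in> centred_words"
    using s by (auto simp: Cons_stacks_iff)
  have "(stack_fam ((i, a) # s))((i, Suc (length s)) := \<one>\<^bsub>ext_algebra (A i)\<^esub>) = stack_fam s"
    using stack_fam_upd_above[OF centred_lists[OF sc], of i "Suc (length s)"] ia by (simp add: site_iff)
  then show ?thesis
    using P_factor[OF Y, of "[]" i a s j k] stacks_lists[OF s] j ki False P_centred[OF Y sc j, of k]
    by (simp del: stack_fam.simps)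
qed

lemma TF_minus_stack:
  assumes "Y \<in> carrier TA" "V \<in> carrier TA"
  shows "TF (Y \<cdot> (p_tensor I A k j \<cdot> V)) =
    TF (Y \<cdot> (P_op k j \<cdot> V)) - TF (Y \<cdot> (P_op k (j - 1) \<cdot> V))"
proof -
  have "Y \<cdot> (p_tensor I A k j \<cdot> V) =
      Y \<cdot> (P_op k j \<cdot> V) \<ominus>\<^bsub>TA\<^esub> Y \<cdot> (P_op k (j - 1) \<cdot> V)"
    using assms P_tensor_closed
    by (simp add: p_tensor_def a_minus_def TA.l_distr TA.r_distr TA.l_minus TA.r_minus)
  then show ?thesis
    using assms P_tensor_closed TA.linear_functional_minus[OF TF_props(1)] by simp
qed

lemma TF_P_zero: "Y \<in> carrier TA \<Longrightarrow> V \<in> carrier TA \<Longrightarrow> TF (Y \<cdot> (P_op k 0 \<cdot> V)) = 0"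
  using TA.linear_functional_zero[OF TF_props(1)] by (simp add: P_tensor_eq)

lemma st_stack_closed: "s \<in> lists L \<Longrightarrow> stack_tensor s \<in> carrier TA"
  by (intro simple_tensor_closed stack_fam_closed)

text \<open>All \<open>P_k(n)\<close> with positive \<open>n\<close> give the same value on the
  empty stack, so their differences vanish. Colour 1 survives because of the convention
  \<open>P_k(0) = 0\<close>.\<close>

lemma replica_empty_stack:
  assumes Y: "Y \<in> carrier TA" and k: "k \<in> I" "b \<in> C k"
  shows "TF (Y \<cdot> (replica I A k b j \<cdot> stack_tensor [])) =
    (if j = 1 then TF (Y \<cdot> stack_tensor [(k, b)]) else 0)"
proof -
  let ?V = "stack_tensor []" and ?Z = "Y \<cdot> iota I A k j b"
  have V: "?V \<in> carrier TA" and Z: "?Z \<in> carrier TA" and io: "iota I A k j b \<in> carrier TA"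
    using Y k by (auto intro: st_stack_closed iota_closed simp del: stack_fam.simps)
  have assoc: "Y \<cdot> (replica I A k b j \<cdot> ?V) = ?Z \<cdot> (p_tensor I A k j \<cdot> ?V)"
    unfolding replica_def using Y V io p_tensor_closed by (simp only: TA.m_assoc TA.m_closed)
  have P: "TF (?Z \<cdot> (P_op k n \<cdot> ?V)) = (if n = 0 then 0 else TF (?Z \<cdot> ?V))" for n
    using P_centred[OF Z Nil_stacks(2), of n k] TF_P_zero[OF Z V] by (cases "n = 0") simp_all
  have "TF (?Z \<cdot> ?V) = TF (Y \<cdot> stack_tensor [(k, b)])" if "j = 1"
    using iota_stack_push[OF k, of "[]"] Y V io that by (simp add: TA.m_assoc del: stack_fam.simps)
  then show ?thesis
    unfolding assoc TF_minus_stack[OF Z V] P by auto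
qed

text \<open>As a function of \<open>n\<close>, the value of \<open>P_k(n)\<close> on the stack is 0
  at first, then \<phi>(a) times the value without the top, and from
  \<open>Suc (Suc (length s))\<close> on the value of the whole stack. The middle range starts at
  \<open>length s\<close> if the letter under the top has label \<open>k\<close>, and one later
  otherwise. Colour \<open>j\<close> sees the difference between \<open>n = j\<close> and
  \<open>n = j - 1\<close>.\<close>

lemma replica_stack:
  assumes Y: "Y \<in> carrier TA" and s: "(i, a) # s \<in> stacks" and k: "k \<in> I" "b \<in> C k" and ki: "k \<noteq> i"
  shows "TF (Y \<cdot> (replica I A k b j \<cdot> stack_tensor ((i, a) # s))) =
    (if j = Suc (Suc (length s)) then TF (Y \<cdot> stack_tensor ((k, b) # (i, ctr i a) # s))
     else if j = Suc (length s) then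
       (if s \<noteq> [] \<and> fst (hd s) = k then 0 else \<phi> i a * TF (Y \<cdot> stack_tensor ((k, b) # s)))
     else if j = length s \<and> s \<noteq> [] \<and> fst (hd s) = k then
       \<phi> i a * TF (Y \<cdot> stack_tensor ((k, b \<otimes>\<^bsub>A k\<^esub> snd (hd s)) # tl s))
     else 0)"
proof -
  let ?V = "stack_tensor ((i, a) # s)" and ?W = "stack_tensor s" and ?Z = "Y \<cdot> iota I A k j b"
  let ?C = "stack_tensor ((i, ctr i a) # s)"
  have ia: "i \<in> I" "a \<in> C i" and sc: "s \<in> centred_words"
    using s by (auto simp: Cons_stacks_iff)
  have sL: "s \<in> lists L" "(i, a) # s \<in> lists L" "(i, ctr i a) # s \<in> lists L"
    using stacks_lists[OF s] ia by (auto simp: letter_iff ctr_closed)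
  have closed: "?V \<in> carrier TA" "?W \<in> carrier TA" "?C \<in> carrier TA" "?Z \<in> carrier TA" "iota I A k j b \<in> carrier TA"
    using Y k by (simp_all only: st_stack_closed sL iota_closed TA.m_closed)
  note Z = closed(4)
  have assoc: "Y \<cdot> (replica I A k b j \<cdot> ?V) = ?Z \<cdot> (p_tensor I A k j \<cdot> ?V)"
    unfolding replica_def using Y closed p_tensor_closed by (simp only: TA.m_assoc TA.m_closed)
  \<comment> \<open>The clause for \<open>n = 0\<close> also shields the comparison with
    \<open>hd s\<close> when \<open>s\<close> is empty.\<close>
  have P: "TF (?Z \<cdot> (P_op k n \<cdot> ?V)) =
      (if n = 0 then 0 else if Suc (length s) < n then TF (?Z \<cdot> ?V)
       else \<phi> i a * (if length s < n \<or> length s = n \<and> fst (hd s) = k then TF (?Z \<cdot> ?W) else 0))" for n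
    using P_stack[OF Z s _ ki, of n] TF_P_zero[OF Z closed(1)] by (cases "n = 0") (simp_all del: stack_fam.simps)
  \<comment> \<open>The last jump is the whole stack minus its scalar part, that is, the stack with
    centred top.\<close>
  have V: "TF (?Z \<cdot> ?V) = TF (?Z \<cdot> ?C) + \<phi> i a * TF (?Z \<cdot> ?W)"
  proof -
    have "?Z \<cdot> ?V = 1 \<odot>\<^bsub>TA\<^esub> (?Z \<cdot> ?C) \<oplus>\<^bsub>TA\<^esub> \<phi> i a \<odot>\<^bsub>TA\<^esub> (?Z \<cdot> ?W)"
      unfolding stack_center[OF sL(2)] using closed by (simp only: TA.r_distr TA.smult_mult_right TA.smult_closed)
    then show ?thesis
      using linear_functional_lincomb[OF TF_props(1) TA.complex_algebra, of "?Z \<cdot> ?C" "?Z \<cdot> ?W" 1 "\<phi> i a"]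
        closed by (simp del: stack_fam.simps)
  qed
  have push2: "TF (?Z \<cdot> ?C) = TF (Y \<cdot> stack_tensor ((k, b) # (i, ctr i a) # s))"
    if "j = Suc (Suc (length s))"
    using iota_stack_push[OF k sL(3)] Y closed that by (simp add: TA.m_assoc del: stack_fam.simps)
  have push1: "TF (?Z \<cdot> ?W) = TF (Y \<cdot> stack_tensor ((k, b) # s))" if "j = Suc (length s)"
    using iota_stack_push[OF k sL(1)] Y closed that by (simp add: TA.m_assoc del: stack_fam.simps)
  have mult: "TF (?Z \<cdot> ?W) = TF (Y \<cdot> stack_tensor ((k, b \<otimes>\<^bsub>A k\<^esub> snd (hd s)) # tl s))"
    if top: "j = length s" "s \<noteq> []" "fst (hd s) = k"
  proof -
    obtain c s' where s': "s = (k, c) # s'"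
      using top by (cases s) auto
    have "?Z \<cdot> ?W = Y \<cdot> (iota I A k j b \<cdot> ?W)"
      using Y closed by (simp add: TA.m_assoc del: stack_fam.simps)
    also have "iota I A k j b \<cdot> ?W = stack_tensor ((k, b \<otimes>\<^bsub>A k\<^esub> snd (hd s)) # tl s)"
      using iota_stack_multiply[OF k, of c s'] sL(1) top(1) unfolding s' by (simp del: stack_fam.simps)
    finally show ?thesis
      by simp
  qed
  have main: "TF (Y \<cdot> (replica I A k b j \<cdot> ?V)) =
      (if j = 0 then 0 else if Suc (length s) < j then TF (?Z \<cdot> ?V)
       else \<phi> i a * (if length s < j \<or> length s = j \<and> fst (hd s) = k then TF (?Z \<cdot> ?W) else 0)) -
      (if j - 1 = 0 then 0 else if Suc (length s) < j - 1 then TF (?Z \<cdot> ?V)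
       else \<phi> i a * (if length s < j - 1 \<or> length s = j - 1 \<and> fst (hd s) = k then TF (?Z \<cdot> ?W) else 0))"
    unfolding assoc TF_minus_stack[OF Z closed(1)] P ..
  have "j = Suc (Suc n) \<or> j = Suc n \<or> j = n \<and> n \<noteq> 0 \<or> j = 0 \<or> Suc (Suc n) < j \<or> 1 \<le> j \<and> j < n" for n
    by linarith
  then consider "j = Suc (Suc (length s))" | "j = Suc (length s)" | "j = length s" "s \<noteq> []"
    | "j = 0" | "Suc (Suc (length s)) < j" | "1 \<le> j" "j < length s"
    by (metis length_0_conv)
  then show ?thesis
  proof cases
    case 1
    show ?thesis
      unfolding main push2[OF 1, symmetric] V using 1 by simp
  next
    case 2
    show ?thesis
      unfolding main push1[OF 2, symmetric] using 2 by simp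
  next
    case 3
    show ?thesis
    proof (cases "fst (hd s) = k")
      case True
      show ?thesis
        unfolding main mult[OF 3 True, symmetric] using 3 True by (cases "length s") simp_all
    next
      case False
      show ?thesis
        unfolding main using 3 False by (cases "length s") simp_all
    qed
  next
    case 4
    show ?thesis
      unfolding main using 4 by auto
  next
    case 5
    show ?thesis
      unfolding main using 5 by (cases j) auto
  next
    case 6
    show ?thesis
      unfolding main using 6 by (cases j) auto
  qed
qed

section \<open>Summation over colours\<close>

abbreviation replicas :: "('i \<times> 'a) list \<Rightarrow> nat list \<Rightarrow> ('i, 'a) tensor list" where
  "replicas u w \<equiv> map2 (\<lambda>(i, a) j. replica I A i a j) u w"

lemma replicas_closed: "u \<in> lists L \<Longrightarrow> set (replicas u w) \<subseteq> carrier TA"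
  by (auto simp: replica_closed letter_iff dest!: set_zip_leftD)

text \<open>Both lists are reversed to follow the reading order of \<open>free_eval\<close>: the
  head belongs to the replica next to the stack, and the others form the left factor
  \<open>Y\<close>.\<close>

definition replica_val :: "('i \<times> 'a) list \<Rightarrow> nat list \<Rightarrow> ('i \<times> 'a) list \<Rightarrow> complex" where
  "replica_val u w s = TF (list_prod TA (replicas (rev u) (rev w)) \<cdot> stack_tensor s)"

lemma replica_val_Cons:
  assumes u: "u \<in> lists L" and k: "k \<in> I" "b \<in> C k" and s: "s \<in> lists L" and len: "length u = length w"
  shows "replica_val ((k, b) # u) (j # w) s =
    TF (list_prod TA (replicas (rev u) (rev w)) \<cdot> (replica I A k b j \<cdot> stack_tensor s))"
proof -
  have closed: "set (replicas (rev u) (rev w)) \<subseteq> carrier TA"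
    using u by (intro replicas_closed) (simp add: lists_eq_set)
  have "list_prod TA (replicas (rev ((k, b) # u)) (rev (j # w))) =
      list_prod TA (replicas (rev u) (rev w)) \<cdot> replica I A k b j"
    using TA.list_prod_append[OF closed, of "[replica I A k b j]"] replica_closed[OF k] len by simp
  then show ?thesis
    unfolding replica_val_def
    using TA.m_assoc[OF TA.list_prod_closed[OF closed] replica_closed[OF k] st_stack_closed[OF s]] by simp
qed

lemma replica_val_empty_stack:
  assumes u: "u \<in> lists L" and k: "k \<in> I" "b \<in> C k" and len: "length u = length w"
  shows "replica_val ((k, b) # u) (j # w) [] = (if j = 1 then replica_val u w [(k, b)] else 0)"
proof -
  have closed: "list_prod TA (replicas (rev u) (rev w)) \<in> carrier TA"
    using u by (intro TA.list_prod_closed replicas_closed) (simp add: lists_eq_set)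
  show ?thesis
    unfolding replica_val_Cons[OF u k lists.Nil len] replica_empty_stack[OF closed k]
    by (simp only: replica_val_def)
qed

lemma replica_val_stack:
  assumes u: "u \<in> lists L" and k: "k \<in> I" "b \<in> C k" and len: "length u = length w"
    and s: "(i, a) # s \<in> stacks" and ki: "k \<noteq> i"
  shows "replica_val ((k, b) # u) (j # w) ((i, a) # s) =
    (if j = Suc (Suc (length s)) then replica_val u w ((k, b) # (i, ctr i a) # s)
     else if j = Suc (length s) then
       (if s \<noteq> [] \<and> fst (hd s) = k then 0 else \<phi> i a * replica_val u w ((k, b) # s))
     else if j = length s \<and> s \<noteq> [] \<and> fst (hd s) = k then
       \<phi> i a * replica_val u w ((k, b \<otimes>\<^bsub>A k\<^esub> snd (hd s)) # tl s)
     else 0)"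
proof -
  have closed: "list_prod TA (replicas (rev u) (rev w)) \<in> carrier TA"
    using u by (intro TA.list_prod_closed replicas_closed) (simp add: lists_eq_set)
  show ?thesis
    unfolding replica_val_Cons[OF u k stacks_lists[OF s] len] replica_stack[OF closed s k ki]
    by (simp only: replica_val_def)
qed

text \<open>Both sides are the product of \<phi> over the letters, which is zero from height 2 on
  because of the centred letters.\<close>

lemma replica_val_Nil:
  assumes "s \<in> stacks" shows "replica_val [] [] s = free_eval [] s"
proof -
  have "tensor_value (stack_fam s) = (\<Prod>(i, a)\<leftarrow>s. \<phi> i a)" if "s \<in> lists L" for s
    using that
  proof (induction s)
    case Nil
    show ?case
      using val_one by (simp add: tensor_value_def tensor_monoid_one)
  next
    case (Cons t s)
    obtain i a where t: "t = (i, a)"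
      by fastforce
    have ia: "i \<in> I" "a \<in> C i" "s \<in> lists L"
      using Cons.hyps t by (auto simp: letter_iff)
    have site: "(i, Suc (length s)) \<in> sites I"
      using ia by (simp add: site_iff)
    have "tensor_value (stack_fam ((i, a) # s)) = val (i, Suc (length s)) (ext_emb (A i) a) *
        tensor_value ((stack_fam s)((i, Suc (length s)) := \<one>\<^bsub>ext (i, Suc (length s))\<^esub>))"
      unfolding stack_fam.simps by (rule tensor_value_upd[OF stack_fam_closed[OF ia(3)] site])
    also have "\<dots> = \<phi> i a * (\<Prod>(i, a)\<leftarrow>s. \<phi> i a)"
      unfolding fst_conv stack_fam_upd_above[OF ia(3) site lessI]
        nc_space.ext_functional_emb[OF nc_space[OF ia(1)] ia(2)] Cons.IH ..
    finally show ?case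
      unfolding t by (simp del: stack_fam.simps)
  qed
  moreover have "free_eval [] s = (\<Prod>(i, a)\<leftarrow>s. \<phi> i a)"
    using assms by (cases s rule: remdups_adj.cases) (auto simp: Cons_stacks_iff Cons_centred_iff)
  ultimately show ?thesis
    using stacks_lists[OF assms] st_stack_closed[OF stacks_lists[OF assms]]
    by (simp add: replica_val_def TF_props(2) stack_fam_closed)
qed

definition colourings :: "nat \<Rightarrow> nat \<Rightarrow> nat list set" where
  "colourings N n = {w. set w \<subseteq> {1..N} \<and> length w = n}"

lemma finite_colourings: "finite (colourings N n)"
  unfolding colourings_def by (rule finite_lists_length_eq) simp

lemma colourings_0: "colourings N 0 = {[]}"
  by (auto simp: colourings_def)

lemma sum_colourings_Suc: "(\<Sum>w\<in>colourings N (Suc n). f w) = (\<Sum>j\<in>{1..N}. \<Sum>w\<in>colourings N n. f (j # w))"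
proof -
  have "(\<Sum>w\<in>colourings N (Suc n). f w) = (\<Sum>(j, w)\<in>{1..N} \<times> colourings N n. f (j # w))"
    by (rule sum.reindex_bij_witness[of _ "\<lambda>(j, w). j # w" "\<lambda>w. (hd w, tl w)"])
       (auto simp: colourings_def length_Suc_conv dest: list.set_sel(2))
  then show ?thesis
    by (simp add: sum.cartesian_product)
qed

text \<open>Summing over the colour read first leaves the pushed stack and one of two popped ones,
  chosen by whether the new letter meets its own label; these are the summands of the recursion. A
  letter raises the height by at most one, so word and stack together never get longer, and
  \<open>N\<close> bounds all colours that contribute.\<close>

lemma sum_replica_val:
  assumes "u \<in> lists L" "s \<in> stacks" "distinct_adj (map fst (rev u @ s))" "length u + length s \<le> N"
  shows "(\<Sum>w\<in>colourings N (length u). replica_val u w s) = free_eval u s"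
  using assms
proof (induction u arbitrary: s)
  case Nil
  then show ?case
    by (simp add: colourings_0 replica_val_Nil)
next
  case (Cons z u)
  obtain k b where z: "z = (k, b)"
    by fastforce
  have k: "k \<in> I" "b \<in> C k"
    using Cons.hyps z by (auto simp: letter_iff)
  note u = \<open>u \<in> lists L\<close>
  have len: "length u = length w" if "w \<in> colourings N (length u)" for w
    using that by (simp add: colourings_def)
  show ?case
  proof (cases s)
    case Nil
    have "(\<Sum>w\<in>colourings N (length u). replica_val (z # u) (j # w) []) =
        (if j = 1 then free_eval u [(k, b)] else 0)" for j
      using Cons.IH[of "[(k, b)]"] Cons.prems Nil z k
      by (simp add: replica_val_empty_stack[OF u k len] Cons_stacks_iff)
    then show ?thesis
      using Cons.prems Nil z by (simp add: sum_colourings_Suc)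
  next
    case (Cons t s')
    obtain i a where t: "t = (i, a)"
      by fastforce
    have stack: "(i, a) # s' \<in> stacks"
      using Cons.prems Cons t by simp
    have ki: "k \<noteq> i"
      using Cons.prems(2) z t Cons by (simp add: distinct_adj_append_iff)
    have ia: "i \<in> I" "a \<in> C i" and s': "s' \<in> centred_words" "s' = [] \<or> i \<noteq> fst (hd s')"
      using stack by (auto simp: Cons_stacks_iff)
    have adj: "distinct_adj (map fst (rev u @ [z]))"
      using Cons.prems(2) by (simp add: distinct_adj_append_iff split: if_splits)
    \<comment> \<open>\<open>c\<close> says that popping the top exposes a letter with the label of
      the one being read.\<close>
    define c where "c \<longleftrightarrow> s' \<noteq> [] \<and> fst (hd s') = k"
    have push2: "(\<Sum>w\<in>colourings N (length u). replica_val u w ((k, b) # (i, ctr i a) # s')) =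
        free_eval u ((k, b) # (i, ctr i a) # s')"
    proof (rule Cons.IH)
      show "(k, b) # (i, ctr i a) # s' \<in> stacks"
        using push_stacks[OF stack] k ki by (simp add: letter_iff)
      then show "distinct_adj (map fst (rev u @ (k, b) # (i, ctr i a) # s'))"
        using adj z by (auto simp: distinct_adj_append_iff stacks_def words_iff)
    qed (use Cons.prems Cons in simp)
    have push1: "(\<Sum>w\<in>colourings N (length u). replica_val u w ((k, b) # s')) = free_eval u ((k, b) # s')"
      if "\<not> c"
    proof (rule Cons.IH)
      show "(k, b) # s' \<in> stacks"
        using k s' that by (auto simp: Cons_stacks_iff c_def)
      then show "distinct_adj (map fst (rev u @ (k, b) # s'))"
        using adj z by (auto simp: distinct_adj_append_iff stacks_def words_iff)
    qed (use Cons.prems Cons in simp)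
    have mult: "(\<Sum>w\<in>colourings N (length u). replica_val u w ((k, b \<otimes>\<^bsub>A k\<^esub> snd (hd s')) # tl s')) =
        free_eval u ((k, b \<otimes>\<^bsub>A k\<^esub> snd (hd s')) # tl s')" if "c"
    proof (rule Cons.IH)
      show "(k, b \<otimes>\<^bsub>A k\<^esub> snd (hd s')) # tl s' \<in> stacks"
        using k s' that unfolding c_def
        by (cases s') (auto simp: Cons_stacks_iff Cons_centred_iff mult_component)
      then show "distinct_adj (map fst (rev u @ (k, b \<otimes>\<^bsub>A k\<^esub> snd (hd s')) # tl s'))"
        using adj z by (auto simp: distinct_adj_append_iff stacks_def words_iff)
    qed (use Cons.prems Cons in simp)
    have inner: "(\<Sum>w\<in>colourings N (length u). replica_val (z # u) (j # w) s) =
        (if j = Suc (Suc (length s')) then free_eval u ((k, b) # (i, ctr i a) # s') else 0) +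
        (if j = Suc (length s') then (if c then 0 else \<phi> i a * free_eval u ((k, b) # s')) else 0) +
        (if j = length s' then (if c then \<phi> i a * free_eval u ((k, b \<otimes>\<^bsub>A k\<^esub> snd (hd s')) # tl s') else 0) else 0)" for j
    proof -
      have "(\<Sum>w\<in>colourings N (length u). replica_val (z # u) (j # w) s) =
          (\<Sum>w\<in>colourings N (length u).
            (if j = Suc (Suc (length s')) then replica_val u w ((k, b) # (i, ctr i a) # s')
             else if j = Suc (length s') then
               (if c then 0 else \<phi> i a * replica_val u w ((k, b) # s'))
             else if j = length s' \<and> c then
               \<phi> i a * replica_val u w ((k, b \<otimes>\<^bsub>A k\<^esub> snd (hd s')) # tl s')
             else 0))"
        unfolding Cons t z c_def conj_assoc
        by (rule sum.cong) (simp_all only: replica_val_stack[OF u k len stack ki])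
      then show ?thesis
        using push2 push1 mult by (auto simp flip: sum_distrib_left)
    qed
    \<comment> \<open>Colour 0 is outside the range, but merging presupposes a nonempty
      \<open>s'\<close>.\<close>
    have "length s' \<in> {1..N}" if "c"
      using that Cons.prems Cons by (cases s') (auto simp: c_def)
    then have "(\<Sum>w\<in>colourings N (length (z # u)). replica_val (z # u) w s) =
        free_eval u ((k, b) # (i, ctr i a) # s') +
        (if c then \<phi> i a * free_eval u ((k, b \<otimes>\<^bsub>A k\<^esub> snd (hd s')) # tl s')
         else \<phi> i a * free_eval u ((k, b) # s'))"
      unfolding length_Cons sum_colourings_Suc inner using Cons.prems Cons by (simp add: sum.distrib)
    \<comment> \<open>A letter exposed by popping is centred, so one step of
      \<open>free_eval\<close> on \<open>s'\<close> has a single nonzero term: merging if the labels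
      agree, pushing otherwise.\<close>
    also have "(if c then \<phi> i a * free_eval u ((k, b \<otimes>\<^bsub>A k\<^esub> snd (hd s')) # tl s')
         else \<phi> i a * free_eval u ((k, b) # s')) = \<phi> i a * free_eval ((k, b) # u) s'"
    proof (cases s')
      case Nil
      then show ?thesis
        by (simp add: c_def)
    next
      case (Cons r s'')
      obtain l d where r: "r = (l, d)"
        by fastforce
      have ld: "l \<in> I" "d \<in> C l" "\<phi> l d = 0"
        using s' Cons r by (auto simp: Cons_centred_iff)
      interpret Al: nc_space "A l" "\<phi> l"
        using ld(1) by (rule nc_space)
      have "ctr l d = d"
        using ld by (simp add: Al.center_def)
      then show ?thesis
        using Cons r ld by (auto simp: c_def)
    qed
    finally show ?thesis
      using ki t z Cons by simp
  qed
qed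

text \<open>The colour used in a step is the height of the stack after this step; \<open>m\<close> is the initial height.\<close>

fun descent :: "nat \<Rightarrow> nat list \<Rightarrow> bool" where
  "descent m [] \<longleftrightarrow> m \<le> 1"
| "descent m (j # w) \<longleftrightarrow> 1 \<le> j \<and> j \<le> Suc m \<and> m \<le> Suc j \<and> descent j w"

text \<open>Each surviving case of \<open>replica_val_stack\<close> is a step of
  \<open>descent\<close>; when the word is exhausted, a nonzero value leaves room for at most one
  letter on the stack.\<close>

lemma replica_val_nonzero:
  assumes "u \<in> lists L" "s \<in> stacks" "distinct_adj (map fst (rev u @ s))" "length u = length w"
    and "replica_val u w s \<noteq> 0"
  shows "descent (length s) w"
  using assms
proof (induction u arbitrary: s w)
  case Nil
  then have "free_eval [] s \<noteq> 0"
    by (simp add: replica_val_Nil)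
  then show ?case
    using Nil.prems by (cases s rule: remdups_adj.cases) auto
next
  case (Cons z u)
  obtain k b where z: "z = (k, b)"
    by fastforce
  have k: "k \<in> I" "b \<in> C k"
    using Cons.hyps z by (auto simp: letter_iff)
  note u = \<open>u \<in> lists L\<close>
  obtain j w' where w: "w = j # w'" and len: "length u = length w'"
    using Cons.prems by (cases w) auto
  show ?case
  proof (cases s)
    case Nil
    have "j = 1" "replica_val u w' [(k, b)] \<noteq> 0"
      using Cons.prems(4) unfolding w z Nil replica_val_empty_stack[OF u k len] by (auto split: if_splits)
    then show ?thesis
      using Cons.IH[of "[(k, b)]" w'] Cons.prems Nil z w k len by (simp add: Cons_stacks_iff)
  next
    case (Cons t s')
    obtain i a where t: "t = (i, a)"
      by fastforce
    have stack: "(i, a) # s' \<in> stacks"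
      using Cons.prems Cons t by simp
    have ki: "k \<noteq> i"
      using Cons.prems(2) z t Cons by (simp add: distinct_adj_append_iff)
    have s': "s' \<in> centred_words"
      using stack by (auto simp: Cons_stacks_iff)
    have adj: "distinct_adj (map fst (rev u @ (k, e) # v))" if "(k, e) # v \<in> stacks" for e v
      using that Cons.prems(2) z by (auto simp: distinct_adj_append_iff stacks_def words_iff split: if_splits)
    have IH: "descent (Suc (length v)) w'" if "(k, e) # v \<in> stacks" "replica_val u w' ((k, e) # v) \<noteq> 0" for e v
      using Cons.IH[OF that(1) adj[OF that(1)] len that(2)] by simp
    note nz = Cons.prems(4)[unfolded w z Cons t replica_val_stack[OF u k len stack ki]]
    consider (up) "j = Suc (Suc (length s'))" "replica_val u w' ((k, b) # (i, ctr i a) # s') \<noteq> 0"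
      | (level) "j = Suc (length s')" "\<not> (s' \<noteq> [] \<and> fst (hd s') = k)" "replica_val u w' ((k, b) # s') \<noteq> 0"
      | (down) "j = length s'" "s' \<noteq> []" "fst (hd s') = k"
          "replica_val u w' ((k, b \<otimes>\<^bsub>A k\<^esub> snd (hd s')) # tl s') \<noteq> 0"
      using nz by (auto split: if_splits)
    then show ?thesis
    proof cases
      case up
      then show ?thesis
        using IH[OF push_stacks[OF stack, of k b] up(2)] k ki w Cons by (simp add: letter_iff)
    next
      case level
      have "(k, b) # s' \<in> stacks"
        using k s' level by (auto simp: Cons_stacks_iff)
      then show ?thesis
        using IH[OF _ level(3)] level(1) w Cons by simp
    next
      case down
      have "(k, b \<otimes>\<^bsub>A k\<^esub> snd (hd s')) # tl s' \<in> stacks"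
        using k s' down by (cases s') (auto simp: Cons_stacks_iff Cons_centred_iff mult_component)
      then show ?thesis
        using IH[OF _ down(4)] down(1,2) w Cons by (cases s') auto
    qed
  qed
qed

lemma descent_bounds: "descent m w \<Longrightarrow> set w \<subseteq> {1..m + length w}"
  by (induction m w rule: descent.induct) fastforce+

lemma descent_successively:
  "descent m w \<Longrightarrow> successively (\<lambda>x y. \<bar>int y - int x\<bar> \<in> {0, 1}) (m # w) \<and> last (m # w) \<le> 1"
  by (induction m w rule: descent.induct) auto

text \<open>Height 0 before the first colour and at most 1 after the last one, with all colours
  positive, force both ends to be 1. Reversal is harmless because the step condition is
  symmetric.\<close>

lemma descent_motzkin:
  assumes "descent 0 (rev w)" "w \<noteq> []"
  shows "w \<in> motzkin_words"
proof -
  have ge: "\<forall>j\<in>set w. 1 \<le> j"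
    using descent_bounds[OF assms(1)] by auto
  have "rev w \<noteq> []"
    using assms by simp
  then obtain j v where v: "rev w = j # v"
    by (cases "rev w") auto
  have "j \<le> 1"
    using assms(1) v by simp
  moreover have "last w = j"
    using v by (metis hd_rev list.sel(1))
  ultimately have last: "last w = 1"
    using ge last_in_set[OF assms(2)] by fastforce
  have *: "successively (\<lambda>x y. \<bar>int y - int x\<bar> \<in> {0, 1}) (rev w)" "last (rev w) \<le> 1"
    using descent_successively[OF assms(1)] v by (auto simp: successively_Cons)
  have hd: "hd w = 1"
    using *(2) ge hd_in_set[OF assms(2)] assms(2) by (fastforce simp: last_rev)
  have "successively (\<lambda>x y. \<bar>int x - int y\<bar> \<in> {0, 1}) w"
    using *(1) by simp
  then have "\<bar>int (w ! Suc k) - int (w ! k)\<bar> \<in> {0, 1}" if "Suc k < length w" for k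
    using successively_nth[of _ w k] that by (simp add: abs_minus_commute)
  then show ?thesis
    unfolding motzkin_words_def using ge last hd assms(2) by blast
qed

text \<open>At height 1 a letter of colour 1 replaces the top, whose expectation leaves as a
  factor.\<close>

lemma replica_val_boolean:
  assumes "u \<in> lists L" "(i, a) \<in> L" "distinct_adj (map fst (rev u @ [(i, a)]))"
  shows "replica_val u (replicate (length u) 1) [(i, a)] = \<phi> i a * (\<Prod>(i, a)\<leftarrow>u. \<phi> i a)"
  using assms
proof (induction u arbitrary: i a)
  case Nil
  then show ?case
    by (simp add: replica_val_Nil Cons_stacks_iff letter_iff)
next
  case (Cons z u)
  obtain k b where z: "z = (k, b)"
    by fastforce
  have k: "k \<in> I" "b \<in> C k"
    using Cons.hyps z by (auto simp: letter_iff)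
  have "k \<noteq> i" "distinct_adj (map fst (rev u @ [(k, b)]))"
    using Cons.prems z by (simp_all add: distinct_adj_append_iff)
  then show ?case
    using Cons k z replica_val_stack[OF Cons.hyps(2) k, of "replicate (length u) 1" i a "[]" 1]
    by (simp add: Cons_stacks_iff letter_iff)
qed


section \<open>The linear Motzkin functionals on alternating words\<close>

lemma list_prod_replicas_closed:
  assumes "u \<in> lists L" "\<forall>j\<in>set w. 1 \<le> j"
  shows "list_prod TA (replicas u w) \<in> replica_algebra I A"
  unfolding replica_algebra_def generated_subalgebra_def
proof (rule InterI, elim CollectE conjE)
  fix B assume B: "unital_subalgebra B TA"
    "{replica I A i a j |i a j. i \<in> I \<and> a \<in> C i \<and> 1 \<le> j} \<subseteq> B"
  show "list_prod TA (replicas u w) \<in> B"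
    using assms
  proof (induction u arbitrary: w)
    case Nil
    then show ?case
      using B(1) by (simp add: unital_subalgebra_def)
  next
    case (Cons x u)
    show ?case
    proof (cases w)
      case Nil
      then show ?thesis
        using B(1) by (simp add: unital_subalgebra_def)
    next
      case (Cons j w')
      obtain i a where x: "x = (i, a)"
        by fastforce
      have "replica I A i a j \<in> B"
        using B(2) Cons.hyps Cons.prems x \<open>w = j # w'\<close> by (auto simp: letter_iff)
      moreover have "list_prod TA (replicas u w') \<in> B"
        using Cons.IH[of w'] Cons.prems \<open>w = j # w'\<close> by simp
      ultimately show ?thesis
        using B(1) x Cons by (simp add: unital_subalgebra_def)
    qed
  qed
qed

lemma replica_lincomb:
  assumes i: "i \<in> I" "1 \<le> j" "a \<in> C i" "b \<in> C i"
  shows "replica I A i (\<alpha> \<odot>\<^bsub>A i\<^esub> a \<oplus>\<^bsub>A i\<^esub> \<beta> \<odot>\<^bsub>A i\<^esub> b) j =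
    \<alpha> \<odot>\<^bsub>TA\<^esub> replica I A i a j \<oplus>\<^bsub>TA\<^esub> \<beta> \<odot>\<^bsub>TA\<^esub> replica I A i b j"
  unfolding replica_def iota_lincomb[OF i]
  using i by (simp add: TA.l_distr TA.smult_mult_left iota_closed p_tensor_closed)

text \<open>With the colours fixed, a letter enters the product only through one entry of one simple
  tensor. This makes the values prescribed for a Motzkin functional consistent.\<close>

lemma replicas_multilinear:
  assumes w: "\<forall>j\<in>set w. 1 \<le> j" and len: "length p + Suc (length q) = length w"
    and pq: "p \<in> lists L" "q \<in> lists L" and i: "i \<in> I" and ab: "a \<in> C i" "b \<in> C i"
  shows "TF (list_prod TA (replicas (p @ (i, \<alpha> \<odot>\<^bsub>A i\<^esub> a \<oplus>\<^bsub>A i\<^esub> \<beta> \<odot>\<^bsub>A i\<^esub> b) # q) w)) =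
    \<alpha> * TF (list_prod TA (replicas (p @ (i, a) # q) w)) + \<beta> * TF (list_prod TA (replicas (p @ (i, b) # q) w))"
proof -
  obtain v j v' where v: "w = v @ j # v'" "length v = length p"
    using len id_take_nth_drop[of "length p" w] by (metis add_Suc_right length_take less_add_Suc1 min.absorb4)
  let ?u = "list_prod TA (replicas p v)" and ?v = "list_prod TA (replicas q v')"
  have j: "1 \<le> j"
    using w v by simp
  have closed: "?u \<in> carrier TA" "?v \<in> carrier TA"
    by (rule TA.list_prod_closed, rule replicas_closed, rule pq)+
  have split: "list_prod TA (replicas (p @ (i, c) # q) w) = ?u \<cdot> replica I A i c j \<cdot> ?v"
    if "c \<in> C i" for c
  proof -
    have "list_prod TA (replicas (p @ (i, c) # q) w) = list_prod TA (replicas p v @ replica I A i c j # replicas q v')"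
      using v by simp
    also have "\<dots> = ?u \<cdot> (replica I A i c j \<cdot> ?v)"
      using TA.list_prod_append[OF replicas_closed[OF pq(1)], of "replica I A i c j # replicas q v'" v]
        replicas_closed[OF pq(2), of v'] replica_closed[OF i that, of j] by simp
    finally show ?thesis
      using closed replica_closed[OF i that] by (simp add: TA.m_assoc)
  qed
  show ?thesis
    unfolding split[OF lincomb_closed[OF i ab]] split[OF ab(1)] split[OF ab(2)] replica_lincomb[OF i j ab]
      TA.mult_lincomb[OF replica_closed[OF i ab(1)] replica_closed[OF i ab(2)] closed]
    using closed replica_closed[OF i ab(1)] replica_closed[OF i ab(2)]
    by (intro linear_functional_lincomb[OF TF_props(1) TA.complex_algebra] TA.m_closed)
qed

lemma motzkin_functional_props:
  assumes w: "\<forall>j\<in>set w. 1 \<le> j"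
  shows "linear_functional FS (\<psi> w)"
    and "\<And>u. u \<in> W \<Longrightarrow> \<psi> w (N.cls u) =
      (if length u = length w then replica_val (rev u) (rev w) [] else 0)"
proof -
  define h where "h u = (if length u = length w then TF (list_prod TA (replicas u w)) else 0)" for u
  let ?h = "\<lambda>u. if length u \<noteq> length w then 0 else if w = [] then 1
      else replica_functional I A \<phi> (list_prod TA (replicas u w))"
  \<comment> \<open>\<open>replica_functional\<close> is \<open>undefined\<close> off the replica
    algebra; products of replicas lie inside, where it agrees with \<open>TF\<close>. For the empty
    word the product is the unit, of value 1.\<close>
  have h: "h u = ?h u" if "u \<in> lists L" for u
    using list_prod_replicas_closed[OF that w] replica_val_Nil[OF Nil_stacks(1)]
      TF_props(2)[OF tensor_monoid_one_closed]
    by (auto simp: h_def replica_functional_def replica_val_def simple_tensor_one)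
  have "multilinear_on_words h"
    unfolding multilinear_on_words_def h_def words_iff
    using replicas_multilinear[OF w] by (auto simp del: lists_eq_set)
  from sep_functional_exists[OF this]
  obtain f where f: "linear_functional FS f" "\<And>u. u \<in> W \<Longrightarrow> f (N.cls u) = h u"
    by blast
  have W: "\<And>u. u \<in> W \<Longrightarrow> u \<in> lists L"
    by (simp add: words_iff)
  have "\<psi> w = restrict f (carrier FS)"
    unfolding motzkin_functional_def
  proof (rule the_on_eq)
    show "linear_functional FS (restrict f (carrier FS)) \<and>
      (\<forall>u\<in>W. restrict f (carrier FS) (word_sep I A u) = ?h u)"
      using FS.linear_functional_restrict[OF f(1)] f(2) h[OF W]
      by (simp add: W word_sep_eq N_cls_closed)
  next
    fix g x
    assume g: "linear_functional FS g \<and>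
      (\<forall>u\<in>W. g (word_sep I A u) = ?h u)" and x: "x \<in> carrier FS"
    have words: "g (N.cls u) = f (N.cls u)" if "u \<in> W" for u
    proof -
      have "g (word_sep I A u) = h u"
        unfolding h[OF W[OF that]] using g that by blast
      then show ?thesis
        by (simp only: word_sep_eq[OF W[OF that]] f(2)[OF that])
    qed
    show "g x = f x"
      using g by (intro sep_functional_eqI[of g f x] f(1) words x) simp_all
  qed
  moreover have "h u = (if length u = length w then replica_val (rev u) (rev w) [] else 0)" if "u \<in> W" for u
    using TA.list_prod_closed[OF replicas_closed[OF W[OF that], of w]]
    by (simp add: h_def replica_val_def simple_tensor_one)
  ultimately show "linear_functional FS (\<psi> w)"
    "\<And>u. u \<in> W \<Longrightarrow> \<psi> w (N.cls u) =
      (if length u = length w then replica_val (rev u) (rev w) [] else 0)"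
    using FS.linear_functional_restrict[OF f(1)] f(2) W N_cls_closed by simp_all
qed

text \<open>\<open>F\<close> may exceed the support of the summands: the support of a sum can shrink
  by cancellation, whereas the union of the two sets \<open>F\<close> is always admissible. At the
  end \<open>F\<close> is cut down to the support.\<close>

lemma functional_eq_sum:
  assumes f: "linear_functional FS f" and g: "\<And>w. w \<in> S \<Longrightarrow> linear_functional FS (g w)"
    and words: "\<And>u. u \<in> W \<Longrightarrow> \<exists>F. finite F \<and> F \<subseteq> S \<and> (\<forall>w\<in>S - F. g w (N.cls u) = 0) \<and>
      f (N.cls u) = (\<Sum>w\<in>F. g w (N.cls u))"
    and x: "x \<in> carrier FS"
  shows "finite {w \<in> S. g w x \<noteq> 0} \<and> f x = (\<Sum>w | w \<in> S \<and> g w x \<noteq> 0. g w x)"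
proof -
  have "\<exists>F. finite F \<and> F \<subseteq> S \<and> (\<forall>w\<in>S - F. g w x = 0) \<and> f x = (\<Sum>w\<in>F. g w x)"
    using x
  proof (induction x rule: sep_induct)
    case zero
    then show ?case
      using FS.linear_functional_zero[OF f] FS.linear_functional_zero[OF g]
      by (intro exI[of _ "{}"]) simp
  next
    case (word u)
    then show ?case
      by (rule words)
  next
    case (add x y)
    then obtain F H where F: "finite F" "F \<subseteq> S" "\<forall>w\<in>S - F. g w x = 0" "f x = (\<Sum>w\<in>F. g w x)"
      and H: "finite H" "H \<subseteq> S" "\<forall>w\<in>S - H. g w y = 0" "f y = (\<Sum>w\<in>H. g w y)"
      by blast
    have g_add: "g w (x \<oplus>\<^bsub>FS\<^esub> y) = g w x + g w y" if "w \<in> S" for w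
      using g[OF that] add.hyps by (simp add: linear_functional_def)
    have "f (x \<oplus>\<^bsub>FS\<^esub> y) = (\<Sum>w\<in>F. g w x) + (\<Sum>w\<in>H. g w y)"
      using f add.hyps F(4) H(4) by (simp add: linear_functional_def)
    also have "(\<Sum>w\<in>F. g w x) = (\<Sum>w\<in>F \<union> H. g w x)"
      using F H by (intro sum.mono_neutral_left) auto
    also have "(\<Sum>w\<in>H. g w y) = (\<Sum>w\<in>F \<union> H. g w y)"
      using F H by (intro sum.mono_neutral_left) auto
    also have "(\<Sum>w\<in>F \<union> H. g w x) + (\<Sum>w\<in>F \<union> H. g w y) = (\<Sum>w\<in>F \<union> H. g w (x \<oplus>\<^bsub>FS\<^esub> y))"
      unfolding sum.distrib[symmetric] using F(2) H(2) g_add by (intro sum.cong) auto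
    finally show ?case
      using F H g_add by (intro exI[of _ "F \<union> H"]) auto
  next
    case (smult c x)
    then obtain F where F: "finite F" "F \<subseteq> S" "\<forall>w\<in>S - F. g w x = 0" "f x = (\<Sum>w\<in>F. g w x)"
      by blast
    have g_smult: "g w (c \<odot>\<^bsub>FS\<^esub> x) = c * g w x" if "w \<in> S" for w
      using g[OF that] smult.hyps by (simp add: linear_functional_def)
    have "f (c \<odot>\<^bsub>FS\<^esub> x) = (\<Sum>w\<in>F. c * g w x)"
      using f smult.hyps F(4) by (simp add: linear_functional_def sum_distrib_left)
    also have "\<dots> = (\<Sum>w\<in>F. g w (c \<odot>\<^bsub>FS\<^esub> x))"
      using F(2) g_smult by (intro sum.cong) auto
    finally show ?case
      using F g_smult by (intro exI[of _ F]) auto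
  qed
  then obtain F where F: "finite F" "F \<subseteq> S" "\<forall>w\<in>S - F. g w x = 0" "f x = (\<Sum>w\<in>F. g w x)"
    by blast
  have sub: "{w \<in> S. g w x \<noteq> 0} \<subseteq> F"
    using F(3) by blast
  then have "(\<Sum>w\<in>F. g w x) = (\<Sum>w | w \<in> S \<and> g w x \<noteq> 0. g w x)"
    using F(1,2) by (intro sum.mono_neutral_right) auto
  then show ?thesis
    using F(1,4) finite_subset[OF sub] by simp
qed

section \<open>The two expansions over Motzkin words\<close>

lemma motzkin_words_star_pos: "w \<in> motzkin_words_star \<Longrightarrow> \<forall>j\<in>set w. 1 \<le> j"
  by (auto simp: motzkin_words_star_def motzkin_words_def)

lemma boolean_words_star_pos: "w \<in> boolean_words_star \<Longrightarrow> \<forall>j\<in>set w. 1 \<le> j"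
  by (auto simp: boolean_words_star_def)

lemma free_product_motzkin:
  assumes "x \<in> carrier FS"
  shows "finite {w \<in> motzkin_words_star. \<psi> w x \<noteq> 0} \<and>
    free_product_functional I A \<phi> (canonical_hom I A x) =
      (\<Sum>w | w \<in> motzkin_words_star \<and> \<psi> w x \<noteq> 0. \<psi> w x)"
proof (rule functional_eq_sum[OF free_product_functional_canonical_hom(1) _ _ assms])
  fix w assume "w \<in> motzkin_words_star"
  then show "linear_functional FS (\<psi> w)"
    by (intro motzkin_functional_props(1) motzkin_words_star_pos)
next
  fix u assume u: "u \<in> W"
  let ?n = "length u"
  have uL: "u \<in> lists L" "rev u \<in> lists L" and adj: "distinct_adj (map fst (rev (rev u) @ []))"
    using u by (simp_all add: words_iff lists_eq_set)
  have descent: "descent 0 (rev w)" if "length w = ?n" "replica_val (rev u) (rev w) [] \<noteq> 0" for w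
    using replica_val_nonzero[OF uL(2) Nil_stacks(1) adj _ that(2)] that(1) by simp
  have eval_eq: "\<psi> w (N.cls u) = (if ?n = length w then replica_val (rev u) (rev w) [] else 0)"
    if "w \<in> motzkin_words_star" for w
    by (rule motzkin_functional_props(2)[OF motzkin_words_star_pos[OF that] u])
  \<comment> \<open>No stack gets higher than the number of letters read, so colours up to
    \<open>?n\<close> suffice.\<close>
  let ?F = "motzkin_words_star \<inter> colourings ?n ?n"
  show "\<exists>F. finite F \<and> F \<subseteq> motzkin_words_star \<and>
      (\<forall>w\<in>motzkin_words_star - F. \<psi> w (N.cls u) = 0) \<and>
      free_after_hom (N.cls u) = (\<Sum>w\<in>F. \<psi> w (N.cls u))"
  proof (intro exI[of _ ?F] conjI ballI)
    show "finite ?F"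
      using finite_colourings by blast
    fix w assume w: "w \<in> motzkin_words_star - ?F"
    show "\<psi> w (N.cls u) = 0"
    proof (rule ccontr)
      assume "\<psi> w (N.cls u) \<noteq> 0"
      then have "?n = length w" "replica_val (rev u) (rev w) [] \<noteq> 0"
        using w eval_eq[of w] by (auto split: if_splits)
      then have "w \<in> colourings ?n ?n"
        using descent_bounds[OF descent[of w]] by (simp add: colourings_def)
      then show False
        using w by blast
    qed
  next
    have "free_after_hom (N.cls u) = free_eval (rev u) []"
      by (rule free_product_functional_canonical_hom(2)[OF uL(1)])
    also have "\<dots> = (\<Sum>w\<in>colourings ?n ?n. replica_val (rev u) w [])"
      using sum_replica_val[OF uL(2) Nil_stacks(1) adj, of ?n] by simp
    \<comment> \<open>\<open>replica_val\<close> takes its words backwards, and reversal permutes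
      the colourings.\<close>
    also have "\<dots> = (\<Sum>w\<in>colourings ?n ?n. replica_val (rev u) (rev w) [])"
      by (rule sum.reindex_bij_witness[of _ rev rev]) (auto simp: colourings_def)
    also have "\<dots> = (\<Sum>w\<in>?F. replica_val (rev u) (rev w) [])"
    proof (rule sum.mono_neutral_right[OF finite_colourings], blast, rule ballI, rule ccontr)
      fix w assume w: "w \<in> colourings ?n ?n - ?F" and nz: "replica_val (rev u) (rev w) [] \<noteq> 0"
      have "descent 0 (rev w)"
        using w nz by (intro descent) (auto simp: colourings_def)
      then have "w \<in> motzkin_words_star"
        using descent_motzkin[of w] by (auto simp: motzkin_words_star_def)
      then show False
        using w by blast
    qed
    also have "\<dots> = (\<Sum>w\<in>?F. \<psi> w (N.cls u))"
      by (rule sum.cong) (auto simp: eval_eq colourings_def)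
    finally show "free_after_hom (N.cls u) =
        (\<Sum>w\<in>?F. \<psi> w (N.cls u))" .
  qed blast
qed

lemma boolean_product_motzkin:
  assumes "x \<in> carrier FS"
  shows "finite {w \<in> boolean_words_star. \<psi> w x \<noteq> 0} \<and>
    boolean_product_functional I A \<phi> x =
      (\<Sum>w | w \<in> boolean_words_star \<and> \<psi> w x \<noteq> 0. \<psi> w x)"
proof (rule functional_eq_sum[OF boolean_product_functional_props(1) _ _ assms])
  fix w assume "w \<in> boolean_words_star"
  then show "linear_functional FS (\<psi> w)"
    by (intro motzkin_functional_props(1) boolean_words_star_pos)
next
  fix u assume u: "u \<in> W"
  \<comment> \<open>The only constant word of the length of \<open>u\<close>, hence the only summand
    that can be nonzero at \<open>u\<close>.\<close>
  let ?w = "replicate (length u) (1::nat)"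
  have uL: "rev u \<in> lists L" and adj: "distinct_adj (map fst (rev (rev u)))"
    using u by (simp_all add: words_iff lists_eq_set)
  have "replica_val (rev u) (replicate (length (rev u)) 1) [] = (\<Prod>(i, a)\<leftarrow>rev u. \<phi> i a)"
    using uL adj
  proof (cases "rev u")
    case Nil
    then show ?thesis
      using replica_val_Nil[OF Nil_stacks(1)] by simp
  next
    case (Cons z v)
    obtain k b where z: "z = (k, b)"
      by fastforce
    have k: "k \<in> I" "b \<in> C k" "v \<in> lists L"
      using uL Cons z by (auto simp: letter_iff)
    have "distinct_adj (map fst (rev v @ [(k, b)]))"
      using adj Cons z by simp
    then show ?thesis
      using Cons z k replica_val_boolean[of v k b] replica_val_empty_stack[OF k(3,1,2), of "replicate (length v) 1" 1]
      by (simp add: letter_iff)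
  qed
  also have "(\<Prod>(i, a)\<leftarrow>rev u. \<phi> i a) = (\<Prod>(i, a)\<leftarrow>u. \<phi> i a)"
    by (simp add: prod_list.rev rev_map[symmetric])
  finally have eval_eq: "replica_val (rev u) ?w [] = (\<Prod>(i, a)\<leftarrow>u. \<phi> i a)"
    by simp
  have "?w \<in> boolean_words_star"
    by (auto simp: boolean_words_star_def)
  moreover have "\<psi> w (N.cls u) = (if length u = length w then (\<Prod>(i, a)\<leftarrow>u. \<phi> i a) else 0)"
    if "w \<in> boolean_words_star" for w
    using motzkin_functional_props(2)[OF boolean_words_star_pos[OF that] u] that eval_eq
    by (auto simp: boolean_words_star_def)
  moreover have "length u \<noteq> length w" if "w \<in> boolean_words_star - {?w}" for w
    using that by (auto simp: boolean_words_star_def)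
  ultimately show "\<exists>F. finite F \<and> F \<subseteq> boolean_words_star \<and>
      (\<forall>w\<in>boolean_words_star - F. \<psi> w (N.cls u) = 0) \<and>
      boolean_product_functional I A \<phi> (N.cls u) = (\<Sum>w\<in>F. \<psi> w (N.cls u))"
    using boolean_product_functional_props(2)[OF u] by (intro exI[of _ "{?w}"]) simp
qed

end

theorem theorem5p1:
  fixes I :: "'i set"
    and A :: "'i \<Rightarrow> 'a calg"
    and \<phi> :: "'i \<Rightarrow> 'a \<Rightarrow> complex"
  assumes "\<And>i. i \<in> I \<Longrightarrow> nc_prob_space (A i) (\<phi> i)"
  shows "(\<forall>x\<in>carrier (free_product_sep I A).
            finite {w \<in> motzkin_words_star. motzkin_functional I A \<phi> w x \<noteq> 0} \<and>
            free_product_functional I A \<phi> (canonical_hom I A x) =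
              (\<Sum>w | w \<in> motzkin_words_star \<and> motzkin_functional I A \<phi> w x \<noteq> 0.
                 motzkin_functional I A \<phi> w x)) \<and>
         (\<forall>x\<in>carrier (free_product_sep I A).
            finite {w \<in> boolean_words_star. motzkin_functional I A \<phi> w x \<noteq> 0} \<and>
            boolean_product_functional I A \<phi> x =
              (\<Sum>w | w \<in> boolean_words_star \<and> motzkin_functional I A \<phi> w x \<noteq> 0.
                 motzkin_functional I A \<phi> w x))"
proof -
  interpret nc_family I A \<phi>
    by (rule nc_family.intro) (rule nc_spaceI[OF assms])
  show ?thesis
    using free_product_motzkin boolean_product_motzkin by blast
qed

end
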